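(* Let $f = \exp\varphi$ be a log-concave probability density on $\mathbb{R}$ with distribution function $F$ and hazard function $h:=f/(1-F)$ on $\{F<1\}$. For each $n>1$ let $\hat f_n$ and $\hat F_n$ be the log-concave maximum likelihood estimators of $f$ and $F$ based on a random sample of size $n$ from $f$ with largest order statistic $X_n$, and let $$\hat h_n(x):=\frac{\hat f_n(x)}{1-\hat F_n(x)},\qquad x\in(-\infty,X_n).$$ Assume that $\varphi \in \mathcal{H}^{\beta,L}(T)$ for some $\beta \in [1,2]$, some $L>0$ and a compact subinterval $T=[A,B]$ (with $A<B$) of the interior of $\{f>0\}$. Assume further that there is a constant $C>0$ such that $\varphi'(x)-\varphi'(y)\ge C(y-x)$ for arbitrary $A\le x<y\le B$, where $\varphi'$ stands for $\varphi'(\cdot\,-)$ or $\varphi'(\cdot\,+)$. Then, with $\rho_n := \log(n)/n$ and $T(n,\beta) := [A + \rho_n^{1/(2\beta+1)},\, B - \rho_n^{1/(2\beta+1)}]$, as $n\to\infty$, $$\max_{t \in T(n,\beta)} |\hat h_n(t)-h(t)| = O_{\mathrm{p}}\bigl(\rho_n^{\beta/(2\beta+1)}\bigr).$$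
   Context: A probability density $f$ on $\mathbb{R}$ is log-concave if $f=\exp\varphi$ for some concave $\varphi:\mathbb{R}\to[-\infty,\infty)$ (with $\exp(-\infty)=0$). For each $n>1$, let $X_1<X_2<\dots<X_n$ be the order statistics of an i.i.d. sample of size $n$ from $f$ (almost surely distinct), with empirical distribution function $\mathbb{F}_n$. For concave $\varphi:\mathbb{R}\to[-\infty,\infty)$ put $\Psi_n(\varphi):=\int\varphi\,d\mathbb{F}_n-\int_{\mathbb{R}}\exp\varphi(x)\,dx$. The estimator $\hat\varphi_n$ is the maximizer of $\Psi_n$ over all concave functions $\mathbb{R}\to[-\infty,\infty)$. It is known that it exists, is unique, is linear on each $[X_j,X_{j+1}]$, $1\le j<n$, and equals $-\infty$ on $\mathbb{R}\setminus[X_1,X_n]$. Put $\hat f_n:=\exp\hat\varphi_n$ and $\hat F_n(x):=\int_{-\infty}^x\hat f_n(r)\,dr$; $\hat f_n$ is a probability density. Hölder classes: for an interval $I$, $\beta\in[1,2]$, $L>0$, a function $g:I\to\mathbb{R}$ belongs to $\mathcal{H}^{\beta,L}(I)$ if for all $x,y\in I$: $|g(x)-g(y)|\le L|x-y|$ in case $\beta=1$; $g$ is differentiable and $|g'(x)-g'(y)|\le L|x-y|^{\beta-1}$ in case $\beta>1$. $\varphi'(x-)$ and $\varphi'(x+)$ denote the left and right derivatives of $\varphi$ at $x$. $Z_n=O_{\mathrm p}(a_n)$ means $\lim_{C\to\infty}\limsup_{n\to\infty}\mathbb{P}(|Z_n|>C a_n)=0$. With probability tending to one, $X_n>B$, so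 $\hat h_n$ is defined on $T(n,\beta)$; $T(n,\beta)$ is a non-empty interval for all sufficiently large $n$. *)

theory Defs
  imports "HOL-Probability.Probability"
begin

definition ext_exp :: "ereal \<Rightarrow> real" where
  "ext_exp y = (if y = -\<infinity> then 0 else exp (real_of_ereal y))"

(* Concave functions from the reals to [-\<infinity>, \<infinity>).  The weights are restricted to 0 < t < 1,
   where the extended arithmetic has its usual meaning; t = 0 and t = 1 are trivial. *)
definition ext_concave :: "(real \<Rightarrow> ereal) \<Rightarrow> bool" where
  "ext_concave \<phi> \<longleftrightarrow>
     (\<forall>x. \<phi> x \<noteq> \<infinity>) \<and>
     (\<forall>x y t. 0 < t \<and> t < 1 \<longrightarrow>
        ereal (1 - t) * \<phi> x + ereal t * \<phi> y \<le> \<phi> ((1 - t) * x + t * y))"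

(* The sample is x 0, ..., x (n - 1) in any order; the average is the integral of \<phi> with respect
   to the empirical distribution.  As \<phi> < \<infinity>, no difference \<infinity> - \<infinity> arises, and the value is
   -\<infinity> if exp \<phi> has infinite integral. *)
definition Psi :: "nat \<Rightarrow> (nat \<Rightarrow> real) \<Rightarrow> (real \<Rightarrow> ereal) \<Rightarrow> ereal" where
  "Psi n x \<phi> = (\<Sum>i<n. \<phi> (x i)) / ereal (real n)
     - enn2ereal (\<integral>\<^sup>+ r. ennreal (ext_exp (\<phi> r)) \<partial>lborel)"

definition is_log_concave_mle :: "nat \<Rightarrow> (nat \<Rightarrow> real) \<Rightarrow> (real \<Rightarrow> ereal) \<Rightarrow> bool" where
  "is_log_concave_mle n x \<phi> \<longleftrightarrow>
     ext_concave \<phi> \<and> (\<forall>\<psi>. ext_concave \<psi> \<longrightarrow> Psi n x \<psi> \<le> Psi n x \<phi>)"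

(* Derivatives are taken within I, that is, one-sided at endpoints belonging to I. *)
definition holder_class :: "real \<Rightarrow> real \<Rightarrow> real set \<Rightarrow> (real \<Rightarrow> real) set" where
  "holder_class \<beta> L I = {g.
     if \<beta> = 1 then \<forall>x\<in>I. \<forall>y\<in>I. \<bar>g x - g y\<bar> \<le> L * \<bar>x - y\<bar>
     else \<exists>g'. (\<forall>x\<in>I. (g has_real_derivative g' x) (at x within I)) \<and>
               (\<forall>x\<in>I. \<forall>y\<in>I. \<bar>g' x - g' y\<bar> \<le> L * \<bar>x - y\<bar> powr (\<beta> - 1))}"

definition left_deriv :: "(real \<Rightarrow> real) \<Rightarrow> real \<Rightarrow> real" where
  "left_deriv g x = Lim (at_left x) (\<lambda>y. (g y - g x) / (y - x))"

definition right_deriv :: "(real \<Rightarrow> real) \<Rightarrow> real \<Rightarrow> real" where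
  "right_deriv g x = Lim (at_right x) (\<lambda>y. (g y - g x) / (y - x))"

definition distr_fun :: "(real \<Rightarrow> real) \<Rightarrow> real \<Rightarrow> real" where
  "distr_fun f x = (LBINT r:{..x}. f r)"

(* Meaningful only where distr_fun f x < 1. *)
definition hazard :: "(real \<Rightarrow> real) \<Rightarrow> real \<Rightarrow> real" where
  "hazard f x = f x / (1 - distr_fun f x)"

definition largest_obs :: "nat \<Rightarrow> (nat \<Rightarrow> real) \<Rightarrow> real" where
  "largest_obs n x = Max (x ` {..<n})"

(* Z n = O_p(a n), where Z n lives on the probability space M n.  The outer measure agrees with the
   measure on measurable events, so this is the usual notion for measurable Z n; it keeps the
   statement meaningful when measurability of Z n has not been established.  The value \<infinity> stands for
   an undefined Z n, which therefore always counts as exceeding the bound. *)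
definition bounded_in_prob ::
  "(nat \<Rightarrow> 'a measure) \<Rightarrow> (nat \<Rightarrow> 'a \<Rightarrow> ereal) \<Rightarrow> (nat \<Rightarrow> real) \<Rightarrow> bool" where
  "bounded_in_prob M Z a \<longleftrightarrow>
     ((\<lambda>K::real. limsup (\<lambda>n. outer_measure_of (M n)
         {\<omega> \<in> space (M n). \<bar>Z n \<omega>\<bar> > ereal (K * a n)})) \<longlongrightarrow> 0) at_top"

definition rho :: "nat \<Rightarrow> real" where
  "rho n = ln (real n) / real n"

definition T_shrunk :: "real \<Rightarrow> real \<Rightarrow> nat \<Rightarrow> real \<Rightarrow> real set" where
  "T_shrunk A B n \<beta> =
     {A + rho n powr (1 / (2 * \<beta> + 1)) .. B - rho n powr (1 / (2 * \<beta> + 1))}"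

(* The maximal distance over S between the estimated hazard rate, which exists only to the left of
   the largest observation Xmax, and the true one; \<infinity> if S is not contained in (-\<infinity>, Xmax).
   The supremum is the maximum whenever the latter exists. *)
definition hazard_error ::
  "real \<Rightarrow> (real \<Rightarrow> real) \<Rightarrow> (real \<Rightarrow> real) \<Rightarrow> real set \<Rightarrow> ereal" where
  "hazard_error Xmax fh f S =
     (if S \<subseteq> {..<Xmax} then (SUP t\<in>S. ereal \<bar>hazard fh t - hazard f t\<bar>) else \<infinity>)"

end

theory Submission
  imports Defs "HOL-Real_Asymp.Real_Asymp"
begin

text \<open>
  Write \<open>\<psi>\<close> for the difference of the estimated and the true log-density, and let \<open>T \<Delta>\<close> be the
  integral of \<open>\<Delta>\<close> against the empirical measure minus its integral against the estimated density.
  Maximality gives \<open>T \<Delta> \<le> 0\<close> whenever the estimator stays concave after adding a small multiple of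
  \<open>\<Delta>\<close>; at a knot of the (piecewise linear) estimator this admits convex kinks and jumps.

  With probability tending to one, the empirical measure \<open>\<mu>\<close> of every interval \<open>I\<close> deviates from its
  true measure \<open>\<nu>\<close> by at most a constant times \<open>sqrt (\<nu> I * \<rho>) + \<rho>\<close> (Bernstein's inequality on a grid
  of quantiles), and the sample range is \<open>O (ln n)\<close>. The rest is deterministic. If \<open>\<psi>\<close> is of order
  \<open>\<epsilon>\<close> at a point, then, \<open>\<phi>\<close> being approximately linear at the scale \<open>\<delta>\<close> by the Hoelder condition,
  \<open>\<psi>\<close> keeps a constant sign and the order \<open>\<epsilon>\<close> on an interval of length of order \<open>\<delta>\<close>. This interval
  contains two distant knots or a long piece on which the estimator is linear, so that \<open>\<psi>\<close> is convex
  on the surrounding linear piece. In either case a test function \<open>\<Delta>\<close> (an indicator, a ramp, or a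
  tent continued linearly below zero) has a signal of order at least \<open>\<epsilon>\<close> times its noise divided by
  \<open>sqrt (\<rho> / \<delta>)\<close>, which forces \<open>\<epsilon>\<^sup>2 \<delta> = O \<rho>\<close>. Strict concavity of \<open>\<phi>\<close> then forces a
  knot inside the interval; there the estimated and the true distribution functions are close, and
  integrating the density bound from this knot yields the claim for the hazard rate.
\<close>

section \<open>Extended concave functions\<close>

text \<open>Nothing is known beforehand about the estimator outside \<open>[A, B]\<close>, and the
  linear piece that meets a deviation window may reach far beyond it, where \<open>f\<close> has no
  lower bound. On such a piece the crude noise \<open>\<eta> 1\<close>, of order
  \<open>sqrt \<rho>\<close>, acquires two factors of the sample range: one for the length of the
  support, one because the slope of the test function may be as small as its height divided by that
  length. So \<open>(ln n)\<^sup>2 * sqrt \<rho>\<close> has to be negligible against \<epsilon>;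
  this follows from \<open>\<epsilon> \<ge> \<rho> powr (2 / 5)\<close>, and here
  \<open>\<beta> \<le> 2\<close> enters. On short pieces noise and signal balance through
  \<open>\<epsilon> = \<delta> powr \<beta>\<close> and
  \<open>\<epsilon>\<^sup>2 * \<delta> = \<rho>\<close>. A tent cut off at its zeros would create
  convex kinks at points that need not be knots. Hence it is continued linearly to the ends of the
  piece. The negative parts still add to the signal, since \<open>\<phi> - g\<close> is concave
  there and lies below them. Strict concavity enters through the gap of \<phi> over one fixed chord,
  which eventually exceeds the error of the estimator.\<close>

lemma ext_exp_nonneg [simp]: "0 \<le> ext_exp y"
  by (simp add: ext_exp_def)

lemma ext_exp_ereal [simp]: "ext_exp (ereal r) = exp r"
  by (simp add: ext_exp_def)

lemma ext_exp_MInfty [simp]: "ext_exp (-\<infinity>) = 0"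
  by (simp add: ext_exp_def)

lemma ext_concave_less_PInfty: "ext_concave \<phi> \<Longrightarrow> \<phi> x \<noteq> \<infinity>"
  by (simp add: ext_concave_def)

lemma ext_concave_finite:
  "ext_concave \<phi> \<Longrightarrow> \<phi> x \<noteq> -\<infinity> \<Longrightarrow> \<phi> x = ereal (real_of_ereal (\<phi> x))"
  using ext_concave_less_PInfty[of \<phi> x] by (cases "\<phi> x") auto

lemma ext_concave_combination:
  assumes "ext_concave \<phi>" "\<phi> x \<noteq> -\<infinity>" "\<phi> y \<noteq> -\<infinity>" "0 \<le> t" "t \<le> 1"
  shows "ereal ((1 - t) * real_of_ereal (\<phi> x) + t * real_of_ereal (\<phi> y)) \<le> \<phi> ((1 - t) * x + t * y)"
proof -
  obtain a b where ab: "\<phi> x = ereal a" "\<phi> y = ereal b"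
    using ext_concave_finite[OF assms(1)] assms(2,3) by blast
  consider "t = 0" | "t = 1" | "0 < t" "t < 1" using assms(4,5) by linarith
  then show ?thesis
  proof cases
    case 3
    then have "ereal (1 - t) * \<phi> x + ereal t * \<phi> y \<le> \<phi> ((1 - t) * x + t * y)"
      using assms(1) unfolding ext_concave_def by blast
    then show ?thesis by (simp add: ab)
  qed (use ab in auto)
qed

lemma ext_concave_imp_concave_on:
  assumes "ext_concave \<phi>"
  shows "concave_on {x. \<phi> x \<noteq> -\<infinity>} (\<lambda>x. real_of_ereal (\<phi> x))"
proof -
  have *: "\<phi> ((1 - t) * x + t * y) \<noteq> -\<infinity> \<and>
      (1 - t) * real_of_ereal (\<phi> x) + t * real_of_ereal (\<phi> y) \<le> real_of_ereal (\<phi> ((1 - t) * x + t * y))"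
    if "\<phi> x \<noteq> -\<infinity>" "\<phi> y \<noteq> -\<infinity>" "0 \<le> t" "t \<le> 1" for x y t
  proof -
    have "\<phi> ((1 - t) * x + t * y) \<noteq> \<infinity>" using assms by (simp add: ext_concave_def)
    then show ?thesis using ext_concave_combination[OF assms that]
      by (cases "\<phi> ((1 - t) * x + t * y)") auto
  qed
  have "u * x + v * y \<in> {x. \<phi> x \<noteq> -\<infinity>} \<and>
      u * real_of_ereal (\<phi> x) + v * real_of_ereal (\<phi> y) \<le> real_of_ereal (\<phi> (u * x + v * y))"
    if "\<phi> x \<noteq> -\<infinity>" "\<phi> y \<noteq> -\<infinity>" "u \<ge> 0" "v \<ge> 0" "u + v = 1" for x y u v
  proof -
    have u: "u = 1 - v" using that by simp
    show ?thesis unfolding u using *[of x y v] that by simp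
  qed
  then show ?thesis unfolding concave_on_iff convex_def by auto
qed

text \<open>Source of the competitors of the estimator. Since the weights are strictly positive, one
  argument outside \<open>{l..u}\<close> already makes the left-hand side -\<infinity>.\<close>

lemma ext_concave_cut:
  assumes "concave_on {l..u} g"
  shows "ext_concave (\<lambda>x. if x \<in> {l..u} then ereal (g x) else -\<infinity>)"
  unfolding ext_concave_def
proof (intro conjI allI impI)
  fix x y t :: real assume t: "0 < t \<and> t < 1"
  show "ereal (1 - t) * (if x \<in> {l..u} then ereal (g x) else -\<infinity>) +
    ereal t * (if y \<in> {l..u} then ereal (g y) else -\<infinity>)
    \<le> (if (1 - t) * x + t * y \<in> {l..u} then ereal (g ((1 - t) * x + t * y)) else -\<infinity>)"
  proof (cases "x \<in> {l..u} \<and> y \<in> {l..u}")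
    case True
    then have "(1 - t) * x + t * y \<in> {l..u}"
      using concave_on_imp_convex[OF assms] t unfolding convex_def by auto
    moreover have "(1 - t) * g x + t * g y \<le> g ((1 - t) * x + t * y)"
      using assms True t unfolding concave_on_iff by auto
    ultimately show ?thesis using True by auto
  next
    case False
    then show ?thesis using t by auto
  qed
qed auto

section \<open>Measurability and exponential tails of log-concave functions\<close>

lemma ext_exp_pos_iff: "0 < ext_exp y \<longleftrightarrow> y \<noteq> -\<infinity>"
  by (simp add: ext_exp_def)

lemma ext_exp_less_iff:
  assumes "y \<noteq> \<infinity>" "0 < c"
  shows "c < ext_exp y \<longleftrightarrow> ereal (ln c) < y"
proof (cases y)
  case (real r)
  then show ?thesis using assms ln_less_cancel_iff[of c "exp r"] by simp
qed (use assms in auto)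

text \<open>Concavity makes each set \<open>{x. ereal a < \<phi> x}\<close> an interval, hence
  Borel. Level \<open>0\<close> of the density corresponds to no real level of \<phi> and is
  exhausted by the levels \<open>- k\<close>.\<close>

lemma borel_measurable_ext_exp_concave:
  assumes "ext_concave \<phi>"
  shows "(\<lambda>x. ext_exp (\<phi> x)) \<in> borel_measurable borel"
proof (rule borel_measurableI_greater)
  fix c :: real
  have iv: "{x. ereal a < \<phi> x} \<in> sets borel" for a
  proof (rule real_interval_borel_measurable)
    have "convex {x. ereal a < \<phi> x}"
      unfolding convex_alt
    proof (intro ballI allI impI)
      fix x y t :: real assume xy: "x \<in> {x. ereal a < \<phi> x}" "y \<in> {x. ereal a < \<phi> x}" and t: "0 \<le> t \<and> t \<le> 1"
      have "\<phi> x \<noteq> -\<infinity>" "\<phi> y \<noteq> -\<infinity>" using xy by auto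
      then obtain p q where pq: "\<phi> x = ereal p" "\<phi> y = ereal q"
        using ext_concave_finite[OF assms] by blast
      then have "a < p" "a < q" using xy by auto
      then have "a < (1 - t) * p + t * q"
        using t convex_bound_lt[of "-p" "-a" "-q" "1 - t" t] by auto
      also have "ereal \<dots> \<le> \<phi> ((1 - t) * x + t * y)"
        using ext_concave_combination[OF assms, of x y t] pq t by auto
      finally show "(1 - t) *\<^sub>R x + t *\<^sub>R y \<in> {x. ereal a < \<phi> x}" by simp
    qed
    then show "is_interval {x. ereal a < \<phi> x}" by (simp add: is_interval_convex_1)
  qed
  have "\<phi> x \<noteq> \<infinity>" for x using assms by (simp add: ext_concave_def)
  then have eq: "{x. c < ext_exp (\<phi> x)} = {x. ereal (ln c) < \<phi> x}" if "0 < c"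
    using ext_exp_less_iff that by blast
  consider "c < 0" | "c = 0" | "0 < c" by linarith
  then show "{x \<in> space borel. c < ext_exp (\<phi> x)} \<in> sets borel"
  proof cases
    case 1
    then have "{x. c < ext_exp (\<phi> x)} = UNIV" by (auto intro: less_le_trans[OF _ ext_exp_nonneg])
    then show ?thesis by simp
  next
    case 2
    have "{x. 0 < ext_exp (\<phi> x)} = (\<Union>k::nat. {x. ereal (- real k) < \<phi> x})"
    proof (intro set_eqI iffI)
      fix x assume "x \<in> {x. 0 < ext_exp (\<phi> x)}"
      then obtain r where "\<phi> x = ereal r"
        using \<open>\<phi> x \<noteq> \<infinity>\<close> by (cases "\<phi> x") (auto simp: ext_exp_pos_iff)
      moreover obtain k :: nat where "- r < real k" using reals_Archimedean2 by blast
      ultimately show "x \<in> (\<Union>k::nat. {x. ereal (- real k) < \<phi> x})" by (auto intro!: exI[of _ k])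
    qed (auto simp: ext_exp_pos_iff)
    then show ?thesis using 2 iv by auto
  qed (use eq iv in simp)
qed

text \<open>With \<open>t\<close> chosen so that \<open>b\<close> is the convex combination of
  \<open>a\<close> and \<open>x\<close>, concavity at \<open>b\<close> bounds
  \<open>\<phi> x\<close> by the chord through \<open>a\<close> and \<open>b\<close>, extended to
  the right.\<close>

lemma ext_concave_chord_bound:
  assumes "ext_concave \<phi>" "\<phi> a \<noteq> -\<infinity>" "\<phi> b \<noteq> -\<infinity>" "a < b" "b \<le> x"
  shows "ext_exp (\<phi> x) \<le> exp (real_of_ereal (\<phi> b) +
     (real_of_ereal (\<phi> b) - real_of_ereal (\<phi> a)) / (b - a) * (x - b))"
proof (cases "\<phi> x = -\<infinity>")
  case False
  define t where "t = (b - a) / (x - a)"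
  have t: "0 \<le> t" "t \<le> 1" using assms by (auto simp: t_def field_simps)
  have b: "(1 - t) * a + t * x = b"
  proof -
    have "(1 - t) * a + t * x = a + t * (x - a)" by (simp add: algebra_simps)
    also have "t * (x - a) = b - a" using assms(4,5) by (simp add: t_def)
    finally show ?thesis by simp
  qed
  obtain p q where pq: "\<phi> b = ereal p" "\<phi> x = ereal q"
    using ext_concave_finite[OF assms(1)] assms(3) False by blast
  have "(1 - t) * real_of_ereal (\<phi> a) + t * q \<le> p"
    using ext_concave_combination[OF assms(1,2) False t] b pq by auto
  then have "(1 - t) * real_of_ereal (\<phi> a) + t * q \<le> (1 - t) * p + t * p" by (simp add: algebra_simps)
  then have "t * (q - p) \<le> (1 - t) * (p - real_of_ereal (\<phi> a))" by (simp add: algebra_simps)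
  also have "1 - t = t * ((x - b) / (b - a))"
  proof -
    have "1 - t = ((x - a) - (b - a)) / (x - a)"
      unfolding t_def by (subst diff_divide_distrib) (use assms(4,5) in simp)
    then show ?thesis using assms(4,5) by (simp add: t_def)
  qed
  finally have "t * (q - p) \<le> t * ((x - b) / (b - a) * (p - real_of_ereal (\<phi> a)))" by (simp add: mult.assoc)
  moreover have "t > 0" using assms(4,5) by (simp add: t_def)
  ultimately have "q - p \<le> (x - b) / (b - a) * (p - real_of_ereal (\<phi> a))" using mult_le_cancel_left_pos by blast
  then have "q \<le> p + (p - real_of_ereal (\<phi> a)) / (b - a) * (x - b)" by (simp add: mult.commute)
  then show ?thesis using pq by simp
qed simp

text \<open>If no value beyond \<open>b\<close> fell below the one at \<open>b\<close>, the integral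
  over \<open>{b<..}\<close> would be infinite. Once the density has fallen, at \<open>x1\<close>,
  the extended chord has negative slope and forces exponential decay; if
  \<open>\<phi> x1 = -\<infinity>\<close>, convexity of the domain makes the tail vanish.\<close>

lemma log_concave_right_tail:
  assumes conc: "ext_concave \<phi>" and int: "(\<integral>\<^sup>+ x. ennreal (ext_exp (\<phi> x)) \<partial>lborel) < \<infinity>"
    and b: "\<phi> b \<noteq> -\<infinity>"
  shows "\<exists>\<alpha>>0. \<exists>K>0. \<exists>x0. \<forall>x\<ge>x0. ext_exp (\<phi> x) \<le> K * exp (- \<alpha> * x)"
proof -
  have "\<exists>x1>b. ext_exp (\<phi> x1) < ext_exp (\<phi> b)"
  proof (rule ccontr)
    assume "\<not> ?thesis"
    then have ge: "ext_exp (\<phi> b) \<le> ext_exp (\<phi> x)" if "x > b" for x using that not_less by blast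
    have "(\<integral>\<^sup>+ x. ennreal (ext_exp (\<phi> b)) * indicator {b<..} x \<partial>lborel) \<le> (\<integral>\<^sup>+ x. ennreal (ext_exp (\<phi> x)) \<partial>lborel)"
      by (intro nn_integral_mono) (auto simp: indicator_def ge ennreal_leI)
    moreover have "(\<integral>\<^sup>+ x. ennreal (ext_exp (\<phi> b)) * indicator {b<..} x \<partial>lborel) = \<infinity>"
    proof -
      have "emeasure lborel {b<..} = \<infinity>"
      proof (rule ccontr)
        assume fin: "emeasure lborel {b<..} \<noteq> \<infinity>"
        have "ennreal (real k) \<le> emeasure lborel {b<..}" for k :: nat
        proof -
          have "emeasure lborel {b<..b + real k} \<le> emeasure lborel {b<..}" by (intro emeasure_mono) auto
          then show ?thesis by simp
        qed
        moreover obtain k where "emeasure lborel {b<..} < of_nat k"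
          using fin ennreal_Ex_less_of_nat by (auto simp: less_top)
        ultimately show False by (metis ennreal_of_nat_eq_real_of_nat leD)
      qed
      moreover have "0 < ext_exp (\<phi> b)" using b by (simp add: ext_exp_pos_iff)
      ultimately show ?thesis by (simp add: nn_integral_cmult_indicator ennreal_mult_top)
    qed
    ultimately show False using int by simp
  qed
  then obtain x1 where x1: "b < x1" "ext_exp (\<phi> x1) < ext_exp (\<phi> b)" by blast
  show ?thesis
  proof (cases "\<phi> x1 = -\<infinity>")
    case True
    have "ext_exp (\<phi> x) = 0" if "x \<ge> x1" for x
    proof (rule ccontr)
      assume "ext_exp (\<phi> x) \<noteq> 0"
      then have "\<phi> x \<noteq> -\<infinity>" by auto
      then have "x1 \<in> {x. \<phi> x \<noteq> -\<infinity>}"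
        using concave_on_imp_convex[OF ext_concave_imp_concave_on[OF conc], folded is_interval_convex_1]
          b that x1(1) mem_is_interval_1_I[of "{x. \<phi> x \<noteq> -\<infinity>}" b x x1] by auto
      with True show False by simp
    qed
    then show ?thesis by (intro exI[of _ 1] conjI exI[of _ x1]) auto
  next
    case False
    define p q where "p = real_of_ereal (\<phi> b)" and "q = real_of_ereal (\<phi> x1)"
    have "\<phi> b \<noteq> \<infinity>" "\<phi> x1 \<noteq> \<infinity>" using conc by (auto simp: ext_concave_def)
    then have pq: "\<phi> b = ereal p" "\<phi> x1 = ereal q" using b False
      by (auto simp: p_def q_def ereal_real)
    with x1 have "q < p" by simp
    define \<alpha> where "\<alpha> = (p - q) / (x1 - b)"
    have "\<alpha> > 0" using \<open>q < p\<close> x1 by (simp add: \<alpha>_def)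
    have "ext_exp (\<phi> x) \<le> exp (q + \<alpha> * x1) * exp (- \<alpha> * x)" if "x \<ge> x1" for x
    proof -
      have "ext_exp (\<phi> x) \<le> exp (q + (q - p) / (x1 - b) * (x - x1))"
        using ext_concave_chord_bound[OF conc b False x1(1) that] pq by simp
      also have "q + (q - p) / (x1 - b) * (x - x1) = (q + \<alpha> * x1) + (- \<alpha> * x)"
      proof -
        have "(q - p) / (x1 - b) = - \<alpha>" by (simp add: \<alpha>_def minus_divide_left)
        then show ?thesis by (simp add: algebra_simps)
      qed
      finally show ?thesis by (simp only: exp_add)
    qed
    then show ?thesis using \<open>\<alpha> > 0\<close> by (intro exI[of _ \<alpha>] conjI exI[of _ "exp (q + \<alpha> * x1)"] exI[of _ x1]) auto
  qed
qed

lemma ext_concave_reflect: "ext_concave \<phi> \<Longrightarrow> ext_concave (\<lambda>x. \<phi> (- x))"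
  unfolding ext_concave_def
proof (intro conjI allI impI)
  fix x y t :: real
  assume *: "(\<forall>x. \<phi> x \<noteq> \<infinity>) \<and> (\<forall>x y t. 0 < t \<and> t < 1 \<longrightarrow>
        ereal (1 - t) * \<phi> x + ereal t * \<phi> y \<le> \<phi> ((1 - t) * x + t * y))" and t: "0 < t \<and> t < 1"
  then have "ereal (1 - t) * \<phi> (-x) + ereal t * \<phi> (-y) \<le> \<phi> ((1 - t) * (-x) + t * (-y))" by blast
  also have "(1 - t) * (-x) + t * (-y) = - ((1 - t) * x + t * y)" by (simp add: algebra_simps)
  finally show "ereal (1 - t) * \<phi> (-x) + ereal t * \<phi> (-y) \<le> \<phi> (- ((1 - t) * x + t * y))" .
qed blast

text \<open>Moves the threshold of the tail bound to a prescribed \<open>b\<close>: between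
  \<open>b\<close> and \<open>x0\<close> the chord through \<open>a\<close> and \<open>b\<close> is
  bounded, so a larger constant is enough.\<close>

lemma log_concave_right_bound:
  assumes conc: "ext_concave \<phi>" and int: "(\<integral>\<^sup>+ x. ennreal (ext_exp (\<phi> x)) \<partial>lborel) < \<infinity>"
    and ab: "\<phi> a \<noteq> -\<infinity>" "\<phi> b \<noteq> -\<infinity>" "a < b"
  shows "\<exists>\<alpha>>0. \<exists>K>0. \<forall>x\<ge>b. ext_exp (\<phi> x) \<le> K * exp (- \<alpha> * x)"
proof -
  obtain \<alpha> K x0 where tail: "\<alpha> > 0" "K > 0" "\<And>x. x \<ge> x0 \<Longrightarrow> ext_exp (\<phi> x) \<le> K * exp (- \<alpha> * x)"
    using log_concave_right_tail[OF conc int ab(2)] by blast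
  define p s where "p = real_of_ereal (\<phi> b)" and "s = (p - real_of_ereal (\<phi> a)) / (b - a)"
  define K' where "K' = exp (\<bar>p\<bar> + \<bar>s\<bar> * \<bar>x0 - b\<bar> + \<alpha> * \<bar>x0\<bar>)"
  have "ext_exp (\<phi> x) \<le> max K K' * exp (- \<alpha> * x)" if "x \<ge> b" for x
  proof (cases "x \<ge> x0")
    case True
    then have "ext_exp (\<phi> x) \<le> K * exp (- \<alpha> * x)" using tail by blast
    also have "\<dots> \<le> max K K' * exp (- \<alpha> * x)" by (intro mult_right_mono) auto
    finally show ?thesis .
  next
    case False
    have "ext_exp (\<phi> x) \<le> exp (p + s * (x - b))"
      using ext_concave_chord_bound[OF conc ab that] by (simp add: p_def s_def)
    also have "\<dots> \<le> exp ((\<bar>p\<bar> + \<bar>s\<bar> * \<bar>x0 - b\<bar> + \<alpha> * \<bar>x0\<bar>) + (- \<alpha> * x))"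
    proof -
      have "s * (x - b) \<le> \<bar>s\<bar> * \<bar>x0 - b\<bar>"
      proof -
        have "s * (x - b) \<le> \<bar>s\<bar> * (x - b)" using that by (intro mult_right_mono) auto
        also have "\<dots> \<le> \<bar>s\<bar> * \<bar>x0 - b\<bar>" using that False by (intro mult_left_mono) auto
        finally show ?thesis .
      qed
      moreover have "\<alpha> * x \<le> \<alpha> * \<bar>x0\<bar>" using False tail(1) by (intro mult_left_mono) auto
      ultimately show ?thesis by simp
    qed
    also have "\<dots> = K' * exp (- \<alpha> * x)" by (simp only: K'_def exp_add)
    also have "\<dots> \<le> max K K' * exp (- \<alpha> * x)" by (intro mult_right_mono) auto
    finally show ?thesis .
  qed
  moreover have "max K K' > 0" using tail(2) by simp
  ultimately show ?thesis using tail(1) by blast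
qed

lemma log_concave_tail:
  assumes conc: "ext_concave \<phi>" and int: "(\<integral>\<^sup>+ x. ennreal (ext_exp (\<phi> x)) \<partial>lborel) < \<infinity>"
    and ab: "\<phi> a \<noteq> -\<infinity>" "\<phi> b \<noteq> -\<infinity>" "a < b"
  shows "\<exists>\<alpha>>0. \<exists>K>0. \<forall>x. ext_exp (\<phi> x) \<le> K * exp (- \<alpha> * \<bar>x\<bar>)"
proof -
  define m where "m = (a + b) / 2"
  have m: "a < m" "m < b" using ab by (auto simp: m_def)
  have "convex {x. \<phi> x \<noteq> -\<infinity>}"
    using concave_on_imp_convex[OF ext_concave_imp_concave_on[OF conc]] .
  then have pm: "\<phi> m \<noteq> -\<infinity>"
    using m ab mem_is_interval_1_I[of "{x. \<phi> x \<noteq> -\<infinity>}" a b m] by (auto simp: is_interval_convex_1)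
  obtain \<alpha>1 K1 where 1: "\<alpha>1 > 0" "K1 > 0" "\<And>x. x \<ge> m \<Longrightarrow> ext_exp (\<phi> x) \<le> K1 * exp (- \<alpha>1 * x)"
    using log_concave_right_bound[OF conc int ab(1) pm m(1)] by blast
  have int': "(\<integral>\<^sup>+ x. ennreal (ext_exp (\<phi> (- x))) \<partial>lborel) < \<infinity>"
    using int borel_measurable_ext_exp_concave[OF conc]
      nn_integral_real_affine[of "\<lambda>x. ennreal (ext_exp (\<phi> x))" "-1" 0] by simp
  obtain \<alpha>2 K2 where 2: "\<alpha>2 > 0" "K2 > 0" "\<And>x. x \<ge> - m \<Longrightarrow> ext_exp (\<phi> (- x)) \<le> K2 * exp (- \<alpha>2 * x)"
    using log_concave_right_bound[OF ext_concave_reflect[OF conc] int', of "- b" "- m"] pm ab m by auto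
  define \<alpha> where "\<alpha> = min \<alpha>1 \<alpha>2"
  \<comment> \<open>A point between 0 and \<open>m\<close> may have the sign opposite to that of the
    one-sided exponent. Its modulus is at most \<open>\<bar>m\<bar>\<close>, so the additional
    exponential factors compensate.\<close>
  define K where "K = max (K1 * exp (2 * \<alpha>1 * \<bar>m\<bar>)) (K2 * exp (2 * \<alpha>2 * \<bar>m\<bar>))"
  have aux: "- \<beta> * y \<le> 2 * \<beta> * \<bar>m\<bar> - \<alpha> * \<bar>y\<bar>" if "\<alpha> \<le> \<beta>" "\<beta> > 0" "- \<bar>m\<bar> \<le> y" for \<beta> y
  proof (cases "y \<ge> 0")
    case True
    have "\<alpha> * y \<le> \<beta> * y" using that True by (intro mult_right_mono) auto
    moreover have "0 \<le> 2 * \<beta> * \<bar>m\<bar>" using that by simp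
    ultimately show ?thesis using True by simp
  next
    case False
    have "\<alpha> * \<bar>y\<bar> \<le> \<beta> * \<bar>y\<bar>" using that by (intro mult_right_mono) auto
    moreover have "\<beta> * \<bar>y\<bar> \<le> \<beta> * \<bar>m\<bar>" using that False by (intro mult_left_mono) auto
    moreover have "- \<beta> * y = \<beta> * \<bar>y\<bar>" using False by simp
    ultimately show ?thesis by linarith
  qed
  have "ext_exp (\<phi> x) \<le> K * exp (- \<alpha> * \<bar>x\<bar>)" for x
  proof (cases "x \<ge> m")
    case True
    have "ext_exp (\<phi> x) \<le> K1 * exp (- \<alpha>1 * x)" using 1 True by blast
    also have "\<dots> \<le> K1 * exp (2 * \<alpha>1 * \<bar>m\<bar> + - \<alpha> * \<bar>x\<bar>)"
      using aux[of \<alpha>1 x] 1 True by (intro mult_left_mono) (auto simp: \<alpha>_def)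
    also have "\<dots> = (K1 * exp (2 * \<alpha>1 * \<bar>m\<bar>)) * exp (- \<alpha> * \<bar>x\<bar>)" by (simp only: exp_add mult.assoc)
    also have "\<dots> \<le> K * exp (- \<alpha> * \<bar>x\<bar>)" unfolding K_def by (intro mult_right_mono) auto
    finally show ?thesis .
  next
    case False
    have "ext_exp (\<phi> x) \<le> K2 * exp (\<alpha>2 * x)" using 2(3)[of "- x"] False by simp
    also have "\<dots> \<le> K2 * exp (2 * \<alpha>2 * \<bar>m\<bar> + - \<alpha> * \<bar>x\<bar>)"
      using aux[of \<alpha>2 "- x"] 2 False by (intro mult_left_mono) (auto simp: \<alpha>_def)
    also have "\<dots> = (K2 * exp (2 * \<alpha>2 * \<bar>m\<bar>)) * exp (- \<alpha> * \<bar>x\<bar>)" by (simp only: exp_add mult.assoc)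
    also have "\<dots> \<le> K * exp (- \<alpha> * \<bar>x\<bar>)" unfolding K_def by (intro mult_right_mono) auto
    finally show ?thesis .
  qed
  moreover have "\<alpha> > 0" "K > 0" using 1 2 by (auto simp: \<alpha>_def K_def less_max_iff_disj)
  ultimately show ?thesis by blast
qed

section \<open>Empirical measures of intervals\<close>

text \<open>A pushforward of the uniform measure on indices: ties count with multiplicity, and the
  sample need not be ordered.\<close>

definition empirical :: "nat \<Rightarrow> (nat \<Rightarrow> real) \<Rightarrow> real measure" where
  "empirical n x = distr (uniform_count_measure {..<n}) borel x"

lemma sets_empirical [simp, measurable_cong]: "sets (empirical n x) = sets borel"
  by (simp add: empirical_def)

lemma space_empirical [simp]: "space (empirical n x) = UNIV"
  by (simp add: empirical_def)

lemma prob_space_empirical: "n > 0 \<Longrightarrow> prob_space (empirical n x)"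
  unfolding empirical_def
  by (intro prob_space.prob_space_distr prob_space_uniform_count_measure)
    (auto simp: measurable_def space_uniform_count_measure sets_uniform_count_measure)

lemma integral_empirical:
  fixes g :: "real \<Rightarrow> real"
  assumes "g \<in> borel_measurable borel"
  shows "integral\<^sup>L (empirical n x) g = (\<Sum>i<n. g (x i)) / n"
proof -
  have "x \<in> measurable (uniform_count_measure {..<n}) borel"
    by (auto simp: measurable_def space_uniform_count_measure sets_uniform_count_measure)
  then show ?thesis using assms
    by (simp add: empirical_def integral_distr integral_uniform_count_measure)
qed

lemma measure_empirical:
  assumes "S \<in> sets borel"
  shows "measure (empirical n x) S = (\<Sum>i<n. indicator S (x i)) / n"
proof -
  have "measure (empirical n x) S = integral\<^sup>L (empirical n x) (indicator S)"
    by simp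
  also have "\<dots> = (\<Sum>i<n. indicator S (x i)) / n"
    using assms by (intro integral_empirical) simp
  finally show ?thesis .
qed

section \<open>Bernstein's inequality for the frequency of a Borel set\<close>

lemma exp_le_quadratic:
  fixes x :: real
  assumes "\<bar>x\<bar> \<le> 1"
  shows "exp x \<le> 1 + x + x\<^sup>2"
proof (cases "0 \<le> x")
  case True
  then show ?thesis using exp_bound[of x] assms by simp
next
  case False
  define y where "y = - x"
  have y: "0 < y" "y \<le> 1" using False assms by (auto simp: y_def)
  have "exp (- y) = 1 / exp y" by (simp add: exp_minus inverse_eq_divide)
  also have "\<dots> \<le> 1 / (1 + y)" using y exp_ge_add_one_self[of y] by (intro divide_left_mono mult_pos_pos) auto
  also have "\<dots> \<le> 1 - y + y\<^sup>2"
  proof -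
    have "1 \<le> 1 + y ^ 3" using y by simp
    also have "\<dots> = (1 - y + y\<^sup>2) * (1 + y)" by (simp add: algebra_simps power2_eq_square power3_eq_cube)
    finally show ?thesis using y by (simp add: pos_divide_le_eq)
  qed
  finally show ?thesis by (simp add: y_def)
qed

text \<open>Exponential Chebyshev bound. The moment generating function of one summand is at most
  \<open>exp (p * \<theta>\<^sup>2)\<close>: the variance proxy is the mass \<open>p\<close> of
  \<open>S\<close>, not a constant, which later gives short intervals small noise. The sign \<sigma>
  covers both tails.\<close>

lemma (in prob_space) Bernstein_indicator:
  fixes \<sigma> \<theta> p t :: real
  assumes fin: "finite I" and indep: "indep_vars (\<lambda>_. borel) X I" and S: "S \<in> sets borel"
    and p: "\<And>i. i \<in> I \<Longrightarrow> prob {\<omega> \<in> space M. X i \<omega> \<in> S} = p"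
    and \<theta>: "0 < \<theta>" "\<theta> \<le> 1" and \<sigma>: "\<bar>\<sigma>\<bar> = 1"
  shows "prob {\<omega> \<in> space M. t \<le> (\<Sum>i\<in>I. \<sigma> * (indicator S (X i \<omega>) - p))} \<le>
    exp (card I * p * \<theta>\<^sup>2 - \<theta> * t)"
proof -
  define Y where "Y i \<omega> = exp (\<theta> * \<sigma> * (indicator S (X i \<omega>) - p))" for i \<omega>
  have X[measurable]: "random_variable borel (X i)" if "i \<in> I" for i
    using indep that by (auto simp: indep_vars_def)
  have [measurable]: "(\<lambda>x. indicator S x :: real) \<in> borel_measurable borel" using S by simp
  have indepY: "indep_vars (\<lambda>_. borel) Y I"
    unfolding Y_def using indep
    by (rule indep_vars_compose2)
      measurable
  have mY[measurable]: "random_variable borel (Y i)" if "i \<in> I" for i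
    using indepY that by (auto simp: indep_vars_def)
  have Yb: "\<bar>Y i \<omega>\<bar> \<le> exp (1 + \<bar>p\<bar>)" for i \<omega>
  proof -
    have "\<theta> * \<sigma> * (indicator S (X i \<omega>) - p) \<le> \<bar>\<theta> * \<sigma> * (indicator S (X i \<omega>) - p)\<bar>" by simp
    also have "\<dots> = \<theta> * \<bar>indicator S (X i \<omega>) - p\<bar>" using \<sigma> \<theta> by (simp add: abs_mult)
    also have "\<dots> \<le> 1 * (1 + \<bar>p\<bar>)"
      using \<theta> by (intro mult_mono) (auto simp: indicator_def)
    finally show ?thesis by (simp add: Y_def)
  qed
  have intY: "integrable M (Y i)" if "i \<in> I" for i
    using Yb that by (intro integrable_const_bound[where B = "exp (1 + \<bar>p\<bar>)"]) auto
  have eY: "expectation (Y i) \<le> exp (p * \<theta>\<^sup>2)" if i: "i \<in> I" for i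
  proof -
    define E where "E = {\<omega> \<in> space M. X i \<omega> \<in> S}"
    have E[measurable]: "E \<in> sets M" unfolding E_def using i S by measurable
    have pE: "prob E = p" using p[OF i] by (simp add: E_def)
    have "expectation (Y i) = expectation (\<lambda>\<omega>. exp (- \<theta> * \<sigma> * p) + exp (- \<theta> * \<sigma> * p) * (exp (\<theta> * \<sigma>) - 1) * indicator E \<omega>)"
      by (intro Bochner_Integration.integral_cong)
        (auto simp: Y_def E_def indicator_def algebra_simps simp flip: exp_add)
    also have "\<dots> = exp (- \<theta> * \<sigma> * p) + exp (- \<theta> * \<sigma> * p) * (exp (\<theta> * \<sigma>) - 1) * p"
    proof -
      have "expectation (\<lambda>\<omega>. exp (- \<theta> * \<sigma> * p) * (exp (\<theta> * \<sigma>) - 1) * indicator E \<omega>) =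
          exp (- \<theta> * \<sigma> * p) * (exp (\<theta> * \<sigma>) - 1) * p"
        using E pE by simp
      moreover have "integrable M (\<lambda>\<omega>. exp (- \<theta> * \<sigma> * p) * (exp (\<theta> * \<sigma>) - 1) * indicator E \<omega>)"
        by (intro integrable_mult_right) (auto simp: less_top[symmetric])
      ultimately show ?thesis by (simp add: prob_space)
    qed
    also have "\<dots> = exp (- \<theta> * \<sigma> * p) * (1 + p * (exp (\<theta> * \<sigma>) - 1))" by (simp add: algebra_simps)
    also have "\<dots> \<le> exp (- \<theta> * \<sigma> * p) * exp (p * (\<theta> * \<sigma> + \<theta>\<^sup>2))"
    proof (intro mult_left_mono)
      have "\<sigma>\<^sup>2 = 1" using \<sigma> by (metis one_power2 power2_abs)
      then have "exp (\<theta> * \<sigma>) - 1 \<le> \<theta> * \<sigma> + \<theta>\<^sup>2"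
        using exp_le_quadratic[of "\<theta> * \<sigma>"] \<theta> \<sigma> by (simp add: abs_mult power_mult_distrib)
      moreover have "p \<ge> 0" using pE by auto
      ultimately have "1 + p * (exp (\<theta> * \<sigma>) - 1) \<le> 1 + p * (\<theta> * \<sigma> + \<theta>\<^sup>2)"
        by (intro add_left_mono mult_left_mono) auto
      also have "\<dots> \<le> exp (p * (\<theta> * \<sigma> + \<theta>\<^sup>2))" by (rule exp_ge_add_one_self)
      finally show "1 + p * (exp (\<theta> * \<sigma>) - 1) \<le> exp (p * (\<theta> * \<sigma> + \<theta>\<^sup>2))" .
    qed simp
    also have "\<dots> = exp (p * \<theta>\<^sup>2)" by (simp add: algebra_simps flip: exp_add)
    finally show ?thesis .
  qed
  define Z where "Z \<omega> = (\<Sum>i\<in>I. \<sigma> * (indicator S (X i \<omega>) - p))" for \<omega>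
  have expZ: "exp (\<theta> * Z \<omega>) = (\<Prod>i\<in>I. Y i \<omega>)" for \<omega>
    using fin by (simp add: Z_def Y_def exp_sum sum_distrib_left mult.assoc)
  have "integrable M (\<lambda>\<omega>. exp (\<theta> * Z \<omega>))"
    unfolding expZ by (rule indep_vars_integrable[OF fin indepY intY])
  then have "set_integrable M (space M) (\<lambda>\<omega>. exp (\<theta> * Z \<omega>))"
    unfolding set_integrable_def by (intro integrable_mult_indicator) auto
  then have "prob {\<omega> \<in> space M. t \<le> Z \<omega>} \<le> exp (- \<theta> * t) * (\<integral>\<omega>\<in>space M. exp (\<theta> * Z \<omega>) \<partial>M)"
    using \<theta> by (intro Chernoff_ineq_ge) auto
  also have "(\<integral>\<omega>\<in>space M. exp (\<theta> * Z \<omega>) \<partial>M) = expectation (\<lambda>\<omega>. \<Prod>i\<in>I. Y i \<omega>)"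
    unfolding set_lebesgue_integral_def by (intro Bochner_Integration.integral_cong) (auto simp: expZ)
  also have "\<dots> = (\<Prod>i\<in>I. expectation (Y i))"
    by (rule indep_vars_lebesgue_integral[OF fin indepY intY])
  also have "exp (- \<theta> * t) * \<dots> \<le> exp (- \<theta> * t) * (\<Prod>i\<in>I. exp (p * \<theta>\<^sup>2))"
    using eY by (intro mult_left_mono prod_mono) (auto simp: Y_def intro!: integral_nonneg_AE)
  also have "\<dots> = exp (card I * p * \<theta>\<^sup>2 - \<theta> * t)"
    by (simp add: exp_of_nat_mult[symmetric] algebra_simps flip: exp_add)
  finally show ?thesis by (simp add: Z_def)
qed

lemma (in prob_space) indicator_mean_deviation:
  fixes p :: real and n :: nat
  assumes n: "n > 1" and indep: "indep_vars (\<lambda>_. borel) X {..<n}" and S: "S \<in> sets borel"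
    and p: "\<And>i. i < n \<Longrightarrow> prob {\<omega> \<in> space M. X i \<omega> \<in> S} = p"
  shows "prob {\<omega> \<in> space M. 4 * (sqrt (p * rho n) + rho n) < \<bar>(\<Sum>i<n. indicator S (X i \<omega>)) / n - p\<bar>} \<le> 2 / real n ^ 3"
proof -
  define m where "m = ln (real n)"
  define q where "q = real n * p"
  have m: "m > 0" using n by (simp add: m_def)
  have "0 \<le> p" using p[of 0] n by (metis less_trans measure_nonneg zero_less_one)
  then have q: "q \<ge> 0" by (simp add: q_def)
  define t where "t = 4 * (sqrt (q * m) + m)"
  have t: "t = real n * (4 * (sqrt (p * rho n) + rho n))"
  proof -
    have "real n * sqrt (p * rho n) = sqrt ((real n)\<^sup>2 * (p * rho n))" by (simp add: real_sqrt_mult)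
    also have "(real n)\<^sup>2 * (p * rho n) = q * m" using n by (simp add: rho_def q_def m_def power2_eq_square)
    finally show ?thesis using n by (simp add: t_def rho_def m_def algebra_simps)
  qed
  have X[measurable]: "random_variable borel (X i)" if "i < n" for i
    using indep that by (auto simp: indep_vars_def)
  have "\<exists>\<theta>>0. \<theta> \<le> 1 \<and> q * \<theta>\<^sup>2 - \<theta> * t \<le> - (3 * m)"
  proof (cases "q \<ge> m")
    case True
    define \<theta> where "\<theta> = sqrt (m / q)"
    have q0: "q > 0" using True m by simp
    have l: "\<theta> > 0" "\<theta> \<le> 1" using m True q0 by (auto simp: \<theta>_def)
    have "q * \<theta>\<^sup>2 = m" using q0 m by (simp add: \<theta>_def)
    moreover have "\<theta> * sqrt (q * m) = m"
    proof -
      have "\<theta> * sqrt (q * m) = sqrt (m / q * (q * m))" by (simp only: \<theta>_def real_sqrt_mult[symmetric])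
      also have "m / q * (q * m) = m * m" using q0 by simp
      finally show ?thesis using m by simp
    qed
    then have "\<theta> * t \<ge> 4 * m" using l m by (simp add: t_def distrib_left mult.left_commute[of \<theta> 4])
    ultimately show ?thesis using l by (intro exI[of _ \<theta>]) auto
  next
    case False
    have "sqrt (q * m) \<ge> 0" using q m by simp
    then have "t \<ge> 4 * m" by (simp add: t_def)
    then show ?thesis using False by (intro exI[of _ 1]) auto
  qed
  then obtain \<theta> where \<theta>: "\<theta> > 0" "\<theta> \<le> 1" "q * \<theta>\<^sup>2 - \<theta> * t \<le> - (3 * m)" by blast
  have e: "exp (- (3 * m)) = 1 / real n ^ 3"
  proof -
    have "exp (- (3 * m)) = exp (- m) ^ 3" by (simp add: exp_of_nat_mult[symmetric])
    also have "exp (- m) = 1 / n" using n by (simp add: m_def exp_minus inverse_eq_divide)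
    finally show ?thesis by (simp add: power_one_over)
  qed
  define E where "E \<sigma> = {\<omega> \<in> space M. t \<le> (\<Sum>i<n. \<sigma> * (indicator S (X i \<omega>) - p))}" for \<sigma> :: real
  have mE[measurable]: "E \<sigma> \<in> sets M" for \<sigma> unfolding E_def using S by measurable
  have pE: "prob (E \<sigma>) \<le> 1 / real n ^ 3" if "\<bar>\<sigma>\<bar> = 1" for \<sigma>
  proof -
    have "prob (E \<sigma>) \<le> exp (card {..<n} * p * \<theta>\<^sup>2 - \<theta> * t)"
      unfolding E_def by (rule Bernstein_indicator) (use indep S p \<theta> that in auto)
    also have "\<dots> \<le> exp (- (3 * m))" using \<theta>(3) by (simp add: q_def)
    finally show ?thesis using e by simp
  qed
  have "prob {\<omega> \<in> space M. 4 * (sqrt (p * rho n) + rho n) < \<bar>(\<Sum>i<n. indicator S (X i \<omega>)) / n - p\<bar>} \<le> prob (E 1 \<union> E (-1))"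
  proof (rule finite_measure_mono)
    show "{\<omega> \<in> space M. 4 * (sqrt (p * rho n) + rho n) < \<bar>(\<Sum>i<n. indicator S (X i \<omega>)) / n - p\<bar>} \<subseteq> E 1 \<union> E (-1)"
    proof
      fix \<omega> assume \<omega>: "\<omega> \<in> {\<omega> \<in> space M. 4 * (sqrt (p * rho n) + rho n) < \<bar>(\<Sum>i<n. indicator S (X i \<omega>)) / n - p\<bar>}"
      define D where "D = (\<Sum>i<n. indicator S (X i \<omega>) - p)"
      have D: "D = n * ((\<Sum>i<n. indicator S (X i \<omega>)) / n - p)"
        using n by (simp add: D_def sum_subtractf algebra_simps)
      have "t < \<bar>D\<bar>" unfolding t D abs_mult using \<omega> n by simp
      then have "t \<le> D \<or> t \<le> - D" by linarith
      then show "\<omega> \<in> E 1 \<union> E (-1)" using \<omega> by (auto simp: E_def D_def sum_negf[symmetric])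
    qed
  qed simp
  also have "\<dots> \<le> prob (E 1) + prob (E (-1))" by (rule measure_Un_le) auto
  also have "\<dots> \<le> 2 / real n ^ 3" using pE[of 1] pE[of "-1"] by simp
  finally show ?thesis .
qed

text \<open>A compact part of the level set has extreme points \<open>a\<close> and
  \<open>b\<close>, and without atoms its mass is at most \<open>cdf \<nu> b - cdf \<nu> a\<close>.
  The truncation is made because level sets at 0 and 1 may be unbounded.\<close>

lemma measure_cdf_level:
  assumes \<nu>: "real_distribution \<nu>" and atomless: "\<And>x. measure \<nu> {x} = 0" and uv: "u \<le> v"
  shows "measure \<nu> {x. u \<le> cdf \<nu> x \<and> cdf \<nu> x \<le> v} \<le> v - u"
proof -
  interpret real_distribution \<nu> by fact
  have cont: "continuous_on UNIV (cdf \<nu>)"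
    using isCont_cdf atomless by (simp add: continuous_on_eq_continuous_at)
  define S where "S = {x. u \<le> cdf \<nu> x \<and> cdf \<nu> x \<le> v}"
  have cS: "closed S" unfolding S_def
    by (intro closed_Collect_conj closed_Collect_le continuous_intros continuous_on_subset[OF cont]) auto
  have bound: "measure \<nu> (S \<inter> {- real k..real k}) \<le> v - u" for k
  proof (cases "S \<inter> {- real k..real k} = {}")
    case False
    define W where "W = S \<inter> {- real k..real k}"
    have "compact W" unfolding W_def using cS by (intro closed_Int_compact) auto
    moreover have "W \<noteq> {}" using False by (simp add: W_def)
    ultimately obtain a b where "a \<in> W" "\<forall>x\<in>W. a \<le> x" "b \<in> W" "\<forall>x\<in>W. x \<le> b"
      using compact_attains_inf[of W] compact_attains_sup[of W] by blast
    then have ab: "a \<in> W" "b \<in> W" "\<And>x. x \<in> W \<Longrightarrow> a \<le> x \<and> x \<le> b" by auto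
    have "measure \<nu> W \<le> measure \<nu> ({a} \<union> {a<..b})"
    proof (rule finite_measure_mono)
      show "W \<subseteq> {a} \<union> {a<..b}"
      proof
        fix x assume "x \<in> W"
        then show "x \<in> {a} \<union> {a<..b}" using ab(3)[of x] by auto
      qed
    qed simp
    also have "\<dots> \<le> measure \<nu> {a} + measure \<nu> {a<..b}" by (intro measure_Un_le) auto
    also have "\<dots> = measure \<nu> {a<..b}" using atomless by simp
    also have "\<dots> = cdf \<nu> b - cdf \<nu> a"
      using ab(3)[OF ab(1)] by (cases "a < b") (auto simp: cdf_diff_eq)
    also have "\<dots> \<le> v - u" using ab(1,2) by (auto simp: W_def S_def)
    finally show ?thesis by (simp add: W_def)
  qed (use uv in simp)
  have "(\<lambda>k. measure \<nu> (S \<inter> {- real k..real k})) \<longlonglongrightarrow> measure \<nu> (\<Union>k. S \<inter> {- real k..real k})"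
    using cS by (intro finite_Lim_measure_incseq) (auto simp: incseq_def)
  moreover have "(\<Union>k. S \<inter> {- real k..real k}) = S"
  proof -
    have "\<exists>k. x \<in> {- real k..real k}" for x
    proof -
      obtain k where "\<bar>x\<bar> \<le> real k" using real_arch_simple by blast
      then show ?thesis by (auto intro!: exI[of _ k])
    qed
    then show ?thesis by blast
  qed
  ultimately show ?thesis unfolding S_def[symmetric] by (intro LIMSEQ_le_const2) (use bound in auto)
qed

text \<open>Level sets of the distribution function replace intervals between quantiles, so no
  inverse function appears. An interval lies between two grid sets whose masses differ by at most
  two cells, that is by \<open>2 * r\<close>. The square root then changes by at most
  \<open>2 * r\<close> as well, and 4 * (2 + 1) + 2 is the constant 14.\<close>

lemma interval_deviation_from_grid:
  fixes \<mu> \<nu> :: "real measure" and n :: nat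
  defines "S \<equiv> \<lambda>i j :: nat. {x. real i / n \<le> cdf \<nu> x \<and> cdf \<nu> x \<le> real j / n}"
  assumes \<nu>: "real_distribution \<nu>" and atomless: "\<And>x. measure \<nu> {x} = 0"
    and \<mu>: "real_distribution \<mu>" and n: "n > 0" and r: "1 / n \<le> r"
    and grid: "\<And>i j. i \<le> n + 1 \<Longrightarrow> j \<le> n + 1 \<Longrightarrow>
      \<bar>measure \<mu> (S i j) - measure \<nu> (S i j)\<bar> \<le> 4 * (sqrt (measure \<nu> (S i j) * r) + r)"
    and I: "is_interval I"
  shows "\<bar>measure \<mu> I - measure \<nu> I\<bar> \<le> 14 * (sqrt (measure \<nu> I * r) + r)"
proof (cases "I = {}")
  case True
  then show ?thesis using r n by (auto intro: order_trans[of 0 "1 / n"])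
next
  case False
  interpret N: real_distribution \<nu> by fact
  interpret M: real_distribution \<mu> by fact
  have r0: "r > 0" using r n by (intro less_le_trans[OF _ r]) auto
  have F01: "0 \<le> cdf \<nu> x" "cdf \<nu> x \<le> 1" for x
    using N.cdf_nonneg N.cdf_bounded_prob by auto
  have Fmono: "cdf \<nu> x \<le> cdf \<nu> y" if "x \<le> y" for x y using N.cdf_nondecreasing that by blast
  have cont: "continuous_on UNIV (cdf \<nu>)"
    using N.isCont_cdf atomless by (simp add: continuous_on_eq_continuous_at)
  have Sb[measurable]: "S i j \<in> sets borel" for i j
  proof -
    have "closed (S i j)" unfolding S_def
      by (intro closed_Collect_conj closed_Collect_le continuous_intros continuous_on_subset[OF cont]) auto
    then show ?thesis by simp
  qed
  have Ib[measurable]: "I \<in> sets borel" using I real_interval_borel_measurable by simp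
  \<comment> \<open>Infimum and supremum over \<open>I\<close> treat open, closed and unbounded
    intervals alike.\<close>
  define \<alpha> \<beta> where "\<alpha> = (INF x\<in>I. cdf \<nu> x)" and "\<beta> = (SUP x\<in>I. cdf \<nu> x)"
  have bdd: "bdd_below (cdf \<nu> ` I)" "bdd_above (cdf \<nu> ` I)" using F01 by (auto intro!: bdd_belowI bdd_aboveI)
  have \<alpha>: "\<alpha> \<le> cdf \<nu> x" and \<beta>: "cdf \<nu> x \<le> \<beta>" if "x \<in> I" for x
    unfolding \<alpha>_def \<beta>_def using that bdd by (auto intro: cINF_lower cSUP_upper)
  obtain x0 where x0: "x0 \<in> I" using False by blast
  have "0 \<le> \<alpha>" "\<beta> \<le> 1"
    unfolding \<alpha>_def \<beta>_def using F01 False by (auto intro!: cINF_greatest cSUP_least)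
  then have ab01: "0 \<le> \<alpha>" "\<beta> \<le> 1" "\<alpha> \<le> 1" "0 \<le> \<beta>"
    using F01[of x0] \<alpha>[OF x0] \<beta>[OF x0] by auto
  \<comment> \<open>Rounding outwards gives the covering set \<open>S i j\<close>; moving both
    indices inwards by one gives a subset of \<open>I\<close>, possibly empty. As \<open>i\<close>
    may be \<open>n\<close>, the grid runs to \<open>n + 1\<close>.\<close>
  define i j where "i = nat \<lfloor>n * \<alpha>\<rfloor>" and "j = nat \<lceil>n * \<beta>\<rceil>"
  have i: "real i \<le> n * \<alpha>" "n * \<alpha> < real i + 1"
    using ab01 unfolding i_def by (auto simp: of_nat_nat)
  have j: "n * \<beta> \<le> real j" "real j < n * \<beta> + 1"
    using ab01 unfolding j_def by (auto simp: of_nat_nat) linarith?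
  have ij: "i \<le> n" "j \<le> n"
  proof -
    have "n * \<alpha> \<le> real n * 1" "n * \<beta> \<le> real n * 1" using ab01 by (simp_all only: mult_left_mono of_nat_0_le_iff)
    then show "i \<le> n" using i(1) by linarith
    have "real j < real n * 1 + 1" using j(2) \<open>n * \<beta> \<le> real n * 1\<close> by linarith
    then show "j \<le> n" by linarith
  qed
  have outer: "I \<subseteq> S i j"
  proof
    fix x assume "x \<in> I"
    then have "real i \<le> n * cdf \<nu> x" "n * cdf \<nu> x \<le> real j"
      using i(1) j(1) mult_left_mono[OF \<alpha>, of x "real n"] mult_left_mono[OF \<beta>, of x "real n"] by auto
    then show "x \<in> S i j" using n by (simp add: S_def pos_divide_le_eq pos_le_divide_eq mult.commute)
  qed
  have inner: "S (i + 1) (j - 1) \<subseteq> I"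
  proof
    fix x assume "x \<in> S (i + 1) (j - 1)"
    then have x: "real i + 1 \<le> n * cdf \<nu> x" "n * cdf \<nu> x \<le> real (j - 1)"
      using n by (auto simp: S_def pos_divide_le_eq pos_le_divide_eq mult.commute)
    have "n * \<alpha> < n * cdf \<nu> x" using x(1) i by linarith
    then have 1: "\<alpha> < cdf \<nu> x" using n by simp
    have "j \<ge> 1" using x by (cases j) auto
    then have "n * cdf \<nu> x < n * \<beta>" using x(2) j(2) by (simp add: of_nat_diff)
    then have 2: "cdf \<nu> x < \<beta>" using n by simp
    obtain y where y: "y \<in> I" "cdf \<nu> y < cdf \<nu> x"
      using 1 cINF_less_iff[OF False bdd(1)] unfolding \<alpha>_def by blast
    obtain z where z: "z \<in> I" "cdf \<nu> x < cdf \<nu> z"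
      using 2 less_cSUP_iff[OF False bdd(2)] unfolding \<beta>_def by blast
    have "\<not> x \<le> y" "\<not> z \<le> x" using y z Fmono[of x y] Fmono[of z x] by auto
    then show "x \<in> I" using I y(1) z(1) \<open>\<not> x \<le> y\<close> mem_is_interval_1_I[of I y z x] by auto
  qed
  \<comment> \<open>The case \<open>a = b\<close> is included: for \<open>j = 0\<close> truncated
    subtraction makes \<open>j - 1\<close> equal to \<open>j\<close>.\<close>
  have lev: "measure \<nu> (S a b) \<le> 1 / n" if "a \<le> b" "b \<le> a + 1" for a b
  proof -
    have "measure \<nu> (S a b) \<le> real b / n - real a / n"
      unfolding S_def using that n by (intro measure_cdf_level[OF \<nu> atomless]) (auto simp: divide_right_mono)
    also have "\<dots> = (real b - real a) / n" by (simp add: diff_divide_distrib)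
    also have "\<dots> \<le> 1 / n" using that by (intro divide_right_mono) auto
    finally show ?thesis .
  qed
  have "measure \<nu> (S i j) \<le> measure \<nu> (S (i + 1) (j - 1) \<union> (S i (i + 1) \<union> S (j - 1) j))"
  proof (rule N.finite_measure_mono)
    show "S i j \<subseteq> S (i + 1) (j - 1) \<union> (S i (i + 1) \<union> S (j - 1) j)" unfolding S_def by auto
  qed measurable
  also have "\<dots> \<le> measure \<nu> (S (i + 1) (j - 1)) + measure \<nu> (S i (i + 1) \<union> S (j - 1) j)"
    by (intro measure_Un_le) auto
  also have "measure \<nu> (S i (i + 1) \<union> S (j - 1) j) \<le> measure \<nu> (S i (i + 1)) + measure \<nu> (S (j - 1) j)"
    by (intro measure_Un_le) auto
  also have "\<dots> \<le> r + r" using lev[of i "i + 1"] lev[of "j - 1" j] r by linarith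
  finally have io: "measure \<nu> (S i j) \<le> measure \<nu> (S (i + 1) (j - 1)) + 2 * r" by simp
  have mono: "measure \<nu> (S (i + 1) (j - 1)) \<le> measure \<nu> I" "measure \<nu> I \<le> measure \<nu> (S i j)"
    "measure \<mu> (S (i + 1) (j - 1)) \<le> measure \<mu> I" "measure \<mu> I \<le> measure \<mu> (S i j)"
    using outer inner by (auto intro!: N.finite_measure_mono M.finite_measure_mono)
  define p where "p = measure \<nu> I"
  have p0: "p \<ge> 0" by (simp add: p_def)
  have "sqrt (measure \<nu> (S i j) * r) \<le> sqrt ((p + 2 * r) * r)"
    using io mono r0 unfolding p_def by (intro real_sqrt_le_mono mult_right_mono) auto
  also have "\<dots> \<le> sqrt (p * r + (2 * r)\<^sup>2)"
    using r0 by (intro real_sqrt_le_mono) (simp add: algebra_simps power2_eq_square)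
  also have "\<dots> \<le> sqrt (p * r) + sqrt ((2 * r)\<^sup>2)"
    using p0 r0 by (intro sqrt_add_le_add_sqrt) auto
  also have "\<dots> = sqrt (p * r) + 2 * r" using r0 by (simp only: real_sqrt_abs)
  finally have s1: "sqrt (measure \<nu> (S i j) * r) \<le> sqrt (p * r) + 2 * r" .
  have s2: "sqrt (measure \<nu> (S (i + 1) (j - 1)) * r) \<le> sqrt (p * r)"
    using mono r0 unfolding p_def by (intro real_sqrt_le_mono mult_right_mono) auto
  have s3: "sqrt (p * r) \<ge> 0" using p0 r0 by simp
  have g1: "\<bar>measure \<mu> (S i j) - measure \<nu> (S i j)\<bar> \<le> 4 * (sqrt (measure \<nu> (S i j) * r) + r)"
    using ij by (intro grid) auto
  have g2: "\<bar>measure \<mu> (S (i + 1) (j - 1)) - measure \<nu> (S (i + 1) (j - 1))\<bar> \<le> 4 * (sqrt (measure \<nu> (S (i + 1) (j - 1)) * r) + r)"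
    using ij by (intro grid) auto
  have "measure \<mu> I - p \<le> 14 * (sqrt (p * r) + r)"
    using abs_le_D1[OF g1] s1 s3 io mono r0 unfolding p_def distrib_left by linarith
  moreover have "p - measure \<mu> I \<le> 14 * (sqrt (p * r) + r)"
    using abs_le_D2[OF g2] s2 s3 io mono r0 unfolding p_def distrib_left by linarith
  ultimately show ?thesis unfolding p_def by linarith
qed

text \<open>Each of the \<open>(n + 2)\<^sup>2\<close> grid sets fails with probability at most
  \<open>2 / n ^ 3\<close>. Off the union \<open>E\<close> of these failures the grid lemma treats
  all intervals simultaneously, so the uncountable family raises no question of
  measurability.\<close>

lemma (in prob_space) empirical_interval_deviation:
  assumes n: "n \<ge> 3" and indep: "indep_vars (\<lambda>_. borel) X {..<n}"
    and distr: "\<And>i. i < n \<Longrightarrow> distr M borel (X i) = \<nu>"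
    and \<nu>: "real_distribution \<nu>" and atomless: "\<And>x. measure \<nu> {x} = 0"
  shows "\<exists>E\<in>events. prob E \<le> 2 * (real n + 2)\<^sup>2 / real n ^ 3 \<and>
    (\<forall>\<omega>\<in>space M - E. \<forall>I. is_interval I \<longrightarrow>
      \<bar>measure (empirical n (\<lambda>i. X i \<omega>)) I - measure \<nu> I\<bar> \<le> 14 * (sqrt (measure \<nu> I * rho n) + rho n))"
proof -
  interpret N: real_distribution \<nu> by fact
  have X[measurable]: "random_variable borel (X i)" if "i < n" for i
    using indep that by (auto simp: indep_vars_def)
  define S where "S i j = {x. real i / n \<le> cdf \<nu> x \<and> cdf \<nu> x \<le> real j / n}" for i j :: nat
  have cont: "continuous_on UNIV (cdf \<nu>)"
    using N.isCont_cdf atomless by (simp add: continuous_on_eq_continuous_at)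
  have Sb[measurable]: "S i j \<in> sets borel" for i j
  proof -
    have "closed (S i j)" unfolding S_def
      by (intro closed_Collect_conj closed_Collect_le continuous_intros continuous_on_subset[OF cont]) auto
    then show ?thesis by simp
  qed
  define B where "B i j = {\<omega> \<in> space M. 4 * (sqrt (measure \<nu> (S i j) * rho n) + rho n) <
      \<bar>(\<Sum>k<n. indicator (S i j) (X k \<omega>)) / n - measure \<nu> (S i j)\<bar>}" for i j
  have mB[measurable]: "B i j \<in> events" for i j unfolding B_def by measurable
  have pB: "prob (B i j) \<le> 2 / real n ^ 3" for i j
    unfolding B_def
  proof (rule indicator_mean_deviation[OF _ indep Sb])
    fix k assume k: "k < n"
    have "measure \<nu> (S i j) = measure (distr M borel (X k)) (S i j)" using distr[OF k] by simp
    also have "\<dots> = prob (X k -` S i j \<inter> space M)" using k by (intro measure_distr) auto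
    also have "X k -` S i j \<inter> space M = {\<omega> \<in> space M. X k \<omega> \<in> S i j}" by auto
    finally show "prob {\<omega> \<in> space M. X k \<omega> \<in> S i j} = measure \<nu> (S i j)" by simp
  qed (use n in auto)
  define E where "E = (\<Union>ij\<in>{..n+1} \<times> {..n+1}. B (fst ij) (snd ij))"
  have "prob E \<le> (\<Sum>ij\<in>{..n+1} \<times> {..n+1}. prob (B (fst ij) (snd ij)))"
    unfolding E_def by (intro finite_measure_subadditive_finite) auto
  also have "\<dots> \<le> (\<Sum>ij\<in>{..n+1} \<times> {..n+1}. 2 / real n ^ 3)" by (intro sum_mono pB)
  also have "\<dots> = 2 * (real n + 2)\<^sup>2 / real n ^ 3"
    by (simp add: card_cartesian_product power2_eq_square) (simp add: algebra_simps)
  finally have pE: "prob E \<le> 2 * (real n + 2)\<^sup>2 / real n ^ 3" .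
  have "\<bar>measure (empirical n (\<lambda>i. X i \<omega>)) I - measure \<nu> I\<bar> \<le> 14 * (sqrt (measure \<nu> I * rho n) + rho n)"
    if \<omega>: "\<omega> \<in> space M - E" and I: "is_interval I" for \<omega> I
  proof (rule interval_deviation_from_grid[OF \<nu> atomless])
    show "real_distribution (empirical n (\<lambda>i. X i \<omega>))"
      using n prob_space_empirical by (auto simp: real_distribution_def real_distribution_axioms_def)
    \<comment> \<open>Here \<open>n \<ge> 3 \<ge> exp 1\<close> is used: a grid cell must not
      outweigh \<open>rho n\<close>.\<close>
    have "1 \<le> ln (real n)"
    proof -
      have "exp 1 \<le> real n" using exp_le n by linarith
      then show ?thesis using n by (subst ln_ge_iff) auto
    qed
    then show "1 / n \<le> rho n" unfolding rho_def by (intro divide_right_mono) auto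
    fix i j assume "i \<le> n + 1" "j \<le> n + 1"
    then have "\<omega> \<notin> B i j" using \<omega> by (auto simp: E_def)
    then have "\<bar>measure (empirical n (\<lambda>i. X i \<omega>)) (S i j) - measure \<nu> (S i j)\<bar>
      \<le> 4 * (sqrt (measure \<nu> (S i j) * rho n) + rho n)"
      using \<omega> by (simp add: B_def measure_empirical not_less)
    then show "\<bar>measure (empirical n (\<lambda>i. X i \<omega>)) {x. real i / n \<le> cdf \<nu> x \<and> cdf \<nu> x \<le> real j / n}
       - measure \<nu> {x. real i / n \<le> cdf \<nu> x \<and> cdf \<nu> x \<le> real j / n}\<bar>
      \<le> 4 * (sqrt (measure \<nu> {x. real i / n \<le> cdf \<nu> x \<and> cdf \<nu> x \<le> real j / n} * rho n) + rho n)"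
      by (simp add: S_def)
  qed (use n I in auto)
  moreover have "E \<in> events" unfolding E_def by (intro sets.finite_UN) auto
  ultimately show ?thesis using pE by blast
qed

section \<open>The variational characterisation of the estimator\<close>

text \<open>The chord inequality without denominators; it persists when the points coincide, which
  saves case distinctions in the later comparisons.\<close>

lemma concave_on_three_points:
  fixes f :: "real \<Rightarrow> real"
  assumes f: "concave_on S f" and "a \<in> S" "c \<in> S" "a \<le> b" "b \<le> c"
  shows "(c - b) * f a + (b - a) * f c \<le> (c - a) * f b"
proof (cases "a = c")
  case False
  then have ac: "a < c" using assms by simp
  define t where "t = (b - a) / (c - a)"
  have t: "0 \<le> t" "t \<le> 1" using assms ac by (auto simp: t_def)
  have tc: "t * (c - a) = b - a" using ac by (simp add: t_def)
  have "(1 - t) * a + t * c = a + t * (c - a)" by (simp add: algebra_simps)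
  then have b: "(1 - t) * a + t * c = b" using tc by simp
  have "(1 - t) * f a + t * f c \<le> f b"
    using f assms(2,3) t b unfolding concave_on_iff by (metis add.commute diff_add_cancel diff_ge_0_iff_ge real_scaleR_def)
  then have "(c - a) * ((1 - t) * f a + t * f c) \<le> (c - a) * f b"
    using ac by (intro mult_left_mono) auto
  also have "(c - a) * ((1 - t) * f a + t * f c) = ((c - a) - t * (c - a)) * f a + (t * (c - a)) * f c"
    by (simp add: algebra_simps)
  finally show ?thesis unfolding tc by simp
qed (use assms in simp)

lemma concave_on_three_pointsI:
  fixes f :: "real \<Rightarrow> real"
  assumes S: "convex S"
    and *: "\<And>a b c. a \<in> S \<Longrightarrow> c \<in> S \<Longrightarrow> a < b \<Longrightarrow> b < c \<Longrightarrow> (c - b) * f a + (b - a) * f c \<le> (c - a) * f b"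
  shows "concave_on S f"
proof (rule concave_on_linorderI)
  fix t x y :: real assume t: "0 < t" "t < 1" and xy: "x \<in> S" "y \<in> S" "x < y"
  define z where "z = (1 - t) * x + t * y"
  have zx: "z - x = t * (y - x)" "y - z = (1 - t) * (y - x)" by (auto simp: z_def algebra_simps)
  have "0 < z - x" "0 < y - z" unfolding zx using t xy by auto
  then have "(y - z) * f x + (z - x) * f y \<le> (y - x) * f z" using *[of x y z] xy by auto
  then have "(y - x) * ((1 - t) * f x + t * f y) \<le> (y - x) * f z" unfolding zx by (simp add: algebra_simps)
  then show "f ((1 - t) *\<^sub>R x + t *\<^sub>R y) \<ge> (1 - t) * f x + t * f y"
    using xy by (simp add: z_def)
qed fact

text \<open>The endpoints give the lower bound. For the upper one, the reflection of
  \<open>y\<close> in the centre has a value bounded below, and the average of the two values is at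
  most the value at the centre.\<close>

lemma concave_on_Icc_bounded:
  fixes f :: "real \<Rightarrow> real"
  assumes f: "concave_on {l..u} f"
  shows "\<exists>B. \<forall>y\<in>{l..u}. \<bar>f y\<bar> \<le> B"
proof (cases "l < u")
  case True
  define m where "m = min (f l) (f u)"
  define c where "c = (l + u) / 2"
  have low: "m \<le> f y" if "y \<in> {l..u}" for y
  proof -
    have "(u - l) * m = (u - y) * m + (y - l) * m" by (simp add: algebra_simps)
    also have "\<dots> \<le> (u - y) * f l + (y - l) * f u"
      using that by (intro add_mono mult_left_mono) (auto simp: m_def)
    also have "\<dots> \<le> (u - l) * f y" using that True by (intro concave_on_three_points[OF f]) auto
    finally show ?thesis using True by simp
  qed
  have up: "f y \<le> 2 * f c - m" if "y \<in> {l..u}" for y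
  proof -
    define z where "z = 2 * c - y"
    have "z = l + u - y" by (simp add: z_def c_def field_simps)
    then have z: "z \<in> {l..u}" using that by auto
    have "f y + f z \<le> 2 * f c"
    proof -
      have conc: "(1 / 2) * f y + (1 / 2) * f z \<le> f ((1/2) * y + (1/2) * z)"
        using concave_onD[OF f, of "1 / 2" y z] that z by simp
      have "(1/2) * y + (1/2) * z = c" by (simp add: z_def field_simps)
      then show ?thesis using conc by simp
    qed
    then show ?thesis using low[OF z] by linarith
  qed
  show ?thesis
  proof (intro exI[of _ "\<bar>m\<bar> + \<bar>2 * f c - m\<bar>"] ballI)
    fix y assume "y \<in> {l..u}"
    then show "\<bar>f y\<bar> \<le> \<bar>m\<bar> + \<bar>2 * f c - m\<bar>" using low[of y] up[of y] by linarith
  qed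
next
  case False
  have "\<forall>y\<in>{l..u}. \<bar>f y\<bar> \<le> \<bar>f l\<bar>"
  proof
    fix y assume "y \<in> {l..u}"
    then have "y = l" using False by auto
    then show "\<bar>f y\<bar> \<le> \<bar>f l\<bar>" by simp
  qed
  then show ?thesis by blast
qed

text \<open>For a triple around \<open>k\<close> whose middle point is left of \<open>k\<close>, the
  chord from \<open>a\<close> to \<open>k\<close> lies above the chord from \<open>a\<close> to
  \<open>c\<close>, since \<open>f c \<le> f k\<close> and \<open>c\<close> is farther away. The
  maximum at \<open>k\<close> thus replaces a comparison of one-sided slopes.\<close>

lemma concave_on_glue_at_maximum:
  fixes f :: "real \<Rightarrow> real"
  assumes l: "concave_on {l..k} f" and u: "concave_on {k..u} f"
    and max: "\<And>y. y \<in> {l..u} \<Longrightarrow> f y \<le> f k"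
  shows "concave_on {l..u} f"
proof (rule concave_on_three_pointsI)
  fix a b c assume ac: "a \<in> {l..u}" "c \<in> {l..u}" and abc: "a < b" "b < c"
  consider "c \<le> k" | "k \<le> a" | "a < k" "k < c" "b \<le> k" | "a < k" "k < c" "k \<le> b" by linarith
  then show "(c - b) * f a + (b - a) * f c \<le> (c - a) * f b"
  proof cases
    case 1
    then show ?thesis using ac abc by (intro concave_on_three_points[OF l]) auto
  next
    case 2
    then show ?thesis using ac abc by (intro concave_on_three_points[OF u]) auto
  next
    case 3
    have 1: "(k - b) * f a + (b - a) * f k \<le> (k - a) * f b"
      using ac abc 3 by (intro concave_on_three_points[OF l]) auto
    have 2: "f a \<le> f k" "f c \<le> f k" using max ac by auto
    have "(b - a) * (c - a) * (f k - f a) \<ge> (b - a) * (k - a) * (f k - f a)"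
      using abc 3 2 by (intro mult_right_mono mult_left_mono) auto
    moreover have "(c - a) * ((k - a) * f b) \<ge> (c - a) * ((k - b) * f a + (b - a) * f k)"
      using 1 abc by (intro mult_left_mono) auto
    moreover have "(k - a) * (b - a) * f k \<ge> (k - a) * (b - a) * f c"
      using 2 abc 3 by (intro mult_left_mono) auto
    ultimately have "(k - a) * ((c - b) * f a + (b - a) * f c) \<le> (k - a) * ((c - a) * f b)"
      by (simp add: algebra_simps)
    then show ?thesis using 3 by simp
  next
    case 4
    have 1: "(c - b) * f k + (b - k) * f c \<le> (c - k) * f b"
      using ac abc 4 by (intro concave_on_three_points[OF u]) auto
    have 2: "f a \<le> f k" "f c \<le> f k" using max ac by auto
    have "(c - b) * (c - a) * (f k - f c) \<ge> (c - b) * (c - k) * (f k - f c)"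
      using abc 4 2 by (intro mult_right_mono mult_left_mono) auto
    moreover have "(c - a) * ((c - k) * f b) \<ge> (c - a) * ((c - b) * f k + (b - k) * f c)"
      using 1 abc by (intro mult_left_mono) auto
    moreover have "(c - k) * (c - b) * f k \<ge> (c - k) * (c - b) * f a"
      using 2 abc 4 by (intro mult_left_mono) auto
    ultimately have "(c - k) * ((c - b) * f a + (b - a) * f c) \<le> (c - k) * ((c - a) * f b)"
      by (simp add: algebra_simps)
    then show ?thesis using 4 by simp
  qed
qed simp

lemma concave_on_min:
  fixes f g :: "real \<Rightarrow> real"
  assumes "concave_on S f" "concave_on S g"
  shows "concave_on S (\<lambda>x. min (f x) (g x))"
proof (rule concave_on_three_pointsI)
  show "convex S" using assms concave_on_imp_convex by blast
  fix a b c assume ac: "a \<in> S" "c \<in> S" and abc: "a < b" "b < c"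
  have "(c - b) * min (f a) (g a) + (b - a) * min (f c) (g c) \<le> (c - b) * f a + (b - a) * f c"
    "(c - b) * min (f a) (g a) + (b - a) * min (f c) (g c) \<le> (c - b) * g a + (b - a) * g c"
    using abc by (auto intro!: add_mono mult_left_mono)
  moreover have "(c - b) * f a + (b - a) * f c \<le> (c - a) * f b" "(c - b) * g a + (b - a) * g c \<le> (c - a) * g b"
    using assms ac abc by (auto intro!: concave_on_three_points)
  ultimately show "(c - b) * min (f a) (g a) + (b - a) * min (f c) (g c) \<le> (c - a) * min (f b) (g b)"
    by (auto simp: min_def)
qed

lemma concave_on_affine: "convex S \<Longrightarrow> concave_on S (\<lambda>x::real. a + b * x)"
  by (rule concave_on_three_pointsI) (auto simp: algebra_simps)

lemma concave_on_cong':
  assumes "concave_on S f" "\<And>x. x \<in> S \<Longrightarrow> f x = g x"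
  shows "concave_on S g"
  using assms by (auto simp: concave_on_iff convex_def)

lemma concave_on_mono: "concave_on S f \<Longrightarrow> T \<subseteq> S \<Longrightarrow> convex T \<Longrightarrow> concave_on T f"
  unfolding concave_on_iff by blast

text \<open>Isolates the real-valued problem on the sample range. Outside \<open>{l..u}\<close>
  nothing is assumed about \<open>g\<close>, so all integrals are taken against \<open>q\<close>.
  The last assumption says that the criterion does not increase to first order in a direction
  \<Delta> of which some positive multiple keeps \<open>g\<close> concave.\<close>

locale concave_mle =
  fixes n :: nat and x :: "nat \<Rightarrow> real" and l u :: real and g q :: "real \<Rightarrow> real"
  assumes n: "n > 0" and data: "\<And>i. i < n \<Longrightarrow> x i \<in> {l..u}"
    and l_data: "l \<in> x ` {..<n}" and u_data: "u \<in> x ` {..<n}" and lu: "l < u"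
    and g: "concave_on {l..u} g"
    and q_def: "q = (\<lambda>y. if y \<in> {l..u} then exp (g y) else 0)"
    and q_int: "integrable lborel q"
    and variational: "\<And>\<Delta> \<tau>. \<Delta> \<in> borel_measurable borel \<Longrightarrow> \<exists>B. \<forall>y\<in>{l..u}. \<bar>\<Delta> y\<bar> \<le> B \<Longrightarrow> \<tau> > 0 \<Longrightarrow>
      concave_on {l..u} (\<lambda>y. g y + \<tau> * \<Delta> y) \<Longrightarrow> (\<Sum>i<n. \<Delta> (x i)) / n \<le> (LINT y|lborel. \<Delta> y * q y)"
begin

text \<open>Boundedness is asked on \<open>{l..u}\<close>, where the sample and \<open>q\<close>
  live; thus ramps and affine functions qualify.\<close>

definition adm :: "(real \<Rightarrow> real) \<Rightarrow> bool" where
  "adm \<Delta> \<longleftrightarrow> \<Delta> \<in> borel_measurable borel \<and> (\<exists>B. \<forall>y\<in>{l..u}. \<bar>\<Delta> y\<bar> \<le> B)"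

definition T :: "(real \<Rightarrow> real) \<Rightarrow> real" where
  "T \<Delta> = (\<Sum>i<n. \<Delta> (x i)) / n - (LINT y|lborel. \<Delta> y * q y)"

lemma q_meas [measurable]: "q \<in> borel_measurable borel"
  using q_int by auto

lemma q_nonneg: "0 \<le> q y"
  by (simp add: q_def)

lemma q_outside: "y \<notin> {l..u} \<Longrightarrow> q y = 0"
  by (auto simp: q_def)

lemma adm_integrable:
  assumes "adm \<Delta>" shows "integrable lborel (\<lambda>y. \<Delta> y * q y)"
proof -
  obtain B where B: "\<And>y. y \<in> {l..u} \<Longrightarrow> \<bar>\<Delta> y\<bar> \<le> B" using assms unfolding adm_def by blast
  have [measurable]: "\<Delta> \<in> borel_measurable borel" using assms by (simp add: adm_def)
  show ?thesis
  proof (rule Bochner_Integration.integrable_bound[of _ "\<lambda>y. B * q y"])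
    show "AE y in lborel. norm (\<Delta> y * q y) \<le> norm (B * q y)"
    proof (rule AE_I2)
      fix y show "norm (\<Delta> y * q y) \<le> norm (B * q y)"
      proof (cases "y \<in> {l..u}")
        case True
        then have "\<bar>\<Delta> y\<bar> \<le> \<bar>B\<bar>" using B[of y] by linarith
        then show ?thesis by (simp add: abs_mult mult_right_mono)
      qed (simp add: q_outside)
    qed
  qed (use q_int in auto)
qed

lemma adm_add: "adm \<Delta> \<Longrightarrow> adm \<Delta>' \<Longrightarrow> adm (\<lambda>y. \<Delta> y + \<Delta>' y)"
proof -
  assume *: "adm \<Delta>" "adm \<Delta>'"
  then obtain B B' where "\<And>y. y \<in> {l..u} \<Longrightarrow> \<bar>\<Delta> y\<bar> \<le> B" "\<And>y. y \<in> {l..u} \<Longrightarrow> \<bar>\<Delta>' y\<bar> \<le> B'"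
    unfolding adm_def by blast
  then have "\<forall>y\<in>{l..u}. \<bar>\<Delta> y + \<Delta>' y\<bar> \<le> B + B'" by (auto intro!: order_trans[OF abs_triangle_ineq] add_mono)
  with * show ?thesis unfolding adm_def by auto
qed

lemma adm_cmul: "adm \<Delta> \<Longrightarrow> adm (\<lambda>y. c * \<Delta> y)"
proof -
  assume *: "adm \<Delta>"
  then obtain B where "\<And>y. y \<in> {l..u} \<Longrightarrow> \<bar>\<Delta> y\<bar> \<le> B" unfolding adm_def by blast
  then have "\<forall>y\<in>{l..u}. \<bar>c * \<Delta> y\<bar> \<le> \<bar>c\<bar> * B" by (auto simp: abs_mult intro!: mult_left_mono)
  with * show ?thesis unfolding adm_def by auto
qed

lemma adm_bounded: "\<Delta> \<in> borel_measurable borel \<Longrightarrow> (\<And>y. y \<in> {l..u} \<Longrightarrow> \<bar>\<Delta> y\<bar> \<le> B) \<Longrightarrow> adm \<Delta>"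
  unfolding adm_def by blast

lemma adm_continuous: "continuous_on UNIV \<Delta> \<Longrightarrow> adm \<Delta>"
proof -
  assume c: "continuous_on UNIV \<Delta>"
  then have "compact (\<Delta> ` {l..u})" by (intro compact_continuous_image continuous_on_subset[OF c]) auto
  then have "bounded (\<Delta> ` {l..u})" by (rule compact_imp_bounded)
  then show ?thesis using c by (auto simp: adm_def bounded_iff borel_measurable_continuous_onI)
qed

lemma adm_ramps [intro]:
  "adm (\<lambda>y. max 0 (k - y))" "adm (\<lambda>y. max 0 (y - k))" "adm (\<lambda>y. a + b * y)"
  by (rule adm_continuous, intro continuous_intros)+

lemma adm_indicator [intro]: "S \<in> sets borel \<Longrightarrow> adm (indicator S)"
  by (rule adm_bounded[of _ 1]) (auto simp: indicator_def)

lemma T_add: "adm \<Delta> \<Longrightarrow> adm \<Delta>' \<Longrightarrow> T (\<lambda>y. \<Delta> y + \<Delta>' y) = T \<Delta> + T \<Delta>'"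
  using Bochner_Integration.integral_add[OF adm_integrable adm_integrable, of \<Delta> \<Delta>']
  by (simp add: T_def distrib_right sum.distrib add_divide_distrib)

lemma T_cmul: "T (\<lambda>y. c * \<Delta> y) = c * T \<Delta>"
  by (simp add: T_def mult.assoc right_diff_distrib flip: sum_distrib_left)

lemma T_cong: "(\<And>y. y \<in> {l..u} \<Longrightarrow> \<Delta> y = \<Delta>' y) \<Longrightarrow> T \<Delta> = T \<Delta>'"
proof -
  assume *: "\<And>y. y \<in> {l..u} \<Longrightarrow> \<Delta> y = \<Delta>' y"
  have "(\<lambda>y. \<Delta> y * q y) = (\<lambda>y. \<Delta>' y * q y)"
  proof
    fix y show "\<Delta> y * q y = \<Delta>' y * q y" using * q_outside[of y] by (cases "y \<in> {l..u}") auto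
  qed
  then show ?thesis unfolding T_def using * data by simp
qed

lemma T_variational: "adm \<Delta> \<Longrightarrow> \<tau> > 0 \<Longrightarrow> concave_on {l..u} (\<lambda>y. g y + \<tau> * \<Delta> y) \<Longrightarrow> T \<Delta> \<le> 0"
  using variational[of \<Delta> \<tau>] by (simp add: T_def adm_def)

lemma T_concave: "adm \<Delta> \<Longrightarrow> concave_on {l..u} \<Delta> \<Longrightarrow> T \<Delta> \<le> 0"
  using T_variational[of \<Delta> 1] concave_on_add[OF g] by simp

text \<open>Affine directions are admissible with both signs. In particular \<open>q\<close> has
  mass one and the same mean as the sample.\<close>

lemma T_affine: "T (\<lambda>y. a + b * y) = 0"
proof -
  have "T (\<lambda>y. a + b * y) \<le> 0" for a b by (intro T_concave adm_ramps concave_on_affine) simp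
  from this[of a b] this[of "-a" "-b"] T_cmul[of "-1" "\<lambda>y. a + b * y"] show ?thesis
    by (simp add: algebra_simps)
qed

lemma ramp_concave: "concave_on {l..u} (\<lambda>y. - max 0 (p - y))" "concave_on {l..u} (\<lambda>y. - max 0 (y - p))"
proof -
  have 1: "concave_on {l..u} (\<lambda>y. min (0 + 0 * y) (- p + 1 * y))" and 2: "concave_on {l..u} (\<lambda>y. min (0 + 0 * y) (p + (-1) * y))"
    by (intro concave_on_min concave_on_affine; simp)+
  show "concave_on {l..u} (\<lambda>y. - max 0 (p - y))" by (rule concave_on_cong'[OF 1]) auto
  show "concave_on {l..u} (\<lambda>y. - max 0 (y - p))" by (rule concave_on_cong'[OF 2]) auto
qed

section \<open>Knots and the shape of the estimator between them\<close>

lemma T_ramp: "0 \<le> T (\<lambda>y. max 0 (p - y))" "0 \<le> T (\<lambda>y. max 0 (y - p))"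
proof -
  have "adm (\<lambda>y. - max 0 (p - y))" "adm (\<lambda>y. - max 0 (y - p))"
    by (rule adm_continuous, intro continuous_intros)+
  then have "T (\<lambda>y. - max 0 (p - y)) \<le> 0" "T (\<lambda>y. - max 0 (y - p)) \<le> 0"
    using T_concave ramp_concave by blast+
  then show "0 \<le> T (\<lambda>y. max 0 (p - y))" "0 \<le> T (\<lambda>y. max 0 (y - p))"
    using T_cmul[of "-1" "\<lambda>y. max 0 (p - y)"] T_cmul[of "-1" "\<lambda>y. max 0 (y - p)"] by auto
qed

text \<open>\<open>T (\<lambda>y. max 0 (k - y))\<close> is the integral up to \<open>k\<close> of
  the empirical minus the estimated distribution function. It is never negative, and knots are the
  observations where it vanishes. This encoding supplies directly the equalities on which the test
  functions rest, and \<open>knot_at_kink\<close> shows that it captures every strict drop of slope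
  at an inner observation.\<close>

definition knot :: "real \<Rightarrow> bool" where
  "knot k \<longleftrightarrow> k \<in> x ` {..<n} \<and> T (\<lambda>y. max 0 (k - y)) \<le> 0"

lemma knot_range: "knot k \<Longrightarrow> k \<in> {l..u}"
  using data by (auto simp: knot_def)

lemma finite_knots: "finite {k. knot k}"
  by (rule finite_subset[of _ "x ` {..<n}"]) (auto simp: knot_def)

lemma knot_ramp: assumes "knot k" shows "T (\<lambda>y. max 0 (k - y)) = 0" "T (\<lambda>y. max 0 (y - k)) = 0"
proof -
  show 1: "T (\<lambda>y. max 0 (k - y)) = 0" using assms T_ramp[of k] by (simp add: knot_def)
  have "T (\<lambda>y. max 0 (y - k)) = T (\<lambda>y. max 0 (k - y) + (- k + 1 * y))"
    by (rule T_cong) (auto simp: max_def)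
  also have "\<dots> = T (\<lambda>y. max 0 (k - y)) + T (\<lambda>y. - k + 1 * y)" by (intro T_add adm_ramps)
  finally show "T (\<lambda>y. max 0 (y - k)) = 0" unfolding 1 T_affine by simp
qed

lemma knot_l: "knot l"
proof -
  have "T (\<lambda>y. max 0 (l - y)) = T (\<lambda>y. 0 + 0 * y)" by (rule T_cong) auto
  also have "\<dots> = 0" by (rule T_affine)
  finally show ?thesis using l_data by (simp add: knot_def)
qed

lemma knot_u: "knot u"
proof -
  have "T (\<lambda>y. max 0 (u - y)) = T (\<lambda>y. u + (-1) * y)" by (rule T_cong) auto
  also have "\<dots> = 0" by (rule T_affine)
  finally show ?thesis using u_data by (simp add: knot_def)
qed

lemma T_tendsto:
  assumes adm: "\<And>j. \<Delta>' j \<in> borel_measurable borel" "\<Delta> \<in> borel_measurable borel"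
    and b: "\<And>j y. \<bar>\<Delta>' j y\<bar> \<le> B"
    and lim: "\<And>y. (\<lambda>j. \<Delta>' j y) \<longlonglongrightarrow> \<Delta> y"
  shows "(\<lambda>j. T (\<Delta>' j)) \<longlonglongrightarrow> T \<Delta>"
  unfolding T_def
proof (intro tendsto_diff tendsto_divide tendsto_sum lim)
  note adm[measurable]
  show "(\<lambda>j. LINT y|lborel. \<Delta>' j y * q y) \<longlonglongrightarrow> (LINT y|lborel. \<Delta> y * q y)"
  proof (rule integral_dominated_convergence[where w = "\<lambda>y. B * q y"])
    show "AE y in lborel. (\<lambda>j. \<Delta>' j y * q y) \<longlonglongrightarrow> \<Delta> y * q y"
      using lim by (auto intro!: tendsto_mult)
    show "AE y in lborel. norm (\<Delta>' j y * q y) \<le> B * q y" for j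
      using b q_nonneg by (auto simp: abs_mult intro!: mult_right_mono)
  qed (use q_int in auto)
qed (use n in auto)

text \<open>Difference quotients of a ramp with respect to its end point: they converge to a step
  that is open at \<open>k\<close>, and they are uniformly bounded, as dominated convergence
  requires.\<close>

lemma step_limit:
  fixes k y :: real
  shows "(\<lambda>j. real (Suc j) * (max 0 (k - y) - max 0 (k - 1 / real (Suc j) - y))) \<longlonglongrightarrow> indicator {..<k} y"
    and "\<bar>real (Suc j) * (max 0 (k - y) - max 0 (k - 1 / real (Suc j) - y))\<bar> \<le> 1"
proof -
  show "\<bar>real (Suc j) * (max 0 (k - y) - max 0 (k - 1 / real (Suc j) - y))\<bar> \<le> 1"
  proof -
    have "\<bar>max 0 (k - y) - max 0 (k - 1 / real (Suc j) - y)\<bar> \<le> 1 / real (Suc j)"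
    proof -
      have *: "\<bar>max 0 (k - y) - max 0 (k - e - y)\<bar> \<le> e" if "e \<ge> 0" for e using that by (auto simp: max_def)
      show ?thesis by (rule *) simp
    qed
    then have "real (Suc j) * \<bar>max 0 (k - y) - max 0 (k - 1 / real (Suc j) - y)\<bar> \<le> real (Suc j) * (1 / real (Suc j))"
      by (intro mult_left_mono) auto
    also have "\<dots> = 1" by simp
    finally show ?thesis by (simp only: abs_mult abs_of_nat)
  qed
  show "(\<lambda>j. real (Suc j) * (max 0 (k - y) - max 0 (k - 1 / real (Suc j) - y))) \<longlonglongrightarrow> indicator {..<k} y"
  proof (cases "y < k")
    case True
    have "eventually (\<lambda>j. 1 / real (Suc j) < k - y) sequentially"
      using True LIMSEQ_inverse_real_of_nat[THEN order_tendstoD(2), of "k - y"] by (simp add: inverse_eq_divide)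
    then have "eventually (\<lambda>j. real (Suc j) * (max 0 (k - y) - max 0 (k - 1 / real (Suc j) - y)) = indicator {..<k} y) sequentially"
    proof eventually_elim
      case (elim j)
      have "max 0 (k - y) - max 0 (k - 1 / real (Suc j) - y) = 1 / real (Suc j)"
        using elim True by (simp add: max_def)
      then have "real (Suc j) * (max 0 (k - y) - max 0 (k - 1 / real (Suc j) - y)) = 1" by (simp only:) simp
      then show ?case using True by simp
    qed
    then show ?thesis by (rule tendsto_eventually)
  next
    case False
    have "max 0 (k - y) - max 0 (k - 1 / real (Suc j) - y) = 0" for j
    proof -
      have *: "max 0 (k - y) - max 0 (k - e - y) = 0" if "e > 0" for e using that False by simp
      show ?thesis by (rule *) simp
    qed
    then show ?thesis using False by (simp only:) simp
  qed
qed

text \<open>As a function of the end point, \<open>T\<close> of the ramp is nonnegative and vanishes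
  at \<open>k\<close>. Its left difference quotients at \<open>k\<close> are therefore at most
  \<open>0\<close>, and so is their limit.\<close>

lemma T_below: assumes "knot k" shows "T (indicator {..<k}) \<le> 0"
proof (rule LIMSEQ_le_const2)
  let ?D = "\<lambda>j y. real (Suc j) * (max 0 (k - y) - max 0 (k - 1 / real (Suc j) - y))"
  show "(\<lambda>j. T (?D j)) \<longlonglongrightarrow> T (indicator {..<k})"
    by (rule T_tendsto[where B = 1]) (use step_limit in \<open>auto simp del: of_nat_Suc\<close>)
  have "T (?D j) \<le> 0" for j
  proof -
    have "T (\<lambda>y. max 0 (k - y) + (-1) * max 0 ((k - 1 / real (Suc j)) - y)) = T (\<lambda>y. max 0 (k - y)) + T (\<lambda>y. (-1) * max 0 ((k - 1 / real (Suc j)) - y))"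
      by (intro T_add adm_cmul adm_ramps)
    also have "\<dots> = - T (\<lambda>y. max 0 ((k - 1 / real (Suc j)) - y))" unfolding T_cmul knot_ramp[OF assms] by simp
    also have "\<dots> \<le> 0" using T_ramp[of "k - 1 / real (Suc j)"] by simp
    finally have "T (\<lambda>y. max 0 (k - y) + (-1) * max 0 ((k - 1 / real (Suc j)) - y)) \<le> 0" .
    then have "T (\<lambda>y. max 0 (k - y) - max 0 (k - 1 / real (Suc j) - y)) \<le> 0" by simp
    then show ?thesis unfolding T_cmul by (intro mult_nonneg_nonpos) auto
  qed
  then show "\<exists>N. \<forall>j\<ge>N. T (?D j) \<le> 0" by blast
qed

text \<open>Mirror image of \<open>T_below\<close>, with \<open>step_limit\<close> applied to
  \<open>- k\<close> and \<open>- y\<close>.\<close>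

lemma T_above: assumes "knot k" shows "T (indicator {k<..}) \<le> 0"
proof (rule LIMSEQ_le_const2)
  let ?D = "\<lambda>j y. real (Suc j) * (max 0 (- k - (- y)) - max 0 (- k - 1 / real (Suc j) - (- y)))"
  have ind: "indicator {k<..} y = (indicator {..<-k} (-y) :: real)" for y by (simp add: indicator_def)
  show "(\<lambda>j. T (?D j)) \<longlonglongrightarrow> T (indicator {k<..})"
  proof (rule T_tendsto[where B = 1])
    show "(\<lambda>j. ?D j y) \<longlonglongrightarrow> indicator {k<..} y" for y unfolding ind by (rule step_limit)
    show "\<bar>?D j y\<bar> \<le> 1" for j y by (rule step_limit)
  qed auto
  have "T (?D j) \<le> 0" for j
  proof -
    have "T (\<lambda>y. max 0 (y - k) + (-1) * max 0 (y - (k + 1 / real (Suc j)))) = T (\<lambda>y. max 0 (y - k)) + T (\<lambda>y. (-1) * max 0 (y - (k + 1 / real (Suc j))))"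
      by (intro T_add adm_cmul adm_ramps)
    also have "\<dots> = - T (\<lambda>y. max 0 (y - (k + 1 / real (Suc j))))" unfolding T_cmul knot_ramp[OF assms] by simp
    also have "\<dots> \<le> 0" using T_ramp[of "k + 1 / real (Suc j)"] by simp
    finally have "T (\<lambda>y. max 0 (y - k) + (-1) * max 0 (y - (k + 1 / real (Suc j)))) \<le> 0" .
    also have "(\<lambda>y. max 0 (y - k) + (-1) * max 0 (y - (k + 1 / real (Suc j)))) =
       (\<lambda>y. max 0 (- k - (- y)) - max 0 (- k - 1 / real (Suc j) - (- y)))"
      by (auto simp: algebra_simps)
    finally show ?thesis unfolding T_cmul by (intro mult_nonneg_nonpos) auto
  qed
  then show "\<exists>N. \<forall>j\<ge>N. T (?D j) \<le> 0" by blast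
qed

text \<open>If \<open>g\<close> rose above its chord on a gap without observations, replacing it
  there by the chord would keep it concave, leave the sample sum unchanged and strictly decrease the
  integral.\<close>

lemma affine_between_data:
  assumes jk: "j \<in> {l..u}" "k \<in> {l..u}" "j < k" and nodata: "\<And>i. i < n \<Longrightarrow> x i \<notin> {j<..<k}"
    and y: "y \<in> {j..k}"
  shows "(k - j) * g y = (k - y) * g j + (y - j) * g k"
proof (rule ccontr)
  assume ne: "(k - j) * g y \<noteq> (k - y) * g j + (y - j) * g k"
  define line where "line z = ((k - z) * g j + (z - j) * g k) / (k - j)" for z
  have line: "(k - j) * line z = (k - z) * g j + (z - j) * g k" for z
    using jk by (simp add: line_def)
  have line_affine: "line z = ((k * g j - j * g k) / (k - j)) + ((g k - g j) / (k - j)) * z" for z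
    unfolding line_def by (simp add: add_divide_distrib diff_divide_distrib algebra_simps)
  have cline: "concave_on {l..u} line"
    by (rule concave_on_cong'[OF concave_on_affine[of "{l..u}" "(k * g j - j * g k) / (k - j)" "(g k - g j) / (k - j)"]])
      (auto simp: line_affine)
  define h where "h z = g z - line z" for z
  have h: "concave_on {l..u} h"
  proof -
    have "concave_on {l..u} (\<lambda>z. g z + ((- ((k * g j - j * g k) / (k - j))) + (- ((g k - g j) / (k - j))) * z))"
      by (intro concave_on_add g concave_on_affine) simp
    then show ?thesis by (rule concave_on_cong') (simp add: h_def line_affine)
  qed
  have hjk: "h j = 0" "h k = 0" using jk by (auto simp: h_def line_def)
  have hin: "0 \<le> h z" if "z \<in> {j..k}" for z
  proof -
    have "(k - z) * h j + (z - j) * h k \<le> (k - j) * h z"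
      using that jk by (intro concave_on_three_points[OF h]) auto
    then show ?thesis using jk hjk by (simp add: zero_le_mult_iff)
  qed
  have "h y \<noteq> 0" using ne line[of y] by (auto simp: h_def)
  then have hy: "h y > 0" using hin[OF y] by simp
  then have yjk: "j < y" "y < k" using y hjk by (auto simp: less_eq_real_def)
  have hpos: "0 < h z" if "z \<in> {j<..<k}" for z
  proof (cases "z \<le> y")
    case True
    have "(y - z) * h j + (z - j) * h y \<le> (y - j) * h z"
      using that jk y True by (intro concave_on_three_points[OF h]) auto
    moreover have "0 < (z - j) * h y" using that hy by simp
    ultimately have "0 < (y - j) * h z" using hjk by simp
    then show ?thesis using yjk by (simp add: zero_less_mult_iff)
  next
    case False
    have "(k - z) * h y + (z - y) * h k \<le> (k - y) * h z"
      using that jk y False by (intro concave_on_three_points[OF h]) auto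
    moreover have "0 < (k - z) * h y" using that hy by simp
    ultimately have "0 < (k - y) * h z" using hjk by simp
    then show ?thesis using yjk by (simp add: zero_less_mult_iff)
  qed
  have hout: "h z \<le> 0" if "z \<in> {l..u}" "z \<notin> {j<..<k}" for z
  proof (cases "z \<le> j")
    case True
    have "(k - j) * h z + (j - z) * h k \<le> (k - z) * h j"
      using that jk True by (intro concave_on_three_points[OF h]) auto
    then have "(k - j) * h z \<le> 0" using hjk by simp
    then show ?thesis using jk by (simp add: mult_le_0_iff)
  next
    case False
    have "(z - k) * h j + (k - j) * h z \<le> (z - j) * h k"
      using that jk False by (intro concave_on_three_points[OF h]) auto
    then have "(k - j) * h z \<le> 0" using hjk by simp
    then show ?thesis using jk by (simp add: mult_le_0_iff)
  qed
  \<comment> \<open>Written with \<open>ln (q z)\<close> instead of \<open>g z\<close>, because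
    measurability is known for \<open>q\<close>.\<close>
  define \<Delta> where "\<Delta> z = (if z \<in> {j<..<k} then line z - ln (q z) else 0)" for z
  have lnq: "ln (q z) = g z" if "z \<in> {l..u}" for z using that by (simp add: q_def)
  have \<Delta>: "\<Delta> z = (if z \<in> {j<..<k} then - h z else 0)" for z
    using jk lnq[of z] by (auto simp: \<Delta>_def h_def)
  obtain B where B: "\<And>z. z \<in> {l..u} \<Longrightarrow> \<bar>h z\<bar> \<le> B" using concave_on_Icc_bounded[OF h] by blast
  have line_meas[measurable]: "line \<in> borel_measurable borel" unfolding line_def by measurable
  have \<Delta>_meas: "\<Delta> \<in> borel_measurable borel" unfolding \<Delta>_def by measurable
  have adm: "adm \<Delta>"
  proof (rule adm_bounded[OF \<Delta>_meas])
    fix z assume z: "z \<in> {l..u}"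
    show "\<bar>\<Delta> z\<bar> \<le> \<bar>B\<bar>" using B[OF z] by (auto simp: \<Delta>)
  qed
  have "T \<Delta> \<le> 0"
  proof (rule T_variational[OF adm zero_less_one])
    \<comment> \<open>Concavity places \<open>g\<close> strictly above the line inside the gap and
      nowhere else, so the minimum with the whole line is the modified function.\<close>
    have "concave_on {l..u} (\<lambda>z. min (g z) (line z))" by (intro concave_on_min g cline)
    then show "concave_on {l..u} (\<lambda>z. g z + 1 * \<Delta> z)"
    proof (rule concave_on_cong')
      fix z assume z: "z \<in> {l..u}"
      show "min (g z) (line z) = g z + 1 * \<Delta> z"
        using hpos[of z] hout[OF z] by (auto simp: \<Delta> h_def)
    qed
  qed
  moreover have "(\<Sum>i<n. \<Delta> (x i)) = 0" using nodata by (intro sum.neutral) (auto simp: \<Delta>)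
  ultimately have "0 \<le> (LINT z|lborel. \<Delta> z * q z)" by (simp add: T_def)
  then have le: "(LINT z|lborel. - (\<Delta> z * q z)) \<le> 0" by simp
  have nonneg: "0 \<le> - (\<Delta> z * q z)" for z
    using hpos[of z] q_nonneg[of z] by (auto simp: \<Delta>)
  have int: "integrable lborel (\<lambda>z. - (\<Delta> z * q z))" using adm_integrable[OF adm] by simp
  have "0 \<le> (LINT z|lborel. - (\<Delta> z * q z))" by (intro integral_nonneg_AE AE_I2 nonneg)
  then have "(LINT z|lborel. - (\<Delta> z * q z)) = 0" using le by linarith
  then have "AE z in lborel. - (\<Delta> z * q z) = 0"
    using integral_nonneg_eq_0_iff_AE[OF int] nonneg by simp
  then have "AE z in lborel. z \<notin> {j<..<k}"
  proof (rule AE_mp, intro AE_I2 impI)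
    fix z assume "- (\<Delta> z * q z) = 0"
    then show "z \<notin> {j<..<k}" using hpos[of z] jk by (auto simp: \<Delta> q_def)
  qed
  then have "{j<..<k} \<in> null_sets lborel" by (subst AE_iff_null_sets) auto
  then have "emeasure lborel {j<..<k} = 0" by auto
  then show False using jk by simp
qed

text \<open>Adding the ramp lowers all slopes left of \<open>k\<close> by \<open>m\<close>, which
  the kink can afford. After subtraction of an affine function of slope \<open>b\<close> the sum has
  its maximum at \<open>k\<close>, so the gluing lemma gives concavity and the ramp becomes an
  admissible direction.\<close>

lemma knot_at_kink:
  assumes k: "k \<in> x ` {..<n}" and lk: "l < k" "k < u" and m: "m > 0"
    and left: "\<And>y. y \<in> {l..k} \<Longrightarrow> g y \<le> g k + (b + m) * (y - k)"
    and right: "\<And>y. y \<in> {k..u} \<Longrightarrow> g y \<le> g k + b * (y - k)"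
  shows "knot k"
proof -
  have "concave_on {l..u} (\<lambda>y. (g y + m * max 0 (k - y)) + (- (g k) + b * k + (- b) * y))"
  proof (rule concave_on_glue_at_maximum[where k = k])
    show "concave_on {l..k} (\<lambda>y. (g y + m * max 0 (k - y)) + (- (g k) + b * k + (- b) * y))"
    proof -
      have "concave_on {l..k} (\<lambda>y. g y + ((m * k - g k + b * k) + (- m - b) * y))"
        using lk by (intro concave_on_add concave_on_mono[OF g] concave_on_affine) auto
      then show ?thesis by (rule concave_on_cong') (auto simp: max_def algebra_simps)
    qed
    show "concave_on {k..u} (\<lambda>y. (g y + m * max 0 (k - y)) + (- (g k) + b * k + (- b) * y))"
    proof -
      have "concave_on {k..u} (\<lambda>y. g y + ((- g k + b * k) + (- b) * y))"
        using lk by (intro concave_on_add concave_on_mono[OF g] concave_on_affine) auto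
      then show ?thesis by (rule concave_on_cong') (auto simp: max_def algebra_simps)
    qed
    fix y assume y: "y \<in> {l..u}"
    show "(g y + m * max 0 (k - y)) + (- (g k) + b * k + (- b) * y)
      \<le> (g k + m * max 0 (k - k)) + (- (g k) + b * k + (- b) * k)"
    proof (cases "y \<le> k")
      case True
      then show ?thesis using left[of y] y by (simp add: max_def algebra_simps)
    next
      case False
      then show ?thesis using right[of y] y by (simp add: max_def algebra_simps)
    qed
  qed
  moreover have "concave_on {l..u} (\<lambda>y. (g k - b * k) + b * y)" by (rule concave_on_affine) simp
  ultimately have "concave_on {l..u} (\<lambda>y. ((g y + m * max 0 (k - y)) + (- (g k) + b * k + (- b) * y)) + ((g k - b * k) + b * y))"
    by (rule concave_on_add)
  then have "concave_on {l..u} (\<lambda>y. g y + m * max 0 (k - y))"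
    by (rule concave_on_cong') simp
  then show ?thesis using T_variational[OF adm_ramps(1) m] k by (simp add: knot_def)
qed

text \<open>Measured from the chord, \<open>g\<close> is linear between neighbouring observations.
  Were it not zero throughout, its maximum over the observations would be positive and attained
  strictly between \<open>s\<close> and \<open>t\<close>, at a kink and hence at a knot.\<close>

lemma affine_between_knots:
  assumes s: "s \<in> x ` {..<n}" and t: "t \<in> x ` {..<n}" and st: "s < t"
    and nok: "\<And>k. s < k \<Longrightarrow> k < t \<Longrightarrow> \<not> knot k" and y: "y \<in> {s..t}"
  shows "(t - s) * g y = (t - y) * g s + (y - s) * g t"
proof (rule ccontr)
  assume ne: "(t - s) * g y \<noteq> (t - y) * g s + (y - s) * g t"
  have st_lu: "s \<in> {l..u}" "t \<in> {l..u}" using s t data by auto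
  define b where "b = (g t - g s) / (t - s)"
  have bts: "b * (t - s) = g t - g s" using st by (simp add: b_def)
  define h where "h z = g z - g s - b * (z - s)" for z
  have h: "concave_on {l..u} h"
  proof -
    have "concave_on {l..u} (\<lambda>z. g z + ((- g s + b * s) + (- b) * z))"
      by (intro concave_on_add g concave_on_affine) simp
    then show ?thesis by (rule concave_on_cong') (simp add: h_def algebra_simps)
  qed
  have hst: "h s = 0" "h t = 0" using bts by (auto simp: h_def algebra_simps)
  define D where "D = {k \<in> x ` {..<n}. s \<le> k \<and> k \<le> t}"
  have D: "finite D" "s \<in> D" "t \<in> D" using s t st by (auto simp: D_def)
  have between: "(k - j) * h z = (k - z) * h j + (z - j) * h k"
    if "j \<in> D" "k \<in> D" "j < k" "\<And>d. d \<in> D \<Longrightarrow> \<not> (j < d \<and> d < k)" "z \<in> {j..k}" for j k z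
  proof -
    have "(k - j) * g z = (k - z) * g j + (z - j) * g k"
    proof (rule affine_between_data)
      show "x i \<notin> {j<..<k}" if "i < n" for i using \<open>j \<in> D\<close> \<open>k \<in> D\<close> that \<open>\<And>d. d \<in> D \<Longrightarrow> \<not> (j < d \<and> d < k)\<close>
        by (force simp: D_def)
    qed (use that st_lu in \<open>auto simp: D_def\<close>)
    then show ?thesis by (simp add: h_def algebra_simps)
  qed
  define v where "v = Max (h ` D)"
  have v: "\<And>d. d \<in> D \<Longrightarrow> h d \<le> v" "v \<in> h ` D"
    using D unfolding v_def by (auto intro: Max_ge Max_in)
  have "v \<ge> 0" using v(1)[OF D(2)] hst by simp
  have "h y \<noteq> 0"
  proof
    assume "h y = 0"
    then have gy: "g y = g s + b * (y - s)" by (simp add: h_def)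
    have "(t - s) * g y = (t - s) * g s + (b * (t - s)) * (y - s)" unfolding gy by (simp add: algebra_simps)
    then have "(t - s) * g y = (t - s) * g s + (g t - g s) * (y - s)" unfolding bts .
    then show False using ne by (simp add: algebra_simps)
  qed
  have "0 \<le> (t - s) * h y"
    using concave_on_three_points[OF h, of s t y] st_lu y hst by auto
  then have hy: "h y > 0" using \<open>h y \<noteq> 0\<close> st by (simp add: zero_le_mult_iff)
  \<comment> \<open>Between neighbouring observations \<open>h\<close> interpolates linearly, so
    \<open>h y > 0\<close> forces a positive value at an observation.\<close>
  have "v > 0"
  proof (rule ccontr)
    assume "\<not> v > 0"
    then have hD: "h d \<le> 0" if "d \<in> D" for d using v(1)[OF that] by simp
    define j where "j = Max {d \<in> D. d \<le> y}"
    define k where "k = Min {d \<in> D. y \<le> d}"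
    have "j \<in> {d \<in> D. d \<le> y}" unfolding j_def using D y by (intro Max_in) auto
    moreover have "k \<in> {d \<in> D. y \<le> d}" unfolding k_def using D y by (intro Min_in) auto
    moreover have "d \<le> j" if "d \<in> D" "d \<le> y" for d unfolding j_def using D that by (intro Max_ge) auto
    moreover have "k \<le> d" if "d \<in> D" "y \<le> d" for d unfolding k_def using D that by (intro Min_le) auto
    ultimately have jk: "j \<in> D" "k \<in> D" "j \<le> y" "y \<le> k" "\<And>d. d \<in> D \<Longrightarrow> \<not> (j < d \<and> d < k)" by force+
    have "h y \<le> 0"
    proof (cases "j = k")
      case True
      then show ?thesis using jk hD by (metis order_antisym)
    next
      case False
      then have "(k - j) * h y = (k - y) * h j + (y - j) * h k" using jk by (intro between) auto
      also have "\<dots> \<le> 0" using jk hD by (intro add_nonpos_nonpos mult_nonneg_nonpos) auto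
      finally show ?thesis using False jk by (simp add: mult_le_0_iff)
    qed
    then show False using hy by simp
  qed
  \<comment> \<open>The leftmost maximiser: the slope on its left is then strictly positive, the one
    on its right at most zero.\<close>
  define k where "k = Min {d \<in> D. h d = v}"
  have kin: "k \<in> {d \<in> D. h d = v}" unfolding k_def using D v by (intro Min_in) auto
  have kmin: "k \<le> d" if "d \<in> D" "h d = v" for d unfolding k_def using D that by (intro Min_le) auto
  have k: "k \<in> D" "h k = v" using kin by auto
  have "k \<noteq> s" "k \<noteq> t" using k hst \<open>v > 0\<close> by auto
  then have sk: "s < k" "k < t" using k by (auto simp: D_def)
  define j where "j = Max {d \<in> D. d < k}"
  have "j \<in> {d \<in> D. d < k}" unfolding j_def using D sk by (intro Max_in) auto
  moreover have jmax: "d \<le> j" if "d \<in> D" "d < k" for d unfolding j_def using D that by (intro Max_ge) auto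
  ultimately have j: "j \<in> D" "j < k" by auto
  define j' where "j' = Min {d \<in> D. k < d}"
  have "j' \<in> {d \<in> D. k < d}" unfolding j'_def using D sk by (intro Min_in) auto
  moreover have jmin: "j' \<le> d" if "d \<in> D" "k < d" for d unfolding j'_def using D that by (intro Min_le) auto
  ultimately have j': "j' \<in> D" "k < j'" by auto
  have lu_D: "d \<in> {l..u}" if "d \<in> D" for d using that st_lu by (auto simp: D_def)
  have "h j < v" using v(1)[OF j(1)] kmin[OF j(1)] j(2) by force
  define m where "m = (h k - h j) / (k - j)"
  have m: "m > 0" using \<open>h j < v\<close> k j by (simp add: m_def)
  have mkj: "m * (k - j) = h k - h j" using j by (simp add: m_def)
  have left: "h z \<le> h k + m * (z - k)" if z: "z \<in> {l..k}" for z
  proof (cases "z \<le> j")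
    case True
    have "(k - j) * h z + (j - z) * h k \<le> (k - z) * h j"
      using True z j lu_D[OF k(1)] lu_D[OF j(1)] by (intro concave_on_three_points[OF h]) auto
    also have "h j = h k - m * (k - j)" using mkj by simp
    finally have "(k - j) * h z \<le> (k - j) * (h k + m * (z - k))" by (simp add: algebra_simps)
    then show ?thesis using j by simp
  next
    case False
    have "(k - j) * h z = (k - z) * h j + (z - j) * h k"
      using False z j k jmax by (intro between) force+
    also have "h j = h k - m * (k - j)" using mkj by simp
    finally have "(k - j) * h z = (k - j) * (h k + m * (z - k))" by (simp add: algebra_simps)
    then show ?thesis using j by simp
  qed
  have right: "h z \<le> h k" if z: "z \<in> {k..u}" for z
  proof (cases "z \<le> j'")
    case True
    have "(j' - k) * h z = (j' - z) * h k + (z - k) * h j'"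
      using True z j' k jmin by (intro between) force+
    also have "\<dots> \<le> (j' - z) * h k + (z - k) * h k"
      using v(1)[OF j'(1)] k z by (intro add_left_mono mult_left_mono) auto
    also have "\<dots> = (j' - k) * h k" by (simp add: algebra_simps)
    finally show ?thesis using j' by simp
  next
    case False
    have "(z - j') * h k + (j' - k) * h z \<le> (z - k) * h j'"
      using False z j' lu_D[OF k(1)] lu_D[OF j'(1)] by (intro concave_on_three_points[OF h]) auto
    also have "\<dots> \<le> (z - k) * h k" using v(1)[OF j'(1)] k z by (intro mult_left_mono) auto
    finally have "(j' - k) * h z \<le> (j' - k) * h k" by (simp add: algebra_simps)
    then show ?thesis using j' by simp
  qed
  have "knot k"
  proof (rule knot_at_kink[OF _ _ _ m, where b = b])
    show "k \<in> x ` {..<n}" using k by (simp add: D_def)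
    show "l < k" "k < u" using sk st_lu by auto
    show "g z \<le> g k + (b + m) * (z - k)" if "z \<in> {l..k}" for z
      using left[OF that] by (simp add: h_def algebra_simps)
    show "g z \<le> g k + b * (z - k)" if "z \<in> {k..u}" for z
      using right[OF that] by (simp add: h_def algebra_simps)
  qed
  then show False using nok sk by blast
qed

end

section \<open>From maximality of the criterion to the variational inequality\<close>

lemma integrable_indicator_Icc: "integrable lborel (indicator {a..b::real} :: real \<Rightarrow> real)"
  by (rule integrable_real_indicator) (auto simp: emeasure_lborel_Icc_eq)

lemma cut_measurable:
  fixes h :: "real \<Rightarrow> real"
  assumes "concave_on {l..u} h"
  shows "(\<lambda>y. if y \<in> {l..u} then exp (h y) else 0) \<in> borel_measurable borel"
proof -
  have "(\<lambda>y. if y \<in> {l..u} then exp (h y) else 0) =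
      (\<lambda>y. ext_exp (if y \<in> {l..u} then ereal (h y) else -\<infinity>))" by auto
  then show ?thesis using borel_measurable_ext_exp_concave[OF ext_concave_cut[OF assms]] by simp
qed

lemma cut_integrable:
  fixes h :: "real \<Rightarrow> real"
  assumes "concave_on {l..u} h"
  shows "integrable lborel (\<lambda>y. if y \<in> {l..u} then exp (h y) else 0)"
proof -
  obtain B where B: "\<And>y. y \<in> {l..u} \<Longrightarrow> \<bar>h y\<bar> \<le> B" using concave_on_Icc_bounded[OF assms] by blast
  note [measurable] = cut_measurable[OF assms]
  show ?thesis
  proof (rule Bochner_Integration.integrable_bound[of _ "\<lambda>y. exp B * indicator {l..u} y"])
    show "AE y in lborel. norm (if y \<in> {l..u} then exp (h y) else 0) \<le> norm (exp B * indicator {l..u} y)"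
    proof (rule AE_I2)
      fix y show "norm (if y \<in> {l..u} then exp (h y) else 0) \<le> norm (exp B * indicator {l..u} y)"
        using B[of y] by (auto simp: abs_le_iff)
    qed
    show "(\<lambda>y. if y \<in> {l..u} then exp (h y) else 0) \<in> borel_measurable lborel"
      using cut_measurable[OF assms] by simp
    show "integrable lborel (\<lambda>y. exp B * indicator {l..u} y)"
      by (intro integrable_mult_right integrable_indicator_Icc)
  qed
qed

lemma Psi_cut:
  assumes n: "n > 0" and data: "\<And>i. i < n \<Longrightarrow> x i \<in> {l..u}" and h: "concave_on {l..u} h"
  shows "Psi n x (\<lambda>y. if y \<in> {l..u} then ereal (h y) else -\<infinity>) =
    ereal ((\<Sum>i<n. h (x i)) / n - (LINT y|lborel. (if y \<in> {l..u} then exp (h y) else 0)))"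
proof -
  have "(\<Sum>i<n. if x i \<in> {l..u} then ereal (h (x i)) else -\<infinity>) = (\<Sum>i<n. ereal (h (x i)))"
    using data by (intro sum.cong) auto
  also have "\<dots> = ereal (\<Sum>i<n. h (x i))" by simp
  finally have s: "(\<Sum>i<n. if x i \<in> {l..u} then ereal (h (x i)) else -\<infinity>) = ereal (\<Sum>i<n. h (x i))" .
  have "(\<integral>\<^sup>+ r. ennreal (ext_exp (if r \<in> {l..u} then ereal (h r) else -\<infinity>)) \<partial>lborel) =
      (\<integral>\<^sup>+ r. ennreal (if r \<in> {l..u} then exp (h r) else 0) \<partial>lborel)"
    by (intro nn_integral_cong) auto
  also have "\<dots> = ennreal (LINT y|lborel. (if y \<in> {l..u} then exp (h y) else 0))"
    by (intro nn_integral_eq_integral cut_integrable[OF h]) auto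
  finally have i: "(\<integral>\<^sup>+ r. ennreal (ext_exp (if r \<in> {l..u} then ereal (h r) else -\<infinity>)) \<partial>lborel) = \<dots>" .
  have "0 \<le> (LINT y|lborel. (if y \<in> {l..u} then exp (h y) else 0))" by (intro integral_nonneg_AE) auto
  then show ?thesis unfolding Psi_def s i using n by (simp add: enn2ereal_ennreal)
qed

text \<open>Two comparisons fix the shape. Against the competitor \<open>0\<close> on
  \<open>{l..u}\<close> the maximum is not -\<infinity>, so \<phi> is finite on the sample range and
  has finite mass. Against its own restriction no mass can sit outside the range; this gives
  equality with \<open>q\<close> almost everywhere. The directional inequality comes from a
  second-order bound of the exponential.\<close>

lemma concave_mle_if_is_log_concave_mle:
  fixes x :: "nat \<Rightarrow> real"
  assumes mle: "is_log_concave_mle n x \<phi>" and n: "n > 0"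
    and l: "l = Min (x ` {..<n})" and u: "u = Max (x ` {..<n})" and lu: "l < u"
  defines "g \<equiv> \<lambda>y. real_of_ereal (\<phi> y)"
  defines "q \<equiv> \<lambda>y. if y \<in> {l..u} then exp (g y) else 0"
  shows "concave_mle n x l u g q" "AE y in lborel. ext_exp (\<phi> y) = q y"
    "\<And>y. y \<in> {l..u} \<Longrightarrow> ext_exp (\<phi> y) = q y"
proof -
  have conc: "ext_concave \<phi>" and max: "\<And>\<psi>. ext_concave \<psi> \<Longrightarrow> Psi n x \<psi> \<le> Psi n x \<phi>"
    using mle by (auto simp: is_log_concave_mle_def)
  have fin: "finite (x ` {..<n})" "x ` {..<n} \<noteq> {}" using n by auto
  have data: "x i \<in> {l..u}" if "i < n" for i using fin that by (auto simp: l u)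
  have ld: "l \<in> x ` {..<n}" "u \<in> x ` {..<n}" using Min_in[OF fin] Max_in[OF fin] by (simp_all only: l u)
  define J where "J = (\<integral>\<^sup>+ r. ennreal (ext_exp (\<phi> r)) \<partial>lborel)"
  have Psi: "Psi n x \<phi> = (\<Sum>i<n. \<phi> (x i)) / ereal (real n) - enn2ereal J" by (simp add: Psi_def J_def)
  have "concave_on {l..u} (\<lambda>y. 0 + 0 * y)" by (rule concave_on_affine) simp
  then have c0: "concave_on {l..u} (\<lambda>y. 0)" by simp
  have "Psi n x (\<lambda>y. if y \<in> {l..u} then ereal 0 else -\<infinity>) \<le> Psi n x \<phi>"
    by (intro max ext_concave_cut c0)
  then have PsiM: "Psi n x \<phi> \<noteq> -\<infinity>" using Psi_cut[OF n data c0] by auto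
  have J0: "enn2ereal J \<noteq> -\<infinity>" using enn2ereal_nonneg[of J] by auto
  have Sinf: "(\<Sum>i\<in>I. \<phi> (x i)) \<noteq> \<infinity>" if "finite I" for I
    using that ext_concave_less_PInfty[OF conc] by (auto simp: sum_Pinfty)
  have fin_data: "\<phi> (x k) \<noteq> -\<infinity>" if k: "k < n" for k
  proof
    assume M: "\<phi> (x k) = -\<infinity>"
    have "(\<Sum>i<n. \<phi> (x i)) = \<phi> (x k) + (\<Sum>i\<in>{..<n} - {k}. \<phi> (x i))"
      using k by (intro sum.remove) auto
    also have "\<dots> = -\<infinity>" using M Sinf[of "{..<n} - {k}"] by (cases "\<Sum>i\<in>{..<n} - {k}. \<phi> (x i)") auto
    finally have "Psi n x \<phi> = -\<infinity>" unfolding Psi using n J0 by (cases "enn2ereal J") auto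
    then show False using PsiM by simp
  qed
  then have gx: "\<phi> (x i) = ereal (g (x i))" if "i < n" for i
    using ext_concave_finite[OF conc] that unfolding g_def by blast
  have S: "(\<Sum>i<n. \<phi> (x i)) = ereal (\<Sum>i<n. g (x i))" using gx by simp
  have "J \<noteq> \<infinity>"
  proof
    assume "J = \<infinity>"
    then have "Psi n x \<phi> = -\<infinity>" unfolding Psi S using n by simp
    then show False using PsiM by simp
  qed
  have iv: "is_interval {y. \<phi> y \<noteq> -\<infinity>}"
    using concave_on_imp_convex[OF ext_concave_imp_concave_on[OF conc]] by (simp add: is_interval_convex_1)
  have "\<phi> l \<noteq> -\<infinity>" "\<phi> u \<noteq> -\<infinity>" using ld fin_data by auto
  then have sub: "{l..u} \<subseteq> {y. \<phi> y \<noteq> -\<infinity>}" using mem_is_interval_1_I[OF iv, of l u] by auto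
  have g: "concave_on {l..u} g"
    unfolding g_def by (rule concave_on_mono[OF ext_concave_imp_concave_on[OF conc] sub]) simp
  show q: "ext_exp (\<phi> y) = q y" if "y \<in> {l..u}" for y
    using ext_concave_finite[OF conc, of y] sub that by (auto simp: q_def g_def ext_exp_def)
  have q_le: "q y \<le> ext_exp (\<phi> y)" for y using q[of y] by (cases "y \<in> {l..u}") (auto simp: q_def)
  note [measurable] = borel_measurable_ext_exp_concave[OF conc]
  have q_int: "integrable lborel q" unfolding q_def by (rule cut_integrable[OF g])
  have f_int: "integrable lborel (\<lambda>y. ext_exp (\<phi> y))"
    using \<open>J \<noteq> \<infinity>\<close> by (intro integrableI_nonneg) (auto simp: J_def less_top)
  have Jr: "enn2ereal J = ereal (LINT y|lborel. ext_exp (\<phi> y))"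
    unfolding J_def using f_int by (subst nn_integral_eq_integral) (auto simp: enn2ereal_ennreal)
  have Psi_real: "Psi n x \<phi> = ereal ((\<Sum>i<n. g (x i)) / n - (LINT y|lborel. ext_exp (\<phi> y)))"
    unfolding Psi S Jr using n by simp
  have cut_le: "(\<Sum>i<n. h (x i)) / n - (LINT y|lborel. (if y \<in> {l..u} then exp (h y) else 0)) \<le>
      (\<Sum>i<n. g (x i)) / n - (LINT y|lborel. ext_exp (\<phi> y))" if "concave_on {l..u} h" for h
  proof -
    have "ereal ((\<Sum>i<n. h (x i)) / n - (LINT y|lborel. (if y \<in> {l..u} then exp (h y) else 0))) \<le> Psi n x \<phi>"
      using max[OF ext_concave_cut[OF that]] by (subst Psi_cut[OF n data that, symmetric])
    then show ?thesis by (simp only: Psi_real ereal_less_eq)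
  qed
  have "(LINT y|lborel. ext_exp (\<phi> y)) \<le> (LINT y|lborel. q y)" using cut_le[OF g] by (simp add: q_def)
  moreover have "(LINT y|lborel. q y) \<le> (LINT y|lborel. ext_exp (\<phi> y))"
    by (intro integral_mono q_int f_int q_le)
  ultimately have eq: "(LINT y|lborel. ext_exp (\<phi> y)) = (LINT y|lborel. q y)" by simp
  have "(LINT y|lborel. ext_exp (\<phi> y) - q y) = 0" using q_int f_int eq by simp
  then have "AE y in lborel. ext_exp (\<phi> y) - q y = 0"
    using q_le integral_nonneg_eq_0_iff_AE[of lborel "\<lambda>y. ext_exp (\<phi> y) - q y"] q_int f_int by simp
  then show "AE y in lborel. ext_exp (\<phi> y) = q y" by eventually_elim simp
  show "concave_mle n x l u g q"
  proof
    fix \<Delta> :: "real \<Rightarrow> real" and \<tau> :: real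
    assume meas[measurable]: "\<Delta> \<in> borel_measurable borel" and "\<exists>B. \<forall>y\<in>{l..u}. \<bar>\<Delta> y\<bar> \<le> B"
      and \<tau>: "\<tau> > 0" and c: "concave_on {l..u} (\<lambda>y. g y + \<tau> * \<Delta> y)"
    then obtain B' where "\<And>y. y \<in> {l..u} \<Longrightarrow> \<bar>\<Delta> y\<bar> \<le> B'" by blast
    then obtain B where B: "\<And>y. y \<in> {l..u} \<Longrightarrow> \<bar>\<Delta> y\<bar> \<le> B" "B > 0"
      by (meson gt_ex less_max_iff_disj max.cobounded1 order_trans)
    have [measurable]: "q \<in> borel_measurable borel" using q_int by auto
    have q0: "q y \<ge> 0" for y by (simp add: q_def)
    have \<Delta>q_int: "integrable lborel (\<lambda>y. \<Delta> y * q y)"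
    proof (rule Bochner_Integration.integrable_bound[of _ "\<lambda>y. B * q y"])
      show "AE y in lborel. norm (\<Delta> y * q y) \<le> norm (B * q y)"
        using B q0 by (intro AE_I2) (auto simp: q_def abs_mult intro!: mult_right_mono)
    qed (use q_int in auto)
    \<comment> \<open>The quadratic remainder keeps a factor \<open>s\<close> after division by
      \<open>s\<close>, so it disappears for \<open>s\<close> tending to \<open>0\<close>.\<close>
    have small: "(\<Sum>i<n. \<Delta> (x i)) / n \<le> (LINT y|lborel. \<Delta> y * q y) + s * (B\<^sup>2 * (LINT y|lborel. q y))"
      if s: "0 < s" "s \<le> \<tau>" "s * B \<le> 1" for s
    proof -
      have cs: "concave_on {l..u} (\<lambda>y. g y + s * \<Delta> y)"
      proof -
        \<comment> \<open>For \<open>s \<le> \<tau>\<close> the perturbed function is a convex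
          combination of \<open>g\<close> and the function assumed concave.\<close>
        have "concave_on {l..u} (\<lambda>y. (1 - s / \<tau>) * g y + (s / \<tau>) * (g y + \<tau> * \<Delta> y))"
          using s \<tau> by (intro concave_on_add concave_on_cmul g c) auto
        then show ?thesis by (rule concave_on_cong') (use \<tau> in \<open>simp add: field_simps\<close>)
      qed
      define qs where "qs y = (if y \<in> {l..u} then exp (g y + s * \<Delta> y) else 0)" for y
      have qs_int: "integrable lborel qs" unfolding qs_def by (rule cut_integrable[OF cs])
      have "(\<Sum>i<n. g (x i) + s * \<Delta> (x i)) / n - (LINT y|lborel. qs y) \<le> (\<Sum>i<n. g (x i)) / n - (LINT y|lborel. q y)"
        using cut_le[OF cs] unfolding eq qs_def .
      then have "s * ((\<Sum>i<n. \<Delta> (x i)) / n) \<le> (LINT y|lborel. qs y) - (LINT y|lborel. q y)"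
        by (simp add: sum.distrib add_divide_distrib sum_distrib_left)
      also have "\<dots> = (LINT y|lborel. qs y - q y)" using qs_int q_int by simp
      also have "\<dots> \<le> (LINT y|lborel. s * (\<Delta> y * q y) + s * (s * (B\<^sup>2 * q y)))"
      proof (intro integral_mono)
        fix y show "qs y - q y \<le> s * (\<Delta> y * q y) + s * (s * (B\<^sup>2 * q y))"
        proof (cases "y \<in> {l..u}")
          case True
          have "\<bar>s * \<Delta> y\<bar> \<le> s * B" using s B(1)[OF True] by (simp add: abs_mult)
          then have "exp (s * \<Delta> y) \<le> 1 + s * \<Delta> y + (s * \<Delta> y)\<^sup>2" using s by (intro exp_le_quadratic) auto
          also have "(s * \<Delta> y)\<^sup>2 \<le> (s * B)\<^sup>2" using \<open>\<bar>s * \<Delta> y\<bar> \<le> s * B\<close> by (intro abs_le_square_iff[THEN iffD1]) auto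
          finally have "q y * exp (s * \<Delta> y) \<le> q y * (1 + s * \<Delta> y + (s * B)\<^sup>2)"
            using q0 by (intro mult_left_mono) auto
          moreover have "qs y = q y * exp (s * \<Delta> y)" using True by (simp add: qs_def q_def exp_add)
          ultimately show ?thesis by (simp add: algebra_simps power2_eq_square)
        next
          case False
          then have "qs y = 0" "q y = 0" by (auto simp: qs_def q_def)
          then show ?thesis by simp
        qed
      qed (use qs_int q_int \<Delta>q_int in auto)
      also have "\<dots> = s * ((LINT y|lborel. \<Delta> y * q y) + s * (B\<^sup>2 * (LINT y|lborel. q y)))"
        using q_int \<Delta>q_int by (simp add: algebra_simps)
      finally show ?thesis using s(1) by (simp only: mult_le_cancel_left_pos)
    qed
    have "((\<lambda>s. (LINT y|lborel. \<Delta> y * q y) + s * (B\<^sup>2 * (LINT y|lborel. q y))) \<longlongrightarrow>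
        (LINT y|lborel. \<Delta> y * q y) + 0 * (B\<^sup>2 * (LINT y|lborel. q y))) (at_right 0)"
      by (intro tendsto_intros)
    moreover have "eventually (\<lambda>s. (\<Sum>i<n. \<Delta> (x i)) / n \<le>
        (LINT y|lborel. \<Delta> y * q y) + s * (B\<^sup>2 * (LINT y|lborel. q y))) (at_right 0)"
    proof -
      have "eventually (\<lambda>s. s \<in> {0<..<min \<tau> (1 / B)}) (at_right 0)"
        using \<tau> B(2) by (intro eventually_at_right_real) auto
      then show ?thesis
      proof eventually_elim
        case (elim s)
        then have "s * B \<le> 1" using B(2) by (simp add: pos_less_divide_eq less_imp_le)
        then show ?case using elim by (intro small) auto
      qed
    qed
    ultimately show "(\<Sum>i<n. \<Delta> (x i)) / n \<le> (LINT y|lborel. \<Delta> y * q y)"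
      using tendsto_lowerbound[OF _ _ trivial_limit_at_right_real] by fastforce
  qed (use n data ld lu g q_int in \<open>auto simp: q_def\<close>)
qed

section \<open>Noise and signal of test functions\<close>

text \<open>Fubini on the region below the graph. Restricting the level to \<open>{0..v}\<close>
  makes the indicator integrable on the product although \<open>lborel\<close> is infinite.\<close>

lemma layer_cake:
  fixes \<Delta> :: "real \<Rightarrow> real"
  assumes fm: "finite_measure \<mu>" and sets[measurable_cong]: "sets \<mu> = sets borel"
    and meas[measurable]: "\<Delta> \<in> borel_measurable borel" and range: "\<And>y. 0 \<le> \<Delta> y \<and> \<Delta> y \<le> v"
  shows "integrable lborel (\<lambda>s. indicator {0..v} s * measure \<mu> {y. s < \<Delta> y})"
    and "(LINT y|\<mu>. \<Delta> y) = (LINT s|lborel. indicator {0..v} s * measure \<mu> {y. s < \<Delta> y})"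
proof -
  interpret finite_measure \<mu> by fact
  have sf: "sigma_finite_measure \<mu>" by unfold_locales
  interpret pair_sigma_finite lborel \<mu> ..
  have sp: "space \<mu> = UNIV" using sets_eq_imp_space_eq[OF sets] by simp
  define h :: "real \<Rightarrow> real \<Rightarrow> real" where "h s y = indicator {0..v} s * indicator {0<..} (\<Delta> y - s)" for s y
  have h_meas: "case_prod h \<in> borel_measurable (lborel \<Otimes>\<^sub>M \<mu>)" unfolding h_def by measurable
  have inner_y: "(LINT y|\<mu>. h s y) = indicator {0..v} s * measure \<mu> {y. s < \<Delta> y}" for s
  proof -
    have "(LINT y|\<mu>. h s y) = (LINT y|\<mu>. indicator {0..v} s * indicator {y. s < \<Delta> y} y)"
      by (intro Bochner_Integration.integral_cong) (auto simp: h_def indicator_def)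
    then show ?thesis by (simp add: sp)
  qed
  have inner_s: "(LINT s|lborel. h s y) = \<Delta> y" for y
  proof -
    have "(LINT s|lborel. h s y) = (LINT s|lborel. indicator {0..<\<Delta> y} s)"
    proof (intro Bochner_Integration.integral_cong refl)
      fix s show "h s y = indicator {0..<\<Delta> y} s"
        using range[of y] by (auto simp: h_def indicator_def)
    qed
    then show ?thesis using range[of y] by simp
  qed
  have m1: "(\<lambda>s. indicator {0..v} s * measure \<mu> {y. s < \<Delta> y}) \<in> borel_measurable lborel"
    using sigma_finite_measure.borel_measurable_lebesgue_integral[OF sf h_meas] by (simp add: inner_y)
  show int1: "integrable lborel (\<lambda>s. indicator {0..v} s * measure \<mu> {y. s < \<Delta> y})"
  proof (rule Bochner_Integration.integrable_bound[OF _ m1])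
    show "integrable lborel (\<lambda>s. measure \<mu> UNIV * indicator {0..v} s)"
      by (intro integrable_mult_right integrable_indicator_Icc)
    show "AE s in lborel. norm (indicator {0..v} s * measure \<mu> {y. s < \<Delta> y}) \<le> norm (measure \<mu> UNIV * indicator {0..v} s)"
      using bounded_measure sp by (intro AE_I2) (auto simp: indicator_def)
  qed
  have int: "integrable (lborel \<Otimes>\<^sub>M \<mu>) (case_prod h)"
  proof (rule Fubini_integrable[OF h_meas])
    have "norm (h s y) = h s y" for s y by (simp add: h_def)
    then show "integrable lborel (\<lambda>s. LINT y|\<mu>. norm (case (s, y) of (a, b) \<Rightarrow> h a b))"
      using int1 by (simp add: inner_y)
    show "AE s in lborel. integrable \<mu> (\<lambda>y. case (s, y) of (a, b) \<Rightarrow> h a b)"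
    proof (intro AE_I2)
      fix s
      have [measurable]: "h s \<in> borel_measurable \<mu>" unfolding h_def by measurable
      show "integrable \<mu> (\<lambda>y. case (s, y) of (a, b) \<Rightarrow> h a b)"
        by (rule integrable_const_bound[where B = 1]) (auto simp: h_def indicator_def)
    qed
  qed
  have "(LINT y|\<mu>. \<Delta> y) = (LINT y|\<mu>. LINT s|lborel. h s y)" by (simp add: inner_s)
  also have "\<dots> = (LINT s|lborel. LINT y|\<mu>. h s y)" by (rule Fubini_integral[OF int])
  finally show "(LINT y|\<mu>. \<Delta> y) = (LINT s|lborel. indicator {0..v} s * measure \<mu> {y. s < \<Delta> y})"
    by (simp add: inner_y)
qed

text \<open>The deviation of the level sets is integrated over the levels from \<open>0\<close> to
  \<open>v\<close>. If \<Delta> is unimodal, these sets are intervals, so a uniform bound over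
  intervals suffices.\<close>

lemma unimodal_deviation:
  fixes \<Delta> :: "real \<Rightarrow> real"
  assumes \<mu>: "finite_measure \<mu>" "sets \<mu> = sets borel" and \<nu>: "finite_measure \<nu>" "sets \<nu> = sets borel"
    and meas: "\<Delta> \<in> borel_measurable borel" and range: "\<And>y. 0 \<le> \<Delta> y \<and> \<Delta> y \<le> v"
    and bound: "\<And>s. 0 \<le> s \<Longrightarrow> \<bar>measure \<mu> {y. s < \<Delta> y} - measure \<nu> {y. s < \<Delta> y}\<bar> \<le> D"
  shows "\<bar>(LINT y|\<mu>. \<Delta> y) - (LINT y|\<nu>. \<Delta> y)\<bar> \<le> v * D"
proof -
  have v: "0 \<le> v" using range[of 0] by simp
  define G where "G s = indicator {0..v} s * measure \<mu> {y. s < \<Delta> y} - indicator {0..v} s * measure \<nu> {y. s < \<Delta> y}" for s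
  have G: "integrable lborel G" "(LINT y|\<mu>. \<Delta> y) - (LINT y|\<nu>. \<Delta> y) = (LINT s|lborel. G s)"
    unfolding G_def using layer_cake[OF \<mu> meas range] layer_cake[OF \<nu> meas range] by auto
  have "\<bar>LINT s|lborel. G s\<bar> \<le> (LINT s|lborel. \<bar>G s\<bar>)" by (rule integral_abs_bound)
  also have "\<dots> \<le> (LINT s|lborel. D * indicator {0..v} s)"
  proof (rule integral_mono)
    show "integrable lborel (\<lambda>s. D * indicator {0..v} s)"
      by (intro integrable_mult_right integrable_indicator_Icc)
    show "\<bar>G s\<bar> \<le> D * indicator {0..v} s" for s
      using bound[of s] by (auto simp: G_def indicator_def)
  qed (use G(1) in simp)
  also have "\<dots> = v * D" using v by simp
  finally show ?thesis using G(2) by simp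
qed

text \<open>Here \<open>p\<close> stands for \<open>g - \<phi>\<close>, and
  \<open>f * (1 - exp p)\<close> is \<open>f - q\<close>. For \<open>D \<ge> 0\<close> the estimate
  \<open>1 - exp (- D) \<ge> D / (1 + D)\<close> costs a factor 2, whence \<open>D \<le> 1\<close>;
  for \<open>D \<le> 0\<close> the tangent of the exponential gives even
  \<open>D\<^sup>2\<close>.\<close>

lemma exp_test_lower_bound:
  fixes D p :: real
  assumes "(0 \<le> D \<and> D \<le> 1 \<and> p \<le> - D) \<or> (D \<le> 0 \<and> - D \<le> p)"
  shows "D\<^sup>2 / 2 \<le> D * (1 - exp p)"
  using assms
proof (elim disjE conjE)
  assume D: "0 \<le> D" "D \<le> 1" "p \<le> - D"
  have "exp p \<le> exp (- D)" using D by simp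
  also have "\<dots> \<le> 1 / (1 + D)"
    using exp_ge_add_one_self[of D] D by (simp add: exp_minus field_simps)
  finally have "exp p \<le> 1 / (1 + D)" .
  moreover have "1 - 1 / (1 + D) = D / (1 + D)" using D by (simp add: field_simps)
  moreover have "D / 2 \<le> D / (1 + D)" using D by (intro divide_left_mono) auto
  ultimately have "D / 2 \<le> 1 - exp p" by linarith
  then have "D * (D / 2) \<le> D * (1 - exp p)" using D by (intro mult_left_mono) auto
  then show ?thesis by (simp add: power2_eq_square)
next
  assume D: "D \<le> 0" "- D \<le> p"
  have "1 - exp p \<le> D" using exp_ge_add_one_self[of p] D by linarith
  then have "D * D \<le> D * (1 - exp p)" using D by (intro mult_left_mono_neg) auto
  moreover have "D * D / 2 \<le> D * D" by simp
  ultimately show ?thesis unfolding power2_eq_square by linarith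
qed

lemma integral_linear_interval:
  fixes a s p :: real assumes "s \<le> p"
  shows "(LINT y|lborel. (p - y) * indicator {s..p} y) = (p - s)\<^sup>2 / 2"
    and "(LINT y|lborel. (y - s) * indicator {s..p} y) = (p - s)\<^sup>2 / 2"
    and "(LINT y|lborel. (y - a)\<^sup>2 * indicator {s..p} y) = ((p - a) ^ 3 - (s - a) ^ 3) / 3"
proof -
  have "(LINT y|lborel. (p - y) * indicator {s..p} y) = - (p - p)\<^sup>2 / 2 - (- (p - s)\<^sup>2 / 2)"
    using assms by (intro integral_FTC_Icc_real) (auto intro!: derivative_eq_intros simp: power2_eq_square field_simps)
  then show "(LINT y|lborel. (p - y) * indicator {s..p} y) = (p - s)\<^sup>2 / 2" by simp
  have "(LINT y|lborel. (y - s) * indicator {s..p} y) = (p - s)\<^sup>2 / 2 - (s - s)\<^sup>2 / 2"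
    using assms by (intro integral_FTC_Icc_real) (auto intro!: derivative_eq_intros simp: power2_eq_square)
  then show "(LINT y|lborel. (y - s) * indicator {s..p} y) = (p - s)\<^sup>2 / 2" by simp
  have "(LINT y|lborel. (y - a)\<^sup>2 * indicator {s..p} y) = (p - a) ^ 3 / 3 - (s - a) ^ 3 / 3"
    using assms by (intro integral_FTC_Icc_real) (auto intro!: derivative_eq_intros)
  then show "(LINT y|lborel. (y - a)\<^sup>2 * indicator {s..p} y) = ((p - a) ^ 3 - (s - a) ^ 3) / 3"
    by (simp add: diff_divide_distrib)
qed

text \<open>The right-hand side is the integral of the squared distance to \<open>a\<close> over
  \<open>{y..z}\<close>; it is smallest when \<open>a\<close> is the midpoint, where it equals the
  left-hand side.\<close>

lemma cube_difference_ge: "(z - y) ^ 3 / 12 \<le> ((z - a) ^ 3 - (y - a) ^ 3) / 3" if "y \<le> z" for a y z :: real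
proof -
  have "((z - a) ^ 3 - (y - a) ^ 3) / 3 - (z - y) ^ 3 / 12 = (z - y) * ((z - a) + (y - a))\<^sup>2 / 4"
    by (simp add: power2_eq_square power3_eq_cube algebra_simps add_divide_distrib diff_divide_distrib)
  also have "\<dots> \<ge> 0" using that by simp
  finally show ?thesis by simp
qed

text \<open>Locates the foot \<open>a\<close> of the left half of a tent with peak \<open>p\<close>:
  a zero of \<open>h\<close> if \<open>h\<close> is negative at \<open>s\<close>, and
  \<open>s\<close> itself otherwise. Concavity puts \<open>h\<close> above the segment from height 0
  at \<open>a\<close> to height \<open>e\<close> at \<open>p\<close>, and below its extension
  further left. The exception \<open>y = a\<close> covers a positive value at
  \<open>a = s\<close>.\<close>

lemma concave_positive_left_end:
  fixes h :: "real \<Rightarrow> real"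
  assumes h: "concave_on {s..t} h" and cont: "continuous_on {s..t} h"
    and w: "s \<le> w" "w < p" "p \<le> t" and e: "e > 0" and ge: "\<And>y. y \<in> {w..p} \<Longrightarrow> e \<le> h y"
  obtains a where "s \<le> a" "a \<le> w" "\<And>y. y \<in> {a..p} \<Longrightarrow> e * (y - a) \<le> (p - a) * h y"
    "\<And>y. s \<le> y \<Longrightarrow> y \<le> a \<Longrightarrow> (p - a) * h y \<le> - (e * (a - y)) \<or> y = a"
proof -
  have "\<exists>a. s \<le> a \<and> a \<le> w \<and> 0 \<le> h a \<and> (a = s \<or> h a = 0)"
  proof (cases "0 \<le> h s")
    case False
    have "\<exists>a\<ge>s. a \<le> w \<and> h a = 0"
      using False w ge[of w] e by (intro IVT' continuous_on_subset[OF cont]) auto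
    then show ?thesis by auto
  qed (use w in auto)
  then obtain a where a: "s \<le> a" "a \<le> w" "0 \<le> h a" "a = s \<or> h a = 0" by blast
  show thesis
  proof
    fix y assume y: "y \<in> {a..p}"
    have "(p - y) * h a + (y - a) * h p \<le> (p - a) * h y"
      using a w y by (intro concave_on_three_points[OF h]) auto
    moreover have "0 \<le> (p - y) * h a" using y a by auto
    moreover have "(y - a) * e \<le> (y - a) * h p" using y ge[of p] w by (intro mult_left_mono) auto
    ultimately show "e * (y - a) \<le> (p - a) * h y" by (simp add: mult.commute)
  next
    fix y assume y: "s \<le> y" "y \<le> a"
    show "(p - a) * h y \<le> - (e * (a - y)) \<or> y = a"
    proof (cases "y = a")
      case False
      then have "h a = 0" using a y by auto
      have "(p - a) * h y + (a - y) * h p \<le> (p - y) * h a"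
        using a w y by (intro concave_on_three_points[OF h]) auto
      moreover have "(a - y) * e \<le> (a - y) * h p" using y ge[of p] w by (intro mult_left_mono) auto
      ultimately show ?thesis using \<open>h a = 0\<close> by (simp add: mult.commute)
    qed simp
  qed (use a in auto)
qed

text \<open>A value \<open>4 * e\<close> of the linearised difference \<open>h\<close> either stays
  above \<open>2 * e\<close> over the length \<open>\<delta> / 4\<close>, or it falls by
  \<open>2 * e\<close> there and, by concavity, continues to fall, below \<open>- 2 * e\<close>
  after \<open>3 * \<delta> / 4\<close>. A value \<open>- 4 * e\<close> persists on one whole side.
  Undoing the linearisation costs another \<open>e\<close>.\<close>

lemma spike_window:
  fixes g \<phi> :: "real \<Rightarrow> real"
  assumes g: "concave_on {z - \<delta>..z + \<delta>} g" and \<delta>: "\<delta> > 0" and e: "e > 0"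
    and lin: "\<And>y. y \<in> {z - \<delta>..z + \<delta>} \<Longrightarrow> \<bar>\<phi> y - \<phi> z - m * (y - z)\<bar> \<le> e"
    and big: "4 * e \<le> \<bar>g z - \<phi> z\<bar>"
  shows "\<exists>c. z - \<delta> \<le> c \<and> c + \<delta> / 4 \<le> z + \<delta> \<and>
    ((\<forall>y\<in>{c..c + \<delta> / 4}. e \<le> g y - \<phi> y) \<or> (\<forall>y\<in>{c..c + \<delta> / 4}. g y - \<phi> y \<le> - e))"
proof -
  define h where "h y = g y - \<phi> z - m * (y - z)" for y
  have h: "concave_on {z - \<delta>..z + \<delta>} h"
  proof -
    have "concave_on {z - \<delta>..z + \<delta>} (\<lambda>y. g y + ((- \<phi> z + m * z) + (- m) * y))"
      by (intro concave_on_add g concave_on_affine) simp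
    then show ?thesis by (rule concave_on_cong') (simp add: h_def algebra_simps)
  qed
  have hd: "\<bar>(g y - \<phi> y) - h y\<bar> \<le> e" if "y \<in> {z - \<delta>..z + \<delta>}" for y
    using lin[OF that] by (simp add: h_def abs_if split: if_splits)
  have hz: "h z = g z - \<phi> z" by (simp add: h_def)
  consider "4 * e \<le> h z" "2 * e \<le> h (z + \<delta> / 4)" | "4 * e \<le> h z" "h (z + \<delta> / 4) < 2 * e" | "h z \<le> - (4 * e)"
    using big hz by linarith
  then show ?thesis
  proof cases
    case 1
    have "e \<le> g y - \<phi> y" if y: "y \<in> {z..z + \<delta> / 4}" for y
    proof -
      have "(z + \<delta> / 4 - y) * h z + (y - z) * h (z + \<delta> / 4) \<le> (z + \<delta> / 4 - z) * h y"
        using y \<delta> by (intro concave_on_three_points[OF h]) auto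
      moreover have "(z + \<delta> / 4 - y) * (2 * e) \<le> (z + \<delta> / 4 - y) * h z"
        using 1 y e by (intro mult_left_mono) auto
      moreover have "(y - z) * (2 * e) \<le> (y - z) * h (z + \<delta> / 4)" using 1 y by (intro mult_left_mono) auto
      ultimately have "\<delta> / 4 * (2 * e) \<le> \<delta> / 4 * h y" by (simp add: algebra_simps)
      then have "2 * e \<le> h y" using \<delta> mult_le_cancel_left_pos[of "\<delta> / 4" "2 * e" "h y"] by simp
      then show ?thesis using hd[of y] y \<delta> by (auto simp: abs_le_iff)
    qed
    then show ?thesis using \<delta> by (intro exI[of _ z]) auto
  next
    case 2
    have "g y - \<phi> y \<le> - e" if y: "y \<in> {z + 3 * \<delta> / 4..z + \<delta>}" for y
    proof -
      have "(y - (z + \<delta> / 4)) * h z + ((z + \<delta> / 4) - z) * h y \<le> (y - z) * h (z + \<delta> / 4)"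
        using y \<delta> by (intro concave_on_three_points[OF h]) auto
      moreover have "(y - (z + \<delta> / 4)) * (4 * e) \<le> (y - (z + \<delta> / 4)) * h z"
        using 2 y \<delta> by (intro mult_left_mono) auto
      moreover have "(y - z) * h (z + \<delta> / 4) \<le> (y - z) * (2 * e)" using 2 y \<delta> by (intro mult_left_mono) auto
      moreover have "(3 * \<delta> / 4) * (2 * e) \<le> (y - z) * (2 * e)" using y e by (intro mult_right_mono) auto
      ultimately have "\<delta> / 4 * h y \<le> \<delta> / 4 * (- (2 * e))" by (simp add: algebra_simps)
      then have "h y \<le> - (2 * e)" using \<delta> mult_le_cancel_left_pos[of "\<delta> / 4" "h y" "- (2 * e)"] by simp
      then show ?thesis using hd[of y] y \<delta> by (auto simp: abs_le_iff)
    qed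
    then show ?thesis using \<delta> by (intro exI[of _ "z + 3 * \<delta> / 4"]) auto
  next
    case 3
    have "(\<forall>y\<in>{z..z + \<delta>}. h y \<le> - (4 * e)) \<or> (\<forall>y\<in>{z - \<delta>..z}. h y \<le> - (4 * e))"
    proof (rule ccontr)
      assume "\<not> ?thesis"
      then obtain y1 y2 where y: "z \<le> y2" "y2 \<le> z + \<delta>" "- (4 * e) < h y2" "z - \<delta> \<le> y1" "y1 \<le> z" "- (4 * e) < h y1"
        by (auto simp: not_le)
      have ne: "y1 < z" "z < y2" using y 3 by (auto simp: less_eq_real_def)
      have "(y2 - z) * h y1 + (z - y1) * h y2 \<le> (y2 - y1) * h z"
        using y by (intro concave_on_three_points[OF h]) auto
      moreover have "(y2 - z) * (- (4 * e)) < (y2 - z) * h y1" using y ne by (intro mult_strict_left_mono) auto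
      moreover have "(z - y1) * (- (4 * e)) < (z - y1) * h y2" using y ne by (intro mult_strict_left_mono) auto
      moreover have "(y2 - y1) * h z \<le> (y2 - y1) * (- (4 * e))" using 3 ne by (intro mult_left_mono) auto
      ultimately show False by (simp add: algebra_simps)
    qed
    then consider "\<forall>y\<in>{z..z + \<delta>}. h y \<le> - (4 * e)" | "\<forall>y\<in>{z - \<delta>..z}. h y \<le> - (4 * e)" by blast
    then show ?thesis
    proof cases
      case 1
      have "\<forall>y\<in>{z..z + \<delta> / 4}. g y - \<phi> y \<le> - e"
      proof
        fix y assume y: "y \<in> {z..z + \<delta> / 4}"
        then have "h y \<le> - (4 * e)" using 1 \<delta> by auto
        moreover have "(g y - \<phi> y) - h y \<le> e" using hd[of y] y \<delta> by (auto simp: abs_le_iff)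
        ultimately show "g y - \<phi> y \<le> - e" using e by linarith
      qed
      then show ?thesis using \<delta> by (intro exI[of _ z]) auto
    next
      case 2
      have "\<forall>y\<in>{z - \<delta>..z - \<delta> + \<delta> / 4}. g y - \<phi> y \<le> - e"
      proof
        fix y assume y: "y \<in> {z - \<delta>..z - \<delta> + \<delta> / 4}"
        then have "h y \<le> - (4 * e)" using 2 \<delta> by auto
        moreover have "(g y - \<phi> y) - h y \<le> e" using hd[of y] y \<delta> by (auto simp: abs_le_iff)
        ultimately show "g y - \<phi> y \<le> - e" using e by linarith
      qed
      then show ?thesis using \<delta> by (intro exI[of _ "z - \<delta>"]) auto
    qed
  qed
qed

section \<open>Truncated ramps, their noise and their sign\<close>

definition ramp_down :: "real \<Rightarrow> real \<Rightarrow> real \<Rightarrow> real" where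
  "ramp_down s p y = (if s \<le> y \<and> y \<le> p then p - y else 0)"

definition ramp_up :: "real \<Rightarrow> real \<Rightarrow> real \<Rightarrow> real" where
  "ramp_up p t y = (if p \<le> y \<and> y \<le> t then y - p else 0)"

lemma ramp_measurable [measurable]:
  "ramp_down s p \<in> borel_measurable borel" "ramp_up p t \<in> borel_measurable borel"
  unfolding ramp_down_def ramp_up_def by measurable

text \<open>Gathers what remains of the randomness: \<open>\<eta> a\<close> bounds the deviation of
  every interval of true mass at most \<open>a\<close>, and \<open>W\<close> bounds the sample
  range. The margin \<open>r\<close> extends the lower bound \<open>c0\<close> of the density beyond
  \<open>[A, B]\<close>, so that a linear piece leaving the margin still meets a fixed length on
  which the density is bounded below.\<close>

locale noisy_mle = concave_mle +
  fixes f \<phi> :: "real \<Rightarrow> real" and A B r W c0 c1 :: real and \<eta> :: "real \<Rightarrow> real"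
  assumes f_int: "integrable lborel f" and f_nonneg: "\<And>y. 0 \<le> f y" and f_total: "(LINT y|lborel. f y) = 1"
    and f_le: "\<And>y. f y \<le> c1" and f_exp: "\<And>y. y \<in> {l..u} \<Longrightarrow> f y = exp (\<phi> y)"
    and \<phi>_conc: "concave_on {l..u} \<phi>" and \<phi>_cont: "continuous_on {l..u} \<phi>"
    and c0: "0 < c0" and f_ge: "\<And>y. y \<in> {A - r..B + r} \<Longrightarrow> c0 \<le> f y"
    and r: "0 < r" "r \<le> 1" and AB: "A < B" and lA: "l < A" and uB: "B < u"
    and W: "u - l \<le> W" "1 \<le> W"
    and noise: "\<And>I a. is_interval I \<Longrightarrow> (LINT y|lborel. indicator I y * f y) \<le> a \<Longrightarrow>
      \<bar>(\<Sum>i<n. indicator I (x i)) / n - (LINT y|lborel. indicator I y * f y)\<bar> \<le> \<eta> a"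
begin

lemma f_meas [measurable]: "f \<in> borel_measurable borel"
  using f_int by auto

definition N :: "(real \<Rightarrow> real) \<Rightarrow> real" where
  "N \<Delta> = (\<Sum>i<n. \<Delta> (x i)) / n - (LINT y|lborel. \<Delta> y * f y)"

lemma bounded_f_integrable:
  assumes [measurable]: "\<Delta> \<in> borel_measurable borel" and b: "\<And>y. \<bar>\<Delta> y\<bar> \<le> K"
  shows "integrable lborel (\<lambda>y. \<Delta> y * f y)"
proof (rule Bochner_Integration.integrable_bound[of _ "\<lambda>y. K * f y"])
  show "AE y in lborel. norm (\<Delta> y * f y) \<le> norm (K * f y)"
  proof (rule AE_I2)
    fix y
    have "\<bar>\<Delta> y\<bar> * f y \<le> K * f y" using b f_nonneg by (intro mult_right_mono) auto
    moreover have "0 \<le> K" using b[of y] by linarith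
    ultimately show "norm (\<Delta> y * f y) \<le> norm (K * f y)" using f_nonneg[of y] by (simp add: abs_mult)
  qed
qed (use f_int in auto)

lemma interval_mass_le:
  shows "(LINT y|lborel. indicator {j..k} y * f y) \<le> 1"
    and "j \<le> k \<Longrightarrow> (LINT y|lborel. indicator {j..k} y * f y) \<le> c1 * (k - j)"
proof -
  have i: "integrable lborel (\<lambda>y. indicator {j..k} y * f y)"
    by (rule bounded_f_integrable[of _ 1]) auto
  have "(LINT y|lborel. indicator {j..k} y * f y) \<le> (LINT y|lborel. f y)"
    by (intro integral_mono i f_int) (use f_nonneg in \<open>auto simp: indicator_def\<close>)
  then show "(LINT y|lborel. indicator {j..k} y * f y) \<le> 1" by (simp add: f_total)
  assume jk: "j \<le> k"
  have "(LINT y|lborel. indicator {j..k} y * f y) \<le> (LINT y|lborel. c1 * indicator {j..k} y)"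
    by (intro integral_mono i integrable_mult_right integrable_indicator_Icc)
      (use f_le in \<open>auto simp: indicator_def\<close>)
  also have "\<dots> = c1 * (k - j)" using jk by simp
  finally show "(LINT y|lborel. indicator {j..k} y * f y) \<le> c1 * (k - j)" .
qed

lemma \<eta>_nonneg: "0 \<le> a \<Longrightarrow> 0 \<le> \<eta> a"
  using noise[of "{}" a] by simp

lemma c1: "0 < c1"
  using f_le[of A] f_ge[of A] c0 r AB by auto

text \<open>Every level set is an interval inside the support and hence deviates by at most
  \<open>\<eta> a\<close>; the levels range up to \<open>v\<close>.\<close>

lemma N_unimodal:
  assumes meas: "\<Delta> \<in> borel_measurable borel" and range: "\<And>y. 0 \<le> \<Delta> y \<and> \<Delta> y \<le> v"
    and iv: "\<And>s. 0 \<le> s \<Longrightarrow> is_interval {y. s < \<Delta> y}"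
    and supp: "\<And>y. y \<notin> {j..k} \<Longrightarrow> \<Delta> y = 0"
    and a: "(LINT y|lborel. indicator {j..k} y * f y) \<le> a"
  shows "\<bar>N \<Delta>\<bar> \<le> v * \<eta> a"
proof -
  let ?\<nu> = "density lborel f"
  have emp: "finite_measure (empirical n x)"
    using prob_space_empirical[OF n] by (simp add: prob_space.finite_measure)
  have dens: "(LINT y|?\<nu>. h y) = (LINT y|lborel. h y * f y)" if "h \<in> borel_measurable borel" for h :: "real \<Rightarrow> real"
    using that f_nonneg by (subst integral_density) (auto simp: mult.commute)
  have "emeasure ?\<nu> (space ?\<nu>) = (\<integral>\<^sup>+ y. f y \<partial>lborel)" by (simp add: emeasure_density)
  also have "\<dots> = ennreal 1" using f_int f_nonneg f_total by (subst nn_integral_eq_integral) auto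
  finally have "finite_measure ?\<nu>" by (intro finite_measureI) simp
  then interpret \<nu>: finite_measure ?\<nu> .
  have m\<nu>: "measure ?\<nu> S = (LINT y|lborel. indicator S y * f y)" if "S \<in> sets borel" for S
    using dens[of "indicator S"] that by simp
  have "\<bar>(LINT y|empirical n x. \<Delta> y) - (LINT y|?\<nu>. \<Delta> y)\<bar> \<le> v * \<eta> a"
  proof (rule unimodal_deviation[OF emp _ \<nu>.finite_measure_axioms _ meas range])
    fix s :: real assume s: "0 \<le> s"
    let ?I = "{y. s < \<Delta> y}"
    have I: "?I \<in> sets borel" using iv[OF s] by (rule real_interval_borel_measurable)
    have sub: "?I \<subseteq> {j..k}" using supp s by force
    have "(LINT y|lborel. indicator ?I y * f y) = measure ?\<nu> ?I" using I by (simp add: m\<nu>)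
    also have "\<dots> \<le> measure ?\<nu> {j..k}" using sub I by (intro \<nu>.finite_measure_mono) auto
    also have "\<dots> \<le> a" using a by (simp add: m\<nu>)
    finally show "\<bar>measure (empirical n x) ?I - measure ?\<nu> ?I\<bar> \<le> \<eta> a"
      using noise[OF iv[OF s]] I by (simp add: m\<nu> measure_empirical)
  qed simp_all
  then show ?thesis using meas by (simp add: N_def integral_empirical dens)
qed

lemma N_ramp_down:
  assumes "s \<le> p" "(LINT y|lborel. indicator {s..p} y * f y) \<le> a"
  shows "\<bar>N (ramp_down s p)\<bar> \<le> (p - s) * \<eta> a"
proof (rule N_unimodal[OF _ _ _ _ assms(2)])
  show "is_interval {y. \<sigma> < ramp_down s p y}" if "0 \<le> \<sigma>" for \<sigma>
    using that unfolding is_interval_1 by (auto simp: ramp_down_def split: if_splits)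
qed (use assms in \<open>auto simp: ramp_down_def\<close>)

lemma N_ramp_up:
  assumes "p \<le> t" "(LINT y|lborel. indicator {p..t} y * f y) \<le> a"
  shows "\<bar>N (ramp_up p t)\<bar> \<le> (t - p) * \<eta> a"
proof (rule N_unimodal[OF _ _ _ _ assms(2)])
  show "is_interval {y. \<sigma> < ramp_up p t y}" if "0 \<le> \<sigma>" for \<sigma>
    using that unfolding is_interval_1 by (auto simp: ramp_up_def split: if_splits)
qed (use assms in \<open>auto simp: ramp_up_def\<close>)

text \<open>Cutting the ramp at \<open>s\<close> subtracts a second ramp ending there and a step
  below it. At a knot the former contributes zero and the latter a nonnegative amount.\<close>

lemma T_ramp_down:
  assumes "knot s" "s \<le> p" shows "0 \<le> T (ramp_down s p)"
proof -
  have "T (ramp_down s p) = T (\<lambda>y. (max 0 (p - y) + (-1) * max 0 (s - y)) + (- (p - s)) * indicator {..<s} y)"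
    using assms(2) by (intro T_cong) (auto simp: ramp_down_def indicator_def)
  also have "\<dots> = (T (\<lambda>y. max 0 (p - y)) + T (\<lambda>y. (-1) * max 0 (s - y))) + T (\<lambda>y. (- (p - s)) * indicator {..<s} y)"
    by (subst T_add; intro adm_add adm_cmul adm_ramps adm_indicator arg_cong2[where f="(+)"] T_add refl) simp
  also have "\<dots> \<ge> 0"
    unfolding T_cmul knot_ramp[OF assms(1)] using T_ramp[of p] mult_nonpos_nonpos[OF _ T_below[OF assms(1)], of "- (p - s)"] assms(2)
    by simp
  finally show ?thesis .
qed

lemma T_ramp_up:
  assumes "knot t" "p \<le> t" shows "0 \<le> T (ramp_up p t)"
proof -
  have "T (ramp_up p t) = T (\<lambda>y. (max 0 (y - p) + (-1) * max 0 (y - t)) + (- (t - p)) * indicator {t<..} y)"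
    using assms(2) by (intro T_cong) (auto simp: ramp_up_def indicator_def)
  also have "\<dots> = (T (\<lambda>y. max 0 (y - p)) + T (\<lambda>y. (-1) * max 0 (y - t))) + T (\<lambda>y. (- (t - p)) * indicator {t<..} y)"
    by (subst T_add; intro adm_add adm_cmul adm_ramps adm_indicator arg_cong2[where f="(+)"] T_add refl) simp
  also have "\<dots> \<ge> 0"
    unfolding T_cmul knot_ramp[OF assms(1)] using T_ramp[of p] mult_nonpos_nonpos[OF _ T_above[OF assms(1)], of "- (t - p)"] assms(2)
    by simp
  finally show ?thesis .
qed

text \<open>The test function is concave on the linear piece between the two knots, hence negative outside
  \<open>{a..b}\<close>; its jumps at the knots are admissible by \<open>T_below\<close> and \<open>T_above\<close>.\<close>

lemma T_tent:
  assumes s: "knot s" and t: "knot t" and o: "s \<le> a" "a < p" "p < b" "b \<le> t"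
    and \<kappa>: "0 < \<kappa>1" "0 < \<kappa>2" "\<kappa>1 * (p - a) = \<kappa>2 * (b - p)"
  shows "T (\<lambda>y. if y < s then 0 else if y \<le> p then \<kappa>1 * (y - a) else if y \<le> t then \<kappa>2 * (b - y) else 0) \<le> 0"
    (is "T ?\<Delta> \<le> 0")
proof -
  define m where "m y = min (- (\<kappa>1 * a) + \<kappa>1 * y) (\<kappa>2 * b + (- \<kappa>2) * y)" for y
  have m1: "m y = \<kappa>1 * (y - a)" if "y \<le> p" for y
  proof -
    have "\<kappa>1 * (y - a) \<le> \<kappa>1 * (p - a)" using that \<kappa> by (intro mult_left_mono) auto
    also have "\<dots> \<le> \<kappa>2 * (b - y)" unfolding \<kappa>(3) using that \<kappa> by (intro mult_left_mono) auto
    finally show ?thesis by (simp add: m_def algebra_simps)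
  qed
  have m2: "m y = \<kappa>2 * (b - y)" if "p \<le> y" for y
  proof -
    have "\<kappa>2 * (b - y) \<le> \<kappa>2 * (b - p)" using that \<kappa> by (intro mult_left_mono) auto
    also have "\<dots> \<le> \<kappa>1 * (y - a)" unfolding \<kappa>(3)[symmetric] using that \<kappa> by (intro mult_left_mono) auto
    finally show ?thesis by (simp add: m_def algebra_simps)
  qed
  have mT: "T m \<le> 0"
    unfolding m_def
    by (intro T_concave concave_on_min concave_on_affine adm_continuous continuous_intros) simp_all
  have am: "adm m" unfolding m_def by (intro adm_continuous continuous_intros)
  have "T ?\<Delta> = T (\<lambda>y. m y + (\<kappa>1 * max 0 (s - y) + (\<kappa>1 * (a - s) * indicator {..<s} y
      + (\<kappa>2 * max 0 (y - t) + \<kappa>2 * (t - b) * indicator {t<..} y))))"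
  proof (rule T_cong)
    fix y
    consider "y < s" | "s \<le> y" "y \<le> p" | "p < y" "y \<le> t" | "t < y" by linarith
    then show "?\<Delta> y = m y + (\<kappa>1 * max 0 (s - y) + (\<kappa>1 * (a - s) * indicator {..<s} y
      + (\<kappa>2 * max 0 (y - t) + \<kappa>2 * (t - b) * indicator {t<..} y)))"
      using o m1[of y] m2[of y] by cases (auto simp: algebra_simps)
  qed
  also have "\<dots> = T m + (\<kappa>1 * T (\<lambda>y. max 0 (s - y)) + (\<kappa>1 * (a - s) * T (indicator {..<s})
      + (\<kappa>2 * T (\<lambda>y. max 0 (y - t)) + \<kappa>2 * (t - b) * T (indicator {t<..}))))"
    unfolding T_cmul[symmetric]
    by (simp only: T_add adm_add adm_cmul adm_ramps adm_indicator am lessThan_borel greaterThan_borel)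
  also have "\<dots> \<le> 0"
    unfolding knot_ramp[OF s] knot_ramp[OF t] using mT T_below[OF s] T_above[OF t] o \<kappa>
    by (simp add: add_nonpos_nonpos mult_nonneg_nonpos)
  finally show ?thesis .
qed

lemma weighted_mass_ge:
  assumes meas: "w \<in> borel_measurable borel" and b: "\<And>y. 0 \<le> w y" "\<And>y. w y \<le> K"
    and sub: "{j..k} \<subseteq> {A - r..B + r}"
  shows "c0 * (LINT y|lborel. w y * indicator {j..k} y) \<le> (LINT y|lborel. w y * f y)"
proof -
  note [measurable] = meas
  have "c0 * (LINT y|lborel. w y * indicator {j..k} y) = (LINT y|lborel. c0 * (w y * indicator {j..k} y))" by simp
  also have "\<dots> \<le> (LINT y|lborel. w y * f y)"
  proof (rule integral_mono)
    show "integrable lborel (\<lambda>y. c0 * (w y * indicator {j..k} y))"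
    proof (rule Bochner_Integration.integrable_bound[OF integrable_mult_right[OF integrable_indicator_Icc[of j k], of "c0 * K"]])
      show "AE y in lborel. norm (c0 * (w y * indicator {j..k} y)) \<le> norm (c0 * K * indicator {j..k} y)"
      proof (rule AE_I2)
        fix y
        have "\<bar>w y\<bar> \<le> \<bar>K\<bar>" using b[of y] by linarith
        then show "norm (c0 * (w y * indicator {j..k} y)) \<le> norm (c0 * K * indicator {j..k} y)"
          using c0 by (auto simp: indicator_def abs_mult)
      qed
    qed measurable
    show "integrable lborel (\<lambda>y. w y * f y)"
      using b by (intro bounded_f_integrable[of _ K] meas) simp
    fix y
    show "c0 * (w y * indicator {j..k} y) \<le> w y * f y"
      using sub f_ge[of y] b(1)[of y] f_nonneg[of y]
      by (cases "y \<in> {j..k}") (auto simp: mult.commute[of "w y"] intro!: mult_right_mono)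
  qed
  finally show ?thesis .
qed

lemma q_f: "y \<in> {l..u} \<Longrightarrow> q y = f y * exp (g y - \<phi> y)"
  by (simp add: q_def f_exp flip: exp_add)

lemma integrable_f_q:
  assumes "\<Delta> \<in> borel_measurable borel" "\<And>y. \<bar>\<Delta> y\<bar> \<le> K"
  shows "integrable lborel (\<lambda>y. \<Delta> y * (f y - q y))"
    and "(LINT y|lborel. \<Delta> y * (f y - q y)) = (LINT y|lborel. \<Delta> y * f y) - (LINT y|lborel. \<Delta> y * q y)"
proof -
  have "adm \<Delta>" using assms by (intro adm_bounded) auto
  then have *: "integrable lborel (\<lambda>y. \<Delta> y * f y)" "integrable lborel (\<lambda>y. \<Delta> y * q y)"
    using bounded_f_integrable[OF assms] adm_integrable by auto
  from Bochner_Integration.integrable_diff[OF this] show "integrable lborel (\<lambda>y. \<Delta> y * (f y - q y))"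
    by (simp add: right_diff_distrib)
  from Bochner_Integration.integral_diff[OF *]
  show "(LINT y|lborel. \<Delta> y * (f y - q y)) = (LINT y|lborel. \<Delta> y * f y) - (LINT y|lborel. \<Delta> y * q y)"
    by (simp add: right_diff_distrib)
qed

text \<open>On the support \<open>q \<ge> (1 + e) * f\<close>, so the integral of
  \<open>\<Delta> * (q - f)\<close> is at least \<open>e\<close> times that of
  \<open>\<Delta> * f\<close>. As \<open>0 \<le> T \<Delta>\<close>, the noise has to account for
  this excess.\<close>

lemma ramp_f_q_le:
  assumes meas: "\<Delta> \<in> borel_measurable borel" and b: "\<And>y. 0 \<le> \<Delta> y" "\<And>y. \<Delta> y \<le> K"
    and supp: "\<And>y. y \<notin> {j..k} \<Longrightarrow> \<Delta> y = 0" and jk: "{j..k} \<subseteq> {l..u}"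
    and big: "\<And>y. y \<in> {j..k} \<Longrightarrow> e \<le> g y - \<phi> y" and T: "0 \<le> T \<Delta>"
  shows "e * (LINT y|lborel. \<Delta> y * f y) \<le> N \<Delta>"
proof -
  have ab: "\<bar>\<Delta> y\<bar> \<le> K" for y using b by simp
  note fq = integrable_f_q[OF meas ab]
  have "(LINT y|lborel. \<Delta> y * (f y - q y)) \<le> (LINT y|lborel. - e * (\<Delta> y * f y))"
  proof (intro integral_mono fq integrable_mult_right bounded_f_integrable[OF meas ab])
    fix y
    show "\<Delta> y * (f y - q y) \<le> - e * (\<Delta> y * f y)"
    proof (cases "y \<in> {j..k}")
      case True
      have "1 + e \<le> exp (g y - \<phi> y)" using exp_ge_add_one_self[of "g y - \<phi> y"] big[OF True] by linarith
      then have "f y * (1 + e) \<le> q y" unfolding q_f[OF subsetD[OF jk True]] using f_nonneg by (intro mult_left_mono) auto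
      then have "\<Delta> y * (f y * (1 + e)) \<le> \<Delta> y * q y" using b by (intro mult_left_mono) auto
      then show ?thesis by (simp add: algebra_simps)
    qed (use supp in simp)
  qed
  also have "\<dots> = - e * (LINT y|lborel. \<Delta> y * f y)" by simp
  finally show ?thesis using T unfolding fq(2) N_def T_def by linarith
qed

text \<open>At a knot the estimated distribution function lies between the left limit and the value
  of the empirical one, by \<open>T_below\<close> and \<open>T_above\<close>; the noise bound then
  compares it with the true one.\<close>

lemma knot_cdf:
  assumes k: "knot k"
  shows "\<bar>(LINT y|lborel. indicator {..k} y * q y) - (LINT y|lborel. indicator {..k} y * f y)\<bar> \<le> \<eta> 1"
proof -
  have le1: "(LINT y|lborel. indicator S y * f y) \<le> 1" if "S \<in> sets borel" for S
  proof -
    have "(LINT y|lborel. indicator S y * f y) \<le> (LINT y|lborel. f y)"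
      using that f_nonneg by (intro integral_mono bounded_f_integrable[of _ 1] f_int) (auto simp: indicator_def)
    then show ?thesis by (simp add: f_total)
  qed
  have "T (indicator {..k}) = T (\<lambda>y. (1 + 0 * y) + (-1) * indicator {k<..} y)"
    by (intro T_cong) (auto simp: indicator_def)
  also have "\<dots> = T (\<lambda>y. 1 + 0 * y) + T (\<lambda>y. (-1) * indicator {k<..} y)"
    by (intro T_add adm_ramps adm_cmul adm_indicator) simp
  also have "\<dots> \<ge> 0" unfolding T_affine T_cmul using T_above[OF k] by simp
  finally have t1: "0 \<le> T (indicator {..k})" .
  have n1: "\<bar>N (indicator {..k})\<bar> \<le> \<eta> 1" "\<bar>N (indicator {..<k})\<bar> \<le> \<eta> 1"
    unfolding N_def by (intro noise le1; simp add: is_interval_1)+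
  have AEk: "AE y in lborel. y \<noteq> k" by (rule AE_lborel_singleton)
  have eq: "(LINT y|lborel. indicator {..<k} y * h y) = (LINT y|lborel. indicator {..k} y * h y)"
    if "h \<in> borel_measurable borel" for h :: "real \<Rightarrow> real"
  proof (rule integral_cong_AE)
    show "AE y in lborel. indicator {..<k} y * h y = indicator {..k} y * h y"
      using AEk by eventually_elim (auto simp: indicator_def)
  qed (use that in measurable)
  show ?thesis
    using t1 T_below[OF k] n1 unfolding T_def N_def eq[OF f_meas] eq[OF q_meas] by linarith
qed

end

section \<open>Deviation of the estimated log-density\<close>

context noisy_mle
begin

text \<open>In the application \<open>d\<close> is \<open>\<delta> / 24\<close> and \<open>e\<close>
  a constant multiple of \<epsilon>. \<open>H1\<close> makes the noise of any interval of length
  \<open>v \<ge> d\<close> a small fraction of \<open>e * c0 * v\<close>; \<open>H2\<close> serves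
  for linear pieces that leave \<open>{A - r..B + r}\<close>, where the crude noise
  \<open>\<eta> 1\<close> is used.\<close>

context
  fixes d e :: real
  assumes d: "0 < d" and e: "0 < e" "e \<le> 1"
    and H1: "\<And>v. d \<le> v \<Longrightarrow> \<eta> (c1 * v) < c0 * e * v / 24"
    and H2: "24 * W\<^sup>2 * \<eta> 1 < c0 * r ^ 3 * e"
begin

lemma far_noise: assumes "0 \<le> w" "w \<le> W" shows "w * \<eta> 1 < c0 * r\<^sup>2 / 2 * e"
proof -
  have "W * 1 \<le> W * W" using W by (intro mult_left_mono) auto
  then have "w * \<eta> 1 \<le> W\<^sup>2 * \<eta> 1"
    using assms \<eta>_nonneg[of 1] by (intro mult_right_mono) (auto simp: power2_eq_square)
  also have "\<dots> \<le> 24 * W\<^sup>2 * \<eta> 1 / 2"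
    using mult_nonneg_nonneg[of "W\<^sup>2" "\<eta> 1"] \<eta>_nonneg[of 1] by simp
  also have "\<dots> < c0 * r ^ 3 * e / 2" using H2 by (rule divide_strict_right_mono) simp
  also have "\<dots> \<le> c0 * r\<^sup>2 / 2 * e"
  proof -
    have "r ^ 3 \<le> r\<^sup>2" using r by (intro power_decreasing) auto
    then have "c0 * e * r ^ 3 \<le> c0 * e * r\<^sup>2" using c0 e by (intro mult_left_mono) auto
    then show ?thesis by (simp add: mult_ac)
  qed
  finally show ?thesis .
qed

text \<open>If the knot \<open>s\<close> lies within the margin, the ramp from \<open>s\<close> down
  to \<open>p\<close> has signal \<open>e * c0 * (p - s)\<^sup>2 / 2\<close> against noise
  \<open>(p - s) * \<eta> (c1 * (p - s))\<close>. Otherwise the signal is at least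
  \<open>e * c0 * r\<^sup>2 / 2\<close>, against noise at most \<open>W * \<eta> 1\<close>.\<close>

lemma positive_window_left:
  assumes s: "knot s" and p: "A \<le> p" "p \<le> B" "d \<le> p - s"
    and big: "\<And>y. y \<in> {s..p} \<Longrightarrow> e \<le> g y - \<phi> y"
  shows False
proof -
  \<comment> \<open>Left of \<open>A - r\<close> the density has no lower bound, so the signal is
    collected from \<open>s'\<close> on, while the noise is that of the full ramp.\<close>
  define s' where "s' = max s (A - r)"
  have sp: "s < p" "s' < p" "s \<le> s'" using p d r by (auto simp: s'_def)
  have lu: "{s..p} \<subseteq> {l..u}" using knot_range[OF s] p uB by auto
  have "c0 * (LINT y|lborel. ramp_down s p y * indicator {s'..p} y) \<le> (LINT y|lborel. ramp_down s p y * f y)"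
    using sp p r by (intro weighted_mass_ge[where K = "p - s"]) (auto simp: ramp_down_def s'_def)
  also have "(LINT y|lborel. ramp_down s p y * indicator {s'..p} y) = (LINT y|lborel. (p - y) * indicator {s'..p} y)"
    using sp by (intro Bochner_Integration.integral_cong) (auto simp: ramp_down_def indicator_def)
  also have "\<dots> = (p - s')\<^sup>2 / 2" using sp by (intro integral_linear_interval) simp
  finally have "e * (c0 * ((p - s')\<^sup>2 / 2)) \<le> e * (LINT y|lborel. ramp_down s p y * f y)"
    using e by (intro mult_left_mono) auto
  also have "\<dots> \<le> N (ramp_down s p)"
  proof (rule ramp_f_q_le[of _ "p - s" s p])
    show "0 \<le> T (ramp_down s p)" using s sp by (intro T_ramp_down) auto
  qed (use big lu sp in \<open>auto simp: ramp_down_def\<close>)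
  finally have main: "e * (c0 * ((p - s')\<^sup>2 / 2)) \<le> N (ramp_down s p)" .
  show False
  proof (cases "A - r \<le> s")
    case True
    have "N (ramp_down s p) \<le> (p - s) * \<eta> (c1 * (p - s))"
      using N_ramp_down[OF _ interval_mass_le(2)] sp by (auto simp: abs_le_iff)
    also have "\<dots> \<le> (p - s) * (c0 * e * (p - s) / 24)"
      using H1[OF p(3)] sp by (intro mult_left_mono) auto
    finally have "e * (c0 * ((p - s)\<^sup>2 / 2)) \<le> (p - s) * (c0 * e * (p - s) / 24)"
      using main True unfolding s'_def by (simp only: max_absorb1)
    moreover have "e * (c0 * ((p - s)\<^sup>2 / 2)) = c0 * e * (p - s)\<^sup>2 / 2"
      "(p - s) * (c0 * e * (p - s) / 24) = c0 * e * (p - s)\<^sup>2 / 24" by (simp_all add: power2_eq_square)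
    moreover have "0 < c0 * e * (p - s)\<^sup>2" using sp e c0 by simp
    ultimately show False by linarith
  next
    case False
    have "N (ramp_down s p) \<le> (p - s) * \<eta> 1"
      using N_ramp_down[OF _ interval_mass_le(1)] sp by (auto simp: abs_le_iff)
    also have "\<dots> < c0 * r\<^sup>2 / 2 * e"
      using sp knot_range[OF s] p uB W by (intro far_noise) auto
    also have "\<dots> \<le> e * (c0 * ((p - s')\<^sup>2 / 2))"
    proof -
      have "r\<^sup>2 \<le> (p - s')\<^sup>2" using False p r by (intro power_mono) (auto simp: s'_def)
      then have "c0 * e * r\<^sup>2 \<le> c0 * e * (p - s')\<^sup>2" using c0 e by (intro mult_left_mono) auto
      then show ?thesis by (simp add: mult_ac)
    qed
    finally show False using main by simp
  qed
qed

lemma positive_window_right: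
  assumes t: "knot t" and p: "A \<le> p" "p \<le> B" "d \<le> t - p"
    and big: "\<And>y. y \<in> {p..t} \<Longrightarrow> e \<le> g y - \<phi> y"
  shows False
proof -
  define t' where "t' = min t (B + r)"
  have pt: "p < t" "p < t'" "t' \<le> t" using p d r by (auto simp: t'_def)
  have lu: "{p..t} \<subseteq> {l..u}" using knot_range[OF t] p lA by auto
  have "c0 * (LINT y|lborel. ramp_up p t y * indicator {p..t'} y) \<le> (LINT y|lborel. ramp_up p t y * f y)"
    using pt p r by (intro weighted_mass_ge[where K = "t - p"]) (auto simp: ramp_up_def t'_def)
  also have "(LINT y|lborel. ramp_up p t y * indicator {p..t'} y) = (LINT y|lborel. (y - p) * indicator {p..t'} y)"
    using pt by (intro Bochner_Integration.integral_cong) (auto simp: ramp_up_def indicator_def)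
  also have "\<dots> = (t' - p)\<^sup>2 / 2" using pt by (intro integral_linear_interval) simp
  finally have "e * (c0 * ((t' - p)\<^sup>2 / 2)) \<le> e * (LINT y|lborel. ramp_up p t y * f y)"
    using e by (intro mult_left_mono) auto
  also have "\<dots> \<le> N (ramp_up p t)"
  proof (rule ramp_f_q_le[of _ "t - p" p t])
    show "0 \<le> T (ramp_up p t)" using t pt by (intro T_ramp_up) auto
  qed (use big lu pt in \<open>auto simp: ramp_up_def\<close>)
  finally have main: "e * (c0 * ((t' - p)\<^sup>2 / 2)) \<le> N (ramp_up p t)" .
  show False
  proof (cases "t \<le> B + r")
    case True
    have "N (ramp_up p t) \<le> (t - p) * \<eta> (c1 * (t - p))"
      using N_ramp_up[OF _ interval_mass_le(2)] pt by (auto simp: abs_le_iff)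
    also have "\<dots> \<le> (t - p) * (c0 * e * (t - p) / 24)"
      using H1[OF p(3)] pt by (intro mult_left_mono) auto
    finally have "e * (c0 * ((t - p)\<^sup>2 / 2)) \<le> (t - p) * (c0 * e * (t - p) / 24)"
      using main True unfolding t'_def by (simp only: min_absorb1)
    moreover have "e * (c0 * ((t - p)\<^sup>2 / 2)) = c0 * e * (t - p)\<^sup>2 / 2"
      "(t - p) * (c0 * e * (t - p) / 24) = c0 * e * (t - p)\<^sup>2 / 24" by (simp_all add: power2_eq_square)
    moreover have "0 < c0 * e * (t - p)\<^sup>2" using pt e c0 by simp
    ultimately show False by linarith
  next
    case False
    have "N (ramp_up p t) \<le> (t - p) * \<eta> 1"
      using N_ramp_up[OF _ interval_mass_le(1)] pt by (auto simp: abs_le_iff)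
    also have "\<dots> < c0 * r\<^sup>2 / 2 * e"
      using pt knot_range[OF t] p lA W by (intro far_noise) auto
    also have "\<dots> \<le> e * (c0 * ((t' - p)\<^sup>2 / 2))"
    proof -
      have "r\<^sup>2 \<le> (t' - p)\<^sup>2" using False p r by (intro power_mono) (auto simp: t'_def)
      then have "c0 * e * r\<^sup>2 \<le> c0 * e * (t' - p)\<^sup>2" using c0 e by (intro mult_left_mono) auto
      then show ?thesis by (simp add: mult_ac)
    qed
    finally show False using main by simp
  qed
qed

lemma mass_Icc_scaled:
  assumes jk: "A \<le> j" "j \<le> k" "k \<le> B"
  shows "c0 * (k - j) \<le> (LINT y|lborel. indicator {j..k} y * f y)"
proof -
  have "c0 * (LINT y|lborel. indicator {j..k} y * indicator {j..k} y) \<le> (LINT y|lborel. indicator {j..k} y * f y)"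
    using jk r by (intro weighted_mass_ge[where K = 1]) auto
  moreover have "(LINT y|lborel. indicator {j..k} y * indicator {j..k} y) = k - j"
    using jk by (simp flip: indicator_inter_arith)
  ultimately show ?thesis by simp
qed

text \<open>The closed interval is used because its complement consists of the two open half-lines
  of \<open>T_below\<close> and \<open>T_above\<close>, while the constant function contributes
  zero.\<close>

lemma two_knots_positive:
  assumes k: "knot j" "knot k" and jk: "A \<le> j" "d \<le> k - j" "k \<le> B"
    and big: "\<And>y. y \<in> {j..k} \<Longrightarrow> e \<le> g y - \<phi> y"
  shows False
proof -
  have "T (indicator {j..k}) = T (\<lambda>y. (1 + 0 * y) + ((-1) * indicator {..<j} y + (-1) * indicator {k<..} y))"
    using jk d by (intro T_cong) (auto simp: indicator_def)
  also have "\<dots> = T (\<lambda>y. 1 + 0 * y) + ((-1) * T (indicator {..<j}) + (-1) * T (indicator {k<..}))"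
    unfolding T_cmul[symmetric]
    by (simp only: T_add adm_add adm_cmul adm_ramps adm_indicator lessThan_borel greaterThan_borel)
  also have "\<dots> \<ge> 0" unfolding T_affine using T_below[OF k(1)] T_above[OF k(2)] by simp
  finally have T: "0 \<le> T (indicator {j..k})" .
  have "e * (c0 * (k - j)) \<le> e * (LINT y|lborel. indicator {j..k} y * f y)"
    using jk d e by (intro mult_left_mono mass_Icc_scaled) auto
  also have "\<dots> \<le> N (indicator {j..k})"
  proof (rule ramp_f_q_le[of _ 1 j k])
    show "0 \<le> T (indicator {j..k})" by (rule T)
  qed (use jk lA uB big in auto)
  also have "\<dots> \<le> \<eta> (c1 * (k - j))"
    unfolding N_def using jk d noise[OF _ interval_mass_le(2), of j k] by (auto simp: is_interval_cc abs_le_iff)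
  also have "\<dots> < c0 * e * (k - j) / 24" by (rule H1[OF jk(2)])
  finally have "e * (c0 * (k - j)) < c0 * e * (k - j) / 24" .
  moreover have "e * (c0 * (k - j)) = c0 * e * (k - j)" "e / 2 * (c0 * (k - j)) = c0 * e * (k - j) / 2"
    by simp_all
  moreover have "0 < c0 * e * (k - j)" using c0 e jk d by simp
  ultimately show False by linarith
qed

text \<open>For the opposite sign the open interval is taken: removing closed half-lines reverses
  the inequality obtained from the knots. The end points carry observations but no Lebesgue measure.
  The relative loss of mass \<open>e / 2\<close> comes from \<open>exp_test_lower_bound\<close> with
  \<open>D = e\<close>.\<close>

lemma two_knots_negative:
  assumes k: "knot j" "knot k" and jk: "A \<le> j" "d \<le> k - j" "k \<le> B"
    and big: "\<And>y. y \<in> {j..k} \<Longrightarrow> g y - \<phi> y \<le> - e"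
  shows False
proof -
  let ?I = "{j<..<k} :: real set"
  have eqI: "(LINT y|lborel. indicator ?I y * h y) = (LINT y|lborel. indicator {j..k} y * h y)"
    if "h \<in> borel_measurable borel" for h :: "real \<Rightarrow> real"
  proof (rule integral_cong_AE)
    have "AE y in lborel. y \<noteq> j" "AE y in lborel. y \<noteq> k" by (rule AE_lborel_singleton)+
    then show "AE y in lborel. indicator ?I y * h y = indicator {j..k} y * h y"
      by eventually_elim (auto simp: indicator_def)
  qed (use that in measurable)
  have half: "T (indicator S) \<le> 0 \<Longrightarrow> S' = - S \<Longrightarrow> S \<in> sets borel \<Longrightarrow> 0 \<le> T (indicator S')" for S S'
  proof -
    assume *: "T (indicator S) \<le> 0" "S' = - S" "S \<in> sets borel"
    have "T (indicator S') = T (\<lambda>y. (1 + 0 * y) + (-1) * indicator S y)"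
      using * by (intro T_cong) (auto simp: indicator_def)
    also have "\<dots> = T (\<lambda>y. 1 + 0 * y) + (-1) * T (indicator S)"
      unfolding T_cmul[symmetric] using * by (intro T_add adm_ramps adm_cmul adm_indicator)
    finally show "0 \<le> T (indicator S')" unfolding T_affine using * by simp
  qed
  have "T (indicator ?I) = T (\<lambda>y. (1 + 0 * y) + ((-1) * indicator {..j} y + (-1) * indicator {k..} y))"
    using jk d by (intro T_cong) (auto simp: indicator_def)
  also have "\<dots> = T (\<lambda>y. 1 + 0 * y) + ((-1) * T (indicator {..j}) + (-1) * T (indicator {k..}))"
    unfolding T_cmul[symmetric]
    by (simp only: T_add adm_add adm_cmul adm_ramps adm_indicator atMost_borel atLeast_borel)
  also have "\<dots> \<le> 0"
    unfolding T_affine using half[OF T_above[OF k(1)], of "{..j}"] half[OF T_below[OF k(2)], of "{k..}"] by auto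
  finally have T: "T (indicator ?I) \<le> 0" .
  note fq = integrable_f_q[of "indicator {j..k}" 1]
  have "e / 2 * (c0 * (k - j)) \<le> e / 2 * (LINT y|lborel. indicator {j..k} y * f y)"
    using jk d e by (intro mult_left_mono mass_Icc_scaled) auto
  also have "\<dots> = (LINT y|lborel. e / 2 * (indicator {j..k} y * f y))" by simp
  also have "\<dots> \<le> (LINT y|lborel. indicator {j..k} y * (f y - q y))"
  proof (intro integral_mono fq integrable_mult_right bounded_f_integrable[of _ 1])
    fix y
    show "e / 2 * (indicator {j..k} y * f y) \<le> indicator {j..k} y * (f y - q y)"
    proof (cases "y \<in> {j..k}")
      case True
      have "e\<^sup>2 / 2 \<le> e * (1 - exp (g y - \<phi> y))" using e big[OF True] by (intro exp_test_lower_bound) auto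
      then have "e * (e / 2) \<le> e * (1 - exp (g y - \<phi> y))" by (simp add: power2_eq_square)
      then have "e / 2 \<le> 1 - exp (g y - \<phi> y)" using e by (simp only: mult_le_cancel_left_pos)
      then have "f y * (e / 2) \<le> f y * (1 - exp (g y - \<phi> y))" using f_nonneg by (intro mult_left_mono) auto
      also have "\<dots> = f y - q y" using True jk lA uB q_f[of y] by (simp add: algebra_simps)
      finally show ?thesis using True by (simp add: mult_ac)
    qed simp
  qed auto
  also have "\<dots> \<le> - N (indicator ?I)" using T fq unfolding N_def T_def eqI[OF f_meas] eqI[OF q_meas] by simp
  also have "\<dots> \<le> \<eta> (c1 * (k - j))"
  proof -
    have "\<bar>N (indicator ?I)\<bar> \<le> \<eta> (c1 * (k - j))" unfolding N_def
      using jk d interval_mass_le(2)[of j k] by (intro noise) (auto simp: is_interval_1 eqI)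
    then show ?thesis by (simp add: abs_le_iff)
  qed
  also have "\<dots> < c0 * e * (k - j) / 24" by (rule H1[OF jk(2)])
  finally have "e / 2 * (c0 * (k - j)) < c0 * e * (k - j) / 24" .
  moreover have "e * (c0 * (k - j)) = c0 * e * (k - j)" "e / 2 * (c0 * (k - j)) = c0 * e * (k - j) / 2"
    by simp_all
  moreover have "0 < c0 * e * (k - j)" using c0 e jk d by simp
  ultimately show False by linarith
qed

text \<open>One side of the peak, within the margin: \<open>y\<close> is its width up to the zero of
  the test function, \<open>w\<close> that of the negative part. \<open>H1\<close> is available from
  length \<open>d\<close> on, hence the maximum with \<open>y\<close>. By
  \<open>w * y * max y w \<le> y ^ 3 + w ^ 3\<close> the negative part consumes at most a quarter of
  the signal, and the reserve for the tent at most another quarter.\<close>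

lemma near_side:
  assumes \<kappa>: "0 < \<kappa>" "\<kappa> * y = e" and y: "d \<le> y" and w: "0 \<le> w"
    and HL: "c0 * \<kappa>\<^sup>2 * (y ^ 3 + w ^ 3) / 6 \<le> HL"
  shows "\<kappa> * (w * \<eta> (c1 * max y w)) + c0 * e\<^sup>2 * y / 24 < HL"
proof -
  have y0: "0 < y" using y d by simp
  have cube: "w * y * max y w \<le> y ^ 3 + w ^ 3"
  proof (cases "y \<le> w")
    case True
    have "w * y * w \<le> w * w * w" using True w y0 by (intro mult_right_mono mult_left_mono) auto
    moreover have "0 \<le> y * y * y" using y0 by simp
    ultimately show ?thesis using True unfolding power3_eq_cube max_def by simp
  next
    case False
    have "w * y * y \<le> y * y * y" using False w y0 by (intro mult_right_mono) auto
    then show ?thesis using False w by (simp add: power3_eq_cube max_def add_increasing2)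
  qed
  have "\<kappa> * (w * \<eta> (c1 * max y w)) \<le> \<kappa> * (w * (c0 * e * max y w / 24))"
    using y w \<kappa>(1) by (intro mult_left_mono less_imp_le[OF H1]) auto
  also have "\<dots> = c0 * \<kappa>\<^sup>2 / 24 * (w * y * max y w)" unfolding \<kappa>(2)[symmetric] by (simp add: power2_eq_square mult_ac)
  also have "\<dots> \<le> c0 * \<kappa>\<^sup>2 / 24 * (y ^ 3 + w ^ 3)" using cube c0 by (intro mult_left_mono) auto
  finally have 1: "\<kappa> * (w * \<eta> (c1 * max y w)) \<le> c0 * \<kappa>\<^sup>2 / 24 * (y ^ 3 + w ^ 3)" .
  have 2: "c0 * e\<^sup>2 * y / 24 = c0 * \<kappa>\<^sup>2 / 24 * y ^ 3"
    unfolding \<kappa>(2)[symmetric] by (simp add: power2_eq_square power3_eq_cube mult_ac)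
  define K where "K = c0 * \<kappa>\<^sup>2 / 24"
  have K: "0 < K" using c0 \<kappa> by (simp add: K_def)
  have HL': "4 * (K * y ^ 3) + 4 * (K * w ^ 3) \<le> HL" using HL by (simp add: K_def algebra_simps)
  have "0 < K * y ^ 3" "0 \<le> K * w ^ 3" using K y0 w by auto
  then show ?thesis using 1 2 HL' unfolding K_def[symmetric] distrib_left by linarith
qed

text \<open>One factor \<open>W\<close> in \<open>H2\<close> bounds the width \<open>y + w\<close>,
  the other the slope, as \<open>\<kappa> = e / y \<ge> e / W\<close>. The term
  \<open>e * \<eta> 1\<close> is room for the whole noise of the tent.\<close>

lemma far_side:
  assumes \<kappa>: "0 < \<kappa>" "\<kappa> * y = e" and y: "0 < y" and w: "0 \<le> w" "y + w \<le> W"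
    and HL: "c0 * \<kappa>\<^sup>2 * r ^ 3 / 24 \<le> HL"
  shows "\<kappa> * (w * \<eta> 1) + e * \<eta> 1 < HL"
proof -
  have "\<kappa> * (w * \<eta> 1) + e * \<eta> 1 = \<kappa> * ((y + w) * \<eta> 1)" unfolding \<kappa>(2)[symmetric] by (simp add: algebra_simps)
  also have "\<dots> \<le> \<kappa> * (W * \<eta> 1)" using w \<kappa> \<eta>_nonneg[of 1] by (intro mult_left_mono mult_right_mono) auto
  also have "\<dots> < \<kappa> * (c0 * \<kappa> * r ^ 3 / 24)"
  proof (rule mult_strict_left_mono[OF _ \<kappa>(1)])
    have "W * (24 * W * \<eta> 1) < c0 * r ^ 3 * (\<kappa> * y)" using H2 \<kappa> by (simp add: power2_eq_square mult_ac)
    also have "\<dots> = (c0 * r ^ 3 * \<kappa>) * y" by simp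
    also have "\<dots> \<le> (c0 * r ^ 3 * \<kappa>) * W" using w c0 r \<kappa> by (intro mult_left_mono) auto
    finally have "W * (24 * W * \<eta> 1) < W * (c0 * r ^ 3 * \<kappa>)" by (simp add: mult.commute)
    then have "24 * W * \<eta> 1 < c0 * r ^ 3 * \<kappa>" using W mult_less_cancel_left_pos[of W] by simp
    then show "W * \<eta> 1 < c0 * \<kappa> * r ^ 3 / 24" by (simp add: mult_ac)
  qed
  also have "\<dots> = c0 * \<kappa>\<^sup>2 * r ^ 3 / 24" by (simp add: power2_eq_square)
  finally show ?thesis using HL by simp
qed

lemma N_add:
  assumes "\<Delta> \<in> borel_measurable borel" "\<And>y. \<bar>\<Delta> y\<bar> \<le> K" "\<Delta>' \<in> borel_measurable borel" "\<And>y. \<bar>\<Delta>' y\<bar> \<le> K'"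
  shows "N (\<lambda>y. \<Delta> y + \<Delta>' y) = N \<Delta> + N \<Delta>'"
  using Bochner_Integration.integral_add[OF bounded_f_integrable bounded_f_integrable, OF assms]
  by (simp add: N_def distrib_right sum.distrib add_divide_distrib)

lemma N_cmul: "N (\<lambda>y. c * \<Delta> y) = c * N \<Delta>"
  by (simp add: N_def mult.assoc right_diff_distrib flip: sum_distrib_left)

text \<open>The slopes are such that \<open>\<Delta>\<close> and \<open>g - \<phi>\<close> have opposite signs and \<open>\<bar>\<Delta>\<bar> \<le> \<bar>g - \<phi>\<bar>\<close>, whence
  \<open>\<Delta> * (f - q) \<ge> \<Delta>\<^sup>2 / 2 * f\<close>. Each side of the peak \<open>p\<close> is handled separately: its signal
  beats its noise by \<open>H1\<close> if the linear piece ends within the range where \<open>f \<ge> c0\<close>, and by \<open>H2\<close>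
  otherwise.\<close>

lemma negative_piece:
  assumes s: "knot s" and t: "knot t" and o: "s \<le> a" "d \<le> p - a" "d \<le> b - p" "b \<le> t" and p: "A \<le> p" "p \<le> B"
    and left_in: "\<And>y. y \<in> {a..p} \<Longrightarrow> e * (y - a) \<le> (p - a) * (\<phi> y - g y)"
    and left_out: "\<And>y. s \<le> y \<Longrightarrow> y \<le> a \<Longrightarrow> (p - a) * (\<phi> y - g y) \<le> - (e * (a - y)) \<or> y = a"
    and right_in: "\<And>y. y \<in> {p..b} \<Longrightarrow> e * (b - y) \<le> (b - p) * (\<phi> y - g y)"
    and right_out: "\<And>y. b \<le> y \<Longrightarrow> y \<le> t \<Longrightarrow> (b - p) * (\<phi> y - g y) \<le> - (e * (y - b)) \<or> y = b"
  shows False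
proof -
  \<comment> \<open>These slopes give both halves the height \<open>e\<close> at the peak, so the
    test function is continuous there and its positive part stays below \<open>1\<close>, as
    \<open>exp_test_lower_bound\<close> demands.\<close>
  define \<kappa>1 \<kappa>2 where "\<kappa>1 = e / (p - a)" and "\<kappa>2 = e / (b - p)"
  have ord: "a < p" "p < b" using o d by auto
  have \<kappa>: "0 < \<kappa>1" "0 < \<kappa>2" "\<kappa>1 * (p - a) = e" "\<kappa>2 * (b - p) = e"
    using ord e by (auto simp: \<kappa>1_def \<kappa>2_def)
  have st: "{s..t} \<subseteq> {l..u}" using knot_range[OF s] knot_range[OF t] by auto
  define \<Delta> where "\<Delta> y = (if y < s then 0 else if y \<le> p then \<kappa>1 * (y - a) else if y \<le> t then \<kappa>2 * (b - y) else 0)" for y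
  have \<Delta>_meas[measurable]: "\<Delta> \<in> borel_measurable borel" unfolding \<Delta>_def by measurable
  have W': "t - s \<le> W" using knot_range[OF s] knot_range[OF t] W by auto
  have \<Delta>_bound: "\<bar>\<Delta> y\<bar> \<le> \<kappa>1 * W + \<kappa>2 * W" for y
  proof -
    have nn: "0 \<le> \<kappa>1 * W" "0 \<le> \<kappa>2 * W" using \<kappa> W by auto
    have "\<Delta> y = 0 \<or> (s \<le> y \<and> y \<le> p) \<or> (p < y \<and> y \<le> t)" by (auto simp: \<Delta>_def)
    then consider "\<Delta> y = 0" | "s \<le> y" "y \<le> p" | "p < y" "y \<le> t" by blast
    then show ?thesis
    proof cases
      case 2
      then have "\<bar>\<Delta> y\<bar> = \<kappa>1 * \<bar>y - a\<bar>" using \<kappa> by (simp add: \<Delta>_def abs_mult)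
      also have "\<dots> \<le> \<kappa>1 * W" using 2 o ord W' \<kappa> by (intro mult_left_mono) auto
      finally show ?thesis using nn by simp
    next
      case 3
      then have "\<bar>\<Delta> y\<bar> = \<kappa>2 * \<bar>b - y\<bar>" using \<kappa> o ord by (simp add: \<Delta>_def abs_mult)
      also have "\<dots> \<le> \<kappa>2 * W" using 3 o ord W' \<kappa> by (intro mult_left_mono) auto
      finally show ?thesis using nn by simp
    qed (use nn in simp)
  qed
  have point: "((\<Delta> y)\<^sup>2 / 2) * f y \<le> \<Delta> y * (f y - q y)" for y
  proof (cases "y \<in> {s..t}")
    case True
    define D where "D = \<Delta> y"
    have "D\<^sup>2 / 2 \<le> D * (1 - exp (g y - \<phi> y))"
    proof (cases "D = 0")
      case False
      show ?thesis
      proof (rule exp_test_lower_bound)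
        consider "y < a" | "a \<le> y" "y \<le> p" | "p < y" "y \<le> b" | "b < y" by linarith
        then show "0 \<le> D \<and> D \<le> 1 \<and> g y - \<phi> y \<le> - D \<or> D \<le> 0 \<and> - D \<le> g y - \<phi> y"
        proof cases
          case 1
          have "e * (a - y) \<le> (g y - \<phi> y) * (p - a)" using left_out[of y] 1 True by (auto simp: algebra_simps)
          then have "e * (a - y) / (p - a) \<le> g y - \<phi> y" using ord by (simp add: pos_divide_le_eq)
          moreover have "D = - (e * (a - y) / (p - a))" using 1 True ord by (simp add: D_def \<Delta>_def \<kappa>1_def minus_divide_left algebra_simps)
          moreover have "0 \<le> e * (a - y) / (p - a)" using 1 e ord by simp
          ultimately show ?thesis by simp
        next
          case 2
          have "e * (y - a) / (p - a) \<le> \<phi> y - g y" using left_in[of y] 2 ord by (simp add: pos_divide_le_eq mult.commute)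
          moreover have D: "D = e * (y - a) / (p - a)" using 2 True by (simp add: D_def \<Delta>_def \<kappa>1_def)
          moreover have "D \<le> e"
          proof -
            have "\<kappa>1 * (y - a) \<le> \<kappa>1 * (p - a)" using 2 \<kappa> by (intro mult_left_mono) auto
            then show ?thesis using 2 True \<kappa> by (simp add: D_def \<Delta>_def)
          qed
          moreover have "0 \<le> D" unfolding D using 2 e ord by simp
          ultimately show ?thesis using e by linarith
        next
          case 3
          have "e * (b - y) / (b - p) \<le> \<phi> y - g y" using right_in[of y] 3 ord by (simp add: pos_divide_le_eq mult.commute)
          moreover have D: "D = e * (b - y) / (b - p)" using 3 True by (simp add: D_def \<Delta>_def \<kappa>2_def)
          moreover have "D \<le> e"
          proof -
            have "\<kappa>2 * (b - y) \<le> \<kappa>2 * (b - p)" using 3 \<kappa> by (intro mult_left_mono) auto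
            then show ?thesis using 3 True \<kappa> by (simp add: D_def \<Delta>_def)
          qed
          moreover have "0 \<le> D" unfolding D using 3 e ord by simp
          ultimately show ?thesis using e by linarith
        next
          case 4
          have "e * (y - b) \<le> (g y - \<phi> y) * (b - p)" using right_out[of y] 4 True by (auto simp: algebra_simps)
          then have "e * (y - b) / (b - p) \<le> g y - \<phi> y" using ord by (simp add: pos_divide_le_eq)
          moreover have "D = - (e * (y - b) / (b - p))" using 4 True ord by (simp add: D_def \<Delta>_def \<kappa>2_def minus_divide_left algebra_simps)
          moreover have "0 \<le> e * (y - b) / (b - p)" using 4 e ord by simp
          ultimately show ?thesis by simp
        qed
      qed
    qed simp
    then have "f y * (D\<^sup>2 / 2) \<le> f y * (D * (1 - exp (g y - \<phi> y)))" using f_nonneg by (intro mult_left_mono) auto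
    also have "\<dots> = D * (f y - q y)" using True st q_f[of y] by (simp add: algebra_simps)
    finally show ?thesis by (simp add: D_def mult.commute)
  next
    case False
    then have "\<Delta> y = 0" using o ord by (auto simp: \<Delta>_def)
    then show ?thesis by simp
  qed
  \<comment> \<open>Half the square of the test function, split at the peak so that each side keeps
    a signal of its own. The halves overlap at \<open>p\<close>, a null set.\<close>
  define wL wR where "wL y = \<kappa>1\<^sup>2 / 2 * ((y - a)\<^sup>2 * indicator {s..p} y)"
    and "wR y = \<kappa>2\<^sup>2 / 2 * ((y - b)\<^sup>2 * indicator {p..t} y)" for y
  have w_meas[measurable]: "wL \<in> borel_measurable borel" "wR \<in> borel_measurable borel"
    unfolding wL_def wR_def by measurable
  have w_nonneg: "0 \<le> wL y" "0 \<le> wR y" for y by (auto simp: wL_def wR_def)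
  have wL_le: "wL y \<le> \<kappa>1\<^sup>2 / 2 * W\<^sup>2" for y
  proof (cases "y \<in> {s..p}")
    case True
    then have "(y - a)\<^sup>2 \<le> W\<^sup>2" using o ord W' W by (intro abs_le_square_iff[THEN iffD1]) auto
    then show ?thesis using True by (simp add: wL_def mult_left_mono)
  qed (simp add: wL_def)
  have wR_le: "wR y \<le> \<kappa>2\<^sup>2 / 2 * W\<^sup>2" for y
  proof (cases "y \<in> {p..t}")
    case True
    then have "(y - b)\<^sup>2 \<le> W\<^sup>2" using o ord W' W by (intro abs_le_square_iff[THEN iffD1]) auto
    then show ?thesis using True by (simp add: wR_def mult_left_mono)
  qed (simp add: wR_def)
  define HL HR where "HL = (LINT y|lborel. wL y * f y)" and "HR = (LINT y|lborel. wR y * f y)"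
  have iL: "integrable lborel (\<lambda>y. wL y * f y)"
    using w_nonneg wL_le by (intro bounded_f_integrable[of _ "\<kappa>1\<^sup>2 / 2 * W\<^sup>2"]) auto
  have iR: "integrable lborel (\<lambda>y. wR y * f y)"
    using w_nonneg wR_le by (intro bounded_f_integrable[of _ "\<kappa>2\<^sup>2 / 2 * W\<^sup>2"]) auto
  note fq = integrable_f_q[OF \<Delta>_meas \<Delta>_bound]
  have "HL + HR = (LINT y|lborel. wL y * f y + wR y * f y)" unfolding HL_def HR_def using iL iR by simp
  also have "\<dots> \<le> (LINT y|lborel. \<Delta> y * (f y - q y))"
  proof (rule integral_mono_AE)
    have "AE y in lborel. y \<noteq> p" by (rule AE_lborel_singleton)
    then show "AE y in lborel. wL y * f y + wR y * f y \<le> \<Delta> y * (f y - q y)"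
    proof eventually_elim
      case (elim y)
      have "wL y + wR y = (\<Delta> y)\<^sup>2 / 2"
      proof -
        consider "y < s" | "s \<le> y" "y < p" | "p < y" "y \<le> t" | "t < y" using elim by linarith
        then show ?thesis
        proof cases
          case 2
          then have "wL y = \<kappa>1\<^sup>2 / 2 * (y - a)\<^sup>2" "wR y = 0" "\<Delta> y = \<kappa>1 * (y - a)"
            by (simp_all add: wL_def wR_def \<Delta>_def)
          then show ?thesis by (simp add: power_mult_distrib)
        next
          case 3
          then have "wL y = 0" "wR y = \<kappa>2\<^sup>2 / 2 * (y - b)\<^sup>2" "\<Delta> y = \<kappa>2 * (b - y)"
            using o ord by (simp_all add: wL_def wR_def \<Delta>_def)
          then show ?thesis by (simp add: power_mult_distrib power2_commute[of y b])
        qed (use o ord in \<open>simp_all add: wL_def wR_def \<Delta>_def\<close>)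
      qed
      then have "wL y * f y + wR y * f y = (\<Delta> y)\<^sup>2 / 2 * f y" by (simp only: distrib_right[symmetric])
      then show ?case using point[of y] by simp
    qed
  qed (use iL iR fq in auto)
  also have "\<dots> \<le> - N \<Delta>"
  proof -
    have "T \<Delta> \<le> 0"
      unfolding \<Delta>_def[abs_def] by (rule T_tent[OF s t o(1) ord o(4) \<kappa>(1,2)]) (simp add: \<kappa>)
    then show ?thesis unfolding fq(2) N_def T_def by simp
  qed
  finally have signal: "HL + HR \<le> - N \<Delta>" .
  \<comment> \<open>For the noise the test function is split into a tent and two ramps: each part,
    up to sign, is unimodal, whereas the whole need not be.\<close>
  define tent where "tent y = (if a \<le> y \<and> y \<le> p then \<kappa>1 * (y - a) else if p < y \<and> y \<le> b then \<kappa>2 * (b - y) else 0)" for y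
  have tent_meas[measurable]: "tent \<in> borel_measurable borel" unfolding tent_def by measurable
  have tent_range: "0 \<le> tent y \<and> tent y \<le> e" for y
  proof -
    have "\<kappa>1 * (y - a) \<le> \<kappa>1 * (p - a)" if "y \<le> p" using that \<kappa> by (intro mult_left_mono) auto
    moreover have "\<kappa>2 * (b - y) \<le> \<kappa>2 * (b - p)" if "p \<le> y" using that \<kappa> by (intro mult_left_mono) auto
    ultimately show ?thesis using \<kappa> e by (auto simp: tent_def)
  qed
  have tent_iv: "is_interval {y. \<sigma> < tent y}" if \<sigma>: "0 \<le> \<sigma>" for \<sigma>
    unfolding is_interval_1
  proof (intro ballI allI impI)
    fix y1 y2 z assume y: "y1 \<in> {y. \<sigma> < tent y}" "y2 \<in> {y. \<sigma> < tent y}" and z: "y1 \<le> z \<and> z \<le> y2"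
    have r: "a \<le> y1" "y2 \<le> b" using y \<sigma> ord by (auto simp: tent_def split: if_splits)
    show "z \<in> {y. \<sigma> < tent y}"
    proof (cases "z \<le> p")
      case True
      have "\<sigma> < \<kappa>1 * (y1 - a)" using y True z r by (auto simp: tent_def split: if_splits)
      also have "\<dots> \<le> \<kappa>1 * (z - a)" using z \<kappa> by (intro mult_left_mono) auto
      finally show ?thesis using True z r by (simp add: tent_def)
    next
      case False
      have "\<sigma> < \<kappa>2 * (b - y2)" using y False z r by (auto simp: tent_def split: if_splits)
      also have "\<dots> \<le> \<kappa>2 * (b - z)" using z \<kappa> by (intro mult_left_mono) auto
      finally show ?thesis using False z r by (simp add: tent_def)
    qed
  qed
  have tent_N: "\<bar>N tent\<bar> \<le> e * \<eta> m" if "(LINT y|lborel. indicator {a..b} y * f y) \<le> m" for m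
    by (rule N_unimodal[OF tent_meas tent_range tent_iv _ that]) (use ord in \<open>auto simp: tent_def\<close>)
  have "N \<Delta> = N (\<lambda>y. tent y + ((- \<kappa>1) * ramp_down s a y + (- \<kappa>2) * ramp_up b t y))"
  proof (rule arg_cong[where f = N], rule ext)
    fix y
    consider "y < s" | "s \<le> y" "y < a" | "a \<le> y" "y \<le> p" | "p < y" "y \<le> b" | "b < y" "y \<le> t" | "t < y" by linarith
    then show "\<Delta> y = tent y + ((- \<kappa>1) * ramp_down s a y + (- \<kappa>2) * ramp_up b t y)"
      using o ord by cases (auto simp: \<Delta>_def tent_def ramp_down_def ramp_up_def algebra_simps)
  qed
  also have "\<dots> = N tent + N (\<lambda>y. (- \<kappa>1) * ramp_down s a y + (- \<kappa>2) * ramp_up b t y)"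
  proof (rule N_add[where K = e and K' = "\<kappa>1 * (a - s) + \<kappa>2 * (t - b)"])
    fix y
    have "ramp_down s a y \<in> {0..a - s}" "ramp_up b t y \<in> {0..t - b}" using o by (auto simp: ramp_down_def ramp_up_def)
    then have "\<bar>(- \<kappa>1) * ramp_down s a y\<bar> \<le> \<kappa>1 * (a - s)" "\<bar>(- \<kappa>2) * ramp_up b t y\<bar> \<le> \<kappa>2 * (t - b)"
      using \<kappa> by (auto simp: abs_mult intro!: mult_left_mono)
    then show "\<bar>(- \<kappa>1) * ramp_down s a y + (- \<kappa>2) * ramp_up b t y\<bar> \<le> \<kappa>1 * (a - s) + \<kappa>2 * (t - b)" by linarith
  qed (use tent_range in \<open>auto simp: abs_le_iff intro: order_trans\<close>)
  also have "N (\<lambda>y. (- \<kappa>1) * ramp_down s a y + (- \<kappa>2) * ramp_up b t y) =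
      N (\<lambda>y. (- \<kappa>1) * ramp_down s a y) + N (\<lambda>y. (- \<kappa>2) * ramp_up b t y)"
  proof (rule N_add[where K = "\<kappa>1 * (a - s)" and K' = "\<kappa>2 * (t - b)"])
    fix y
    have "ramp_down s a y \<in> {0..a - s}" "ramp_up b t y \<in> {0..t - b}" using o by (auto simp: ramp_down_def ramp_up_def)
    then show "\<bar>(- \<kappa>1) * ramp_down s a y\<bar> \<le> \<kappa>1 * (a - s)" "\<bar>(- \<kappa>2) * ramp_up b t y\<bar> \<le> \<kappa>2 * (t - b)"
      using \<kappa> by (auto simp: abs_mult intro!: mult_left_mono)
  qed auto
  finally have N\<Delta>: "- N \<Delta> = - N tent + \<kappa>1 * N (ramp_down s a) + \<kappa>2 * N (ramp_up b t)" unfolding N_cmul by simp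
  have downN: "\<kappa>1 * N (ramp_down s a) \<le> \<kappa>1 * ((a - s) * \<eta> m)"
    if "(LINT y|lborel. indicator {s..a} y * f y) \<le> m" for m
    using N_ramp_down[OF o(1) that] \<kappa> by (intro mult_left_mono) (auto simp: abs_le_iff)
  have upN: "\<kappa>2 * N (ramp_up b t) \<le> \<kappa>2 * ((t - b) * \<eta> m)"
    if "(LINT y|lborel. indicator {b..t} y * f y) \<le> m" for m
    using N_ramp_up[OF o(4) that] \<kappa> by (intro mult_left_mono) (auto simp: abs_le_iff)
  have HLge: "c0 * (\<kappa>1\<^sup>2 / 2 * (((p - a) ^ 3 - (s' - a) ^ 3) / 3)) \<le> HL"
    if s': "s \<le> s'" "A - r \<le> s'" "s' \<le> p" for s'
  proof -
    have "c0 * (LINT y|lborel. wL y * indicator {s'..p} y) \<le> HL"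
      unfolding HL_def using s' p r w_nonneg wL_le by (intro weighted_mass_ge[where K = "\<kappa>1\<^sup>2 / 2 * W\<^sup>2"]) auto
    also have "(LINT y|lborel. wL y * indicator {s'..p} y) = (LINT y|lborel. \<kappa>1\<^sup>2 / 2 * ((y - a)\<^sup>2 * indicator {s'..p} y))"
      using s' by (intro Bochner_Integration.integral_cong) (auto simp: wL_def indicator_def)
    also have "\<dots> = \<kappa>1\<^sup>2 / 2 * (((p - a) ^ 3 - (s' - a) ^ 3) / 3)"
      unfolding integral_linear_interval(3)[OF s'(3), of a, symmetric] by (rule integral_mult_right_zero)
    finally show ?thesis .
  qed
  have HRge: "c0 * (\<kappa>2\<^sup>2 / 2 * (((t' - b) ^ 3 - (p - b) ^ 3) / 3)) \<le> HR"
    if t': "t' \<le> t" "t' \<le> B + r" "p \<le> t'" for t'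
  proof -
    have "c0 * (LINT y|lborel. wR y * indicator {p..t'} y) \<le> HR"
      unfolding HR_def using t' p r w_nonneg wR_le by (intro weighted_mass_ge[where K = "\<kappa>2\<^sup>2 / 2 * W\<^sup>2"]) auto
    also have "(LINT y|lborel. wR y * indicator {p..t'} y) = (LINT y|lborel. \<kappa>2\<^sup>2 / 2 * ((y - b)\<^sup>2 * indicator {p..t'} y))"
      using t' by (intro Bochner_Integration.integral_cong) (auto simp: wR_def indicator_def)
    also have "\<dots> = \<kappa>2\<^sup>2 / 2 * (((t' - b) ^ 3 - (p - b) ^ 3) / 3)"
      unfolding integral_linear_interval(3)[OF t'(3), of b, symmetric] by (rule integral_mult_right_zero)
    finally show ?thesis .
  qed
  \<comment> \<open>A side leaving the margin retains an interval of length \<open>r\<close> within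
    it. The zero of the test function may fall anywhere, even at the midpoint of that interval;
    \<open>cube_difference_ge\<close> covers this worst case.\<close>
  have far3: "c0 * \<kappa>\<^sup>2 * r ^ 3 / 24 \<le> c0 * (\<kappa>\<^sup>2 / 2 * ((z2 ^ 3 - z1 ^ 3) / 3))" if "r \<le> z2 - z1" for \<kappa> z1 z2
  proof -
    have "r ^ 3 \<le> (z2 - z1) ^ 3" using that r by (intro power_mono) auto
    also have "\<dots> / 12 \<le> (z2 ^ 3 - z1 ^ 3) / 3" using cube_difference_ge[of z1 z2 0] that r by simp
    finally have "r ^ 3 / 12 \<le> (z2 ^ 3 - z1 ^ 3) / 3" by simp
    then have "(c0 * \<kappa>\<^sup>2 / 2) * (r ^ 3 / 12) \<le> (c0 * \<kappa>\<^sup>2 / 2) * ((z2 ^ 3 - z1 ^ 3) / 3)"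
      using c0 by (intro mult_left_mono) auto
    then show ?thesis by (simp add: mult_ac)
  qed
  have cube_neg: "(- z) ^ 3 = - (z ^ 3)" for z :: real by simp
  have \<eta>1: "0 \<le> e * \<eta> 1" using e \<eta>_nonneg[of 1] by simp
  \<comment> \<open>Each side also reserves room for the noise of the tent: a near side its own
    share of \<open>tent2\<close>, a far side the full bound of \<open>tent1\<close>. Two near sides
    together pay \<open>tent2\<close>, and a single far side suffices for
    \<open>tent1\<close>.\<close>
  have L: "\<kappa>1 * N (ramp_down s a) + c0 * e\<^sup>2 * (p - a) / 24 < HL \<or> \<kappa>1 * N (ramp_down s a) + e * \<eta> 1 < HL"
  proof (cases "A - r \<le> s")
    case True
    have "\<kappa>1 * N (ramp_down s a) \<le> \<kappa>1 * ((a - s) * \<eta> (c1 * max (p - a) (a - s)))"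
      using c1 o by (intro downN order_trans[OF interval_mass_le(2)] mult_left_mono) auto
    moreover have "\<kappa>1 * ((a - s) * \<eta> (c1 * max (p - a) (a - s))) + c0 * e\<^sup>2 * (p - a) / 24 < HL"
    proof (rule near_side[OF \<kappa>(1,3) o(2)])
      have "s - a = - (a - s)" by simp
      then have "(s - a) ^ 3 = - ((a - s) ^ 3)" by (simp only: cube_neg)
      then show "c0 * \<kappa>1\<^sup>2 * ((p - a) ^ 3 + (a - s) ^ 3) / 6 \<le> HL"
        using HLge[of s] True o ord by simp
    qed (use o in simp)
    ultimately show ?thesis by linarith
  next
    case False
    have "\<kappa>1 * N (ramp_down s a) \<le> \<kappa>1 * ((a - s) * \<eta> 1)" by (intro downN interval_mass_le(1))
    moreover have "\<kappa>1 * ((a - s) * \<eta> 1) + e * \<eta> 1 < HL"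
    proof (rule far_side[OF \<kappa>(1,3)])
      show "c0 * \<kappa>1\<^sup>2 * r ^ 3 / 24 \<le> HL"
        using HLge[of "A - r"] far3[of "p - a" "A - r - a" \<kappa>1] False p r by simp
    qed (use ord o W' in auto)
    ultimately show ?thesis by linarith
  qed
  have R: "\<kappa>2 * N (ramp_up b t) + c0 * e\<^sup>2 * (b - p) / 24 < HR \<or> \<kappa>2 * N (ramp_up b t) + e * \<eta> 1 < HR"
  proof (cases "t \<le> B + r")
    case True
    have "\<kappa>2 * N (ramp_up b t) \<le> \<kappa>2 * ((t - b) * \<eta> (c1 * max (b - p) (t - b)))"
      using c1 o by (intro upN order_trans[OF interval_mass_le(2)] mult_left_mono) auto
    moreover have "\<kappa>2 * ((t - b) * \<eta> (c1 * max (b - p) (t - b))) + c0 * e\<^sup>2 * (b - p) / 24 < HR"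
    proof (rule near_side[OF \<kappa>(2,4) o(3)])
      have "p - b = - (b - p)" by simp
      then have "(p - b) ^ 3 = - ((b - p) ^ 3)" by (simp only: cube_neg)
      then show "c0 * \<kappa>2\<^sup>2 * ((b - p) ^ 3 + (t - b) ^ 3) / 6 \<le> HR"
        using HRge[of t] True o ord by (simp add: add.commute)
    qed (use o in simp)
    ultimately show ?thesis by linarith
  next
    case False
    have "\<kappa>2 * N (ramp_up b t) \<le> \<kappa>2 * ((t - b) * \<eta> 1)" by (intro upN interval_mass_le(1))
    moreover have "\<kappa>2 * ((t - b) * \<eta> 1) + e * \<eta> 1 < HR"
    proof (rule far_side[OF \<kappa>(2,4)])
      show "c0 * \<kappa>2\<^sup>2 * r ^ 3 / 24 \<le> HR"
        using HRge[of "B + r"] far3[of "B + r - b" "p - b" \<kappa>2] False p r by simp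
    qed (use ord o W' in auto)
    ultimately show ?thesis by linarith
  qed
  have tent1: "- N tent \<le> e * \<eta> 1" using tent_N[OF interval_mass_le(1)] by (simp add: abs_le_iff)
  have tent2: "- N tent \<le> c0 * e\<^sup>2 * (p - a) / 24 + c0 * e\<^sup>2 * (b - p) / 24"
  proof -
    have "- N tent \<le> e * \<eta> (c1 * (b - a))" using tent_N[OF interval_mass_le(2)] ord by (simp add: abs_le_iff)
    also have "\<dots> \<le> e * (c0 * e * (b - a) / 24)" using H1[of "b - a"] o d ord e by (intro mult_left_mono) auto
    also have "\<dots> = c0 * e\<^sup>2 * (p - a) / 24 + c0 * e\<^sup>2 * (b - p) / 24"
      by (simp add: power2_eq_square algebra_simps add_divide_distrib diff_divide_distrib)
    finally show ?thesis .
  qed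
  have nn: "0 \<le> c0 * e\<^sup>2 * (p - a) / 24" "0 \<le> c0 * e\<^sup>2 * (b - p) / 24" using c0 ord by auto
  show False using L R tent1 tent2 nn \<eta>1 signal N\<Delta> by linarith
qed

text \<open>The window is cut into thirds. Knots in both outer thirds are at least
  \<open>2 * d\<close> apart. Otherwise one outer third is free of knots and lies in a linear piece
  \<open>{s..t}\<close>, on which \<open>\<phi> - g\<close> is concave. If \<open>g\<close> is too
  large, the excess continues to one end of the piece, which is a knot; if it is too small, a tent
  has its peak in the middle of the third, with width at least \<open>d\<close> on either
  side.\<close>

lemma no_deviation_window:
  assumes c: "A \<le> c" "c + 6 * d \<le> B"
    and big: "(\<forall>y\<in>{c..c + 6 * d}. e \<le> g y - \<phi> y) \<or> (\<forall>y\<in>{c..c + 6 * d}. g y - \<phi> y \<le> - e)"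
  shows False
proof (cases "(\<exists>j\<in>{c..c + 2 * d}. knot j) \<and> (\<exists>k\<in>{c + 4 * d..c + 6 * d}. knot k)")
  case True
  then obtain j k where jk: "j \<in> {c..c + 2 * d}" "knot j" "k \<in> {c + 4 * d..c + 6 * d}" "knot k" by blast
  have "{j..k} \<subseteq> {c..c + 6 * d}" "d \<le> k - j" "A \<le> j" "k \<le> B" using jk d c by auto
  then show False
    using two_knots_positive[OF jk(2,4)] two_knots_negative[OF jk(2,4)] big by blast
next
  case False
  then obtain w where w: "c \<le> w" "w + 2 * d \<le> c + 6 * d" and noknot: "\<And>k. k \<in> {w..w + 2 * d} \<Longrightarrow> \<not> knot k"
  proof (cases "\<exists>j\<in>{c..c + 2 * d}. knot j")
    case True
    then show ?thesis using False d by (intro that[of "c + 4 * d"]) auto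
  next
    case no: False
    then show ?thesis using d by (intro that[of c]) auto
  qed
  have wB: "A \<le> w" "w + 2 * d \<le> B" using w c by auto
  \<comment> \<open>The nearest knots on either side; \<open>knot_l\<close> and
    \<open>knot_u\<close> make both sets nonempty.\<close>
  define s t where "s = Max {k. knot k \<and> k \<le> w}" and "t = Min {k. knot k \<and> w + 2 * d \<le> k}"
  have fin: "finite {k. knot k \<and> P k}" for P by (rule finite_subset[OF _ finite_knots]) auto
  have "s \<in> {k. knot k \<and> k \<le> w}" unfolding s_def using knot_l lA wB by (intro Max_in fin) auto
  then have s: "knot s" "s \<le> w" by auto
  have "t \<in> {k. knot k \<and> w + 2 * d \<le> k}" unfolding t_def using knot_u uB wB by (intro Min_in fin) auto
  then have t: "knot t" "w + 2 * d \<le> t" by auto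
  have smax: "k \<le> s" if "knot k" "k \<le> w" for k unfolding s_def using that fin by (intro Max_ge) auto
  have tmin: "t \<le> k" if "knot k" "w + 2 * d \<le> k" for k unfolding t_def using that fin by (intro Min_le) auto
  have none: "\<not> knot k" if "s < k" "k < t" for k
    using smax[of k] tmin[of k] noknot[of k] that by force
  have st: "s < t" using s t d by simp
  have lu: "{s..t} \<subseteq> {l..u}" using knot_range[OF s(1)] knot_range[OF t(1)] by auto
  have aff: "g y = (t * g s - s * g t) / (t - s) + (g t - g s) / (t - s) * y" if "y \<in> {s..t}" for y
  proof -
    have "(t - s) * g y = (t - y) * g s + (y - s) * g t"
      by (rule affine_between_knots[OF _ _ st none that]) (use s t in \<open>auto simp: knot_def\<close>)
    then have "g y = ((t * g s - s * g t) + (g t - g s) * y) / (t - s)"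
      using st by (simp add: eq_divide_eq algebra_simps)
    then show ?thesis by (simp add: add_divide_distrib)
  qed
  define h where "h y = \<phi> y - g y" for y
  have h: "concave_on {s..t} h"
  proof -
    have "concave_on {s..t} (\<lambda>y. \<phi> y + (- ((t * g s - s * g t) / (t - s)) + (- ((g t - g s) / (t - s))) * y))"
      by (intro concave_on_add concave_on_mono[OF \<phi>_conc lu] concave_on_affine) auto
    then show ?thesis
    proof (rule concave_on_cong')
      fix y assume "y \<in> {s..t}"
      from aff[OF this] show "\<phi> y + (- ((t * g s - s * g t) / (t - s)) + (- ((g t - g s) / (t - s))) * y) = h y"
        by (simp add: h_def)
    qed
  qed
  have hc: "continuous_on {s..t} h"
  proof -
    have "continuous_on {s..t} (\<lambda>y. \<phi> y - ((t * g s - s * g t) / (t - s) + (g t - g s) / (t - s) * y))"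
      by (intro continuous_intros continuous_on_subset[OF \<phi>_cont lu])
    then show ?thesis
    proof (rule continuous_on_eq)
      fix y assume "y \<in> {s..t}"
      from aff[OF this] show "\<phi> y - ((t * g s - s * g t) / (t - s) + (g t - g s) / (t - s) * y) = h y"
        by (simp add: h_def)
    qed
  qed
  have sub: "{w..w + 2 * d} \<subseteq> {c..c + 6 * d}" using w by auto
  have "(\<forall>y\<in>{w..w + 2 * d}. h y \<le> - e) \<or> (\<forall>y\<in>{w..w + 2 * d}. e \<le> h y)"
    using big
  proof (elim disjE)
    assume *: "\<forall>y\<in>{c..c + 6 * d}. e \<le> g y - \<phi> y"
    have "h y \<le> - e" if "y \<in> {w..w + 2 * d}" for y
      using bspec[OF * subsetD[OF sub that]] by (simp add: h_def)
    then show ?thesis by blast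
  next
    assume *: "\<forall>y\<in>{c..c + 6 * d}. g y - \<phi> y \<le> - e"
    have "e \<le> h y" if "y \<in> {w..w + 2 * d}" for y
      using bspec[OF * subsetD[OF sub that]] by (simp add: h_def)
    then show ?thesis by blast
  qed
  then consider "\<forall>y\<in>{w..w + 2 * d}. h y \<le> - e" | "\<forall>y\<in>{w..w + 2 * d}. e \<le> h y" by blast
  then show False
  proof cases
    case 1
    \<comment> \<open>A concave function with values above \<open>- e\<close> on both sides of
      \<open>w\<close> would exceed \<open>- e\<close> at \<open>w\<close>.\<close>
    have "(\<forall>y\<in>{s..w + 2 * d}. h y \<le> - e) \<or> (\<forall>y\<in>{w..t}. h y \<le> - e)"
    proof (rule ccontr)
      assume "\<not> ?thesis"
      then obtain y1 y2 where y: "y1 \<in> {s..w + 2 * d}" "- e < h y1" "y2 \<in> {w..t}" "- e < h y2" by (auto simp: not_le)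
      then have y12: "y1 < w" "w + 2 * d < y2" using 1 by (auto simp: not_le[symmetric])
      have "(y2 - w) * h y1 + (w - y1) * h y2 \<le> (y2 - y1) * h w"
        using y y12 s t d by (intro concave_on_three_points[OF h]) auto
      also have "\<dots> \<le> (y2 - y1) * (- e)" using 1 y12 d by (intro mult_left_mono) auto
      finally have "(y2 - w) * h y1 + (w - y1) * h y2 \<le> (y2 - y1) * (- e)" .
      moreover have "(y2 - w) * (- e) < (y2 - w) * h y1" using y y12 d by (intro mult_strict_left_mono) auto
      moreover have "(w - y1) * (- e) < (w - y1) * h y2" using y y12 by (intro mult_strict_left_mono) auto
      ultimately show False by (simp add: algebra_simps)
    qed
    then show False
    proof
      assume *: "\<forall>y\<in>{s..w + 2 * d}. h y \<le> - e"
      have "e \<le> g y - \<phi> y" if "y \<in> {s..w + 2 * d}" for y using bspec[OF * that] by (simp add: h_def)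
      then show False using s wB d by (intro positive_window_left[OF s(1), of "w + 2 * d"]) auto
    next
      assume *: "\<forall>y\<in>{w..t}. h y \<le> - e"
      have "e \<le> g y - \<phi> y" if "y \<in> {w..t}" for y using bspec[OF * that] by (simp add: h_def)
      then show False using t wB d by (intro positive_window_right[OF t(1), of w]) auto
    qed
  next
    case 2
    have wd: "w < w + d" "w + d \<le> t" "- (w + 2 * d) < - (w + d)" "- (w + d) \<le> - s" "- t \<le> - (w + 2 * d)"
      using s t d by auto
    have ge: "e \<le> h y" if "y \<in> {w..w + d}" for y using 2 that d by auto
    have ge': "e \<le> h (- y)" if "y \<in> {- (w + 2 * d)..- (w + d)}" for y using 2 that d by auto
    obtain a where a: "s \<le> a" "a \<le> w" "\<And>y. y \<in> {a..w + d} \<Longrightarrow> e * (y - a) \<le> (w + d - a) * h y"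
      "\<And>y. s \<le> y \<Longrightarrow> y \<le> a \<Longrightarrow> (w + d - a) * h y \<le> - (e * (a - y)) \<or> y = a"
      by (rule concave_positive_left_end[OF h hc s(2) wd(1,2) e(1) ge], assumption, rule that, assumption+)
    \<comment> \<open>Reflection turns the right foot of the tent into a left one.\<close>
    have h': "concave_on {- t..- s} (\<lambda>y. h (- y))"
    proof (rule concave_on_three_pointsI)
      fix a b c assume *: "a \<in> {- t..- s}" "c \<in> {- t..- s}" "a < b" "b < c"
      have "(- a - - b) * h (- c) + (- b - - c) * h (- a) \<le> (- a - - c) * h (- b)"
        using * by (intro concave_on_three_points[OF h]) auto
      then show "(c - b) * h (- a) + (b - a) * h (- c) \<le> (c - a) * h (- b)" by (simp add: algebra_simps)
    qed simp
    have hc': "continuous_on {- t..- s} (\<lambda>y. h (- y))"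
      by (intro continuous_on_compose2[OF hc]) (auto intro!: continuous_intros)
    obtain b' where b': "- t \<le> b'" "b' \<le> - (w + 2 * d)" 
      "\<And>y. y \<in> {b'..- (w + d)} \<Longrightarrow> e * (y - b') \<le> (- (w + d) - b') * h (- y)"
      "\<And>y. - t \<le> y \<Longrightarrow> y \<le> b' \<Longrightarrow> (- (w + d) - b') * h (- y) \<le> - (e * (b' - y)) \<or> y = b'"
      by (rule concave_positive_left_end[OF h' hc' wd(5,3,4) e(1) ge'], assumption, rule that, assumption+)
    define b where "b = - b'"
    have b: "w + 2 * d \<le> b" "b \<le> t" using b' by (auto simp: b_def)
    have bb: "b - y = - y - b'" "b - (w + d) = - (w + d) - b'" "y - b = b' - - y" for y by (auto simp: b_def)
    have bR: "e * (b - y) \<le> (b - (w + d)) * h y" if "y \<in> {w + d..b}" for y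
    proof -
      have "- y \<in> {b'..- (w + d)}" using that by (auto simp: b_def)
      from b'(3)[OF this] show ?thesis unfolding bb by (simp only: minus_minus)
    qed
    have bO: "(b - (w + d)) * h y \<le> - (e * (y - b)) \<or> y = b" if "b \<le> y" "y \<le> t" for y
    proof -
      have "- t \<le> - y" "- y \<le> b'" using that by (auto simp: b_def)
      from b'(4)[OF this] show ?thesis unfolding bb by (auto simp: b_def)
    qed
    show False
    proof (rule negative_piece[OF s(1) t(1) a(1), of "w + d" b])
      show "d \<le> w + d - a" "d \<le> b - (w + d)" "b \<le> t" "A \<le> w + d" "w + d \<le> B"
        using a(2) b wB d by auto
      show "e * (y - a) \<le> (w + d - a) * (\<phi> y - g y)" if "y \<in> {a..w + d}" for y
        using a(3)[OF that] unfolding h_def .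
      show "(w + d - a) * (\<phi> y - g y) \<le> - (e * (a - y)) \<or> y = a" if "s \<le> y" "y \<le> a" for y
        using a(4)[OF that] unfolding h_def .
      show "e * (b - y) \<le> (b - (w + d)) * (\<phi> y - g y)" if "y \<in> {w + d..b}" for y
        using bR[OF that] unfolding h_def .
      show "(b - (w + d)) * (\<phi> y - g y) \<le> - (e * (y - b)) \<or> y = b" if "b \<le> y" "y \<le> t" for y
        using bO[OF that] unfolding h_def .
    qed
  qed
qed

text \<open>\<open>spike_window\<close> at scale \<open>24 * d\<close> produces a window of length
  \<open>6 * d\<close>, exactly what \<open>no_deviation_window\<close> excludes.\<close>

lemma uniform_closeness:
  assumes z: "A + 24 * d \<le> z" "z \<le> B - 24 * d"
    and lin: "\<And>y. y \<in> {z - 24 * d..z + 24 * d} \<Longrightarrow> \<bar>\<phi> y - \<phi> z - m * (y - z)\<bar> \<le> e"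
  shows "\<bar>g z - \<phi> z\<bar> < 4 * e"
proof (rule ccontr)
  assume "\<not> ?thesis"
  then have far: "4 * e \<le> \<bar>g z - \<phi> z\<bar>" by simp
  have cg: "concave_on {z - 24 * d..z + 24 * d} g"
    using z lA uB by (intro concave_on_mono[OF g]) auto
  have d24: "24 * d > 0" using d by simp
  obtain c where "z - 24 * d \<le> c" "c + 24 * d / 4 \<le> z + 24 * d"
    "(\<forall>y\<in>{c..c + 24 * d / 4}. e \<le> g y - \<phi> y) \<or> (\<forall>y\<in>{c..c + 24 * d / 4}. g y - \<phi> y \<le> - e)"
    using spike_window[OF cg d24 e(1) lin far] by blast
  then show False using no_deviation_window[of c] z by simp
qed

end
end

section \<open>From the log-density to the hazard rate\<close>

context noisy_mle
begin

text \<open>Without a knot in between, the nearest knots outside enclose a linear piece that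
  contains \<open>a\<close>, \<open>b\<close> and their midpoint.\<close>

lemma knot_if_not_midpoint_affine:
  assumes ab: "A \<le> a" "a < b" "b \<le> B" and ne: "g ((a + b) / 2) \<noteq> (g a + g b) / 2"
  shows "\<exists>k\<in>{a<..<b}. knot k"
proof (rule ccontr)
  assume no: "\<not> ?thesis"
  define s t where "s = Max {k. knot k \<and> k \<le> a}" and "t = Min {k. knot k \<and> b \<le> k}"
  have fin: "finite {k. knot k \<and> P k}" for P by (rule finite_subset[OF _ finite_knots]) auto
  have "s \<in> {k. knot k \<and> k \<le> a}" unfolding s_def using knot_l lA ab by (intro Max_in fin) auto
  then have s: "knot s" "s \<le> a" by auto
  have "t \<in> {k. knot k \<and> b \<le> k}" unfolding t_def using knot_u uB ab by (intro Min_in fin) auto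
  then have t: "knot t" "b \<le> t" by auto
  have smax: "k \<le> s" if "knot k" "k \<le> a" for k unfolding s_def using that fin by (intro Max_ge) auto
  have tmin: "t \<le> k" if "knot k" "b \<le> k" for k unfolding t_def using that fin by (intro Min_le) auto
  have none: "\<not> knot k" if "s < k" "k < t" for k
    using smax[of k] tmin[of k] no that by force
  have st: "s < t" using s t ab by simp
  have aff: "(t - s) * g y = (t - y) * g s + (y - s) * g t" if "y \<in> {s..t}" for y
    by (rule affine_between_knots[OF _ _ st none that]) (use s t in \<open>auto simp: knot_def\<close>)
  have "(t - s) * (2 * g ((a + b) / 2)) = 2 * ((t - s) * g ((a + b) / 2))" by simp
  also have "\<dots> = 2 * ((t - (a + b) / 2) * g s + ((a + b) / 2 - s) * g t)" using s t ab by (subst aff) auto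
  also have "\<dots> = ((t - a) * g s + (a - s) * g t) + ((t - b) * g s + (b - s) * g t)"
    by (simp add: algebra_simps add_divide_distrib)
  also have "\<dots> = (t - s) * (g a + g b)" using s t ab aff[of a] aff[of b] by (simp add: distrib_left)
  finally show False using ne st by simp
qed

text \<open>Starting the integration of the density error at the knot, instead of at -\<infinity>,
  avoids any control of the estimated density outside \<open>{a..b}\<close>.\<close>

lemma cdf_deviation:
  assumes ab: "A \<le> a" "b \<le> B" and k: "knot k" "k \<in> {a..b}" and z: "z \<in> {a..b}" and e: "0 \<le> e"
    and close: "\<And>y. y \<in> {a..b} \<Longrightarrow> \<bar>q y - f y\<bar> \<le> e"
  shows "\<bar>(LINT y|lborel. indicator {..z} y * q y) - (LINT y|lborel. indicator {..z} y * f y)\<bar> \<le> \<eta> 1 + (B - A) * e"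
proof -
  define G where "G S = (LINT y|lborel. indicator S y * (f y - q y))" for S :: "real set"
  have G: "G S = (LINT y|lborel. indicator S y * f y) - (LINT y|lborel. indicator S y * q y)"
    "integrable lborel (\<lambda>y. indicator S y * (f y - q y))" if "S \<in> sets borel" for S
    unfolding G_def using integrable_f_q[of "indicator S" 1] that by auto
  have GU: "G {..j'} = G {..j} + G {j<..j'}" if "j \<le> j'" for j j'
  proof -
    have "G {..j'} = (LINT y|lborel. indicator {..j} y * (f y - q y) + indicator {j<..j'} y * (f y - q y))"
      unfolding G_def using that by (intro Bochner_Integration.integral_cong) (auto simp: indicator_def)
    also have "\<dots> = G {..j} + G {j<..j'}" unfolding G_def by (intro Bochner_Integration.integral_add G) auto
    finally show ?thesis .
  qed
  have small: "\<bar>G {j<..j'}\<bar> \<le> (B - A) * e" if j: "a \<le> j" "j \<le> j'" "j' \<le> b" for j j'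
  proof -
    have "\<bar>G {j<..j'}\<bar> \<le> (LINT y|lborel. \<bar>indicator {j<..j'} y * (f y - q y)\<bar>)"
      unfolding G_def by (rule integral_abs_bound)
    also have "\<dots> \<le> (LINT y|lborel. e * indicator {A..B} y)"
    proof (intro integral_mono integrable_abs G integrable_mult_right integrable_indicator_Icc)
      fix y show "\<bar>indicator {j<..j'} y * (f y - q y)\<bar> \<le> e * indicator {A..B} y"
        using close[of y] j ab e by (auto simp: indicator_def abs_minus_commute)
    qed simp
    also have "\<dots> = (B - A) * e" using AB by simp
    finally show ?thesis .
  qed
  have "\<bar>G {..k}\<bar> \<le> \<eta> 1" using knot_cdf[OF k(1)] by (simp add: G abs_minus_commute)
  moreover have "\<bar>G {..z} - G {..k}\<bar> \<le> (B - A) * e"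
  proof (cases "k \<le> z")
    case True
    then show ?thesis using GU[OF True] small[of k z] k z by simp
  next
    case False
    then show ?thesis using GU[of z k] small[of z k] k z by simp
  qed
  ultimately have "\<bar>G {..z}\<bar> \<le> \<eta> 1 + (B - A) * e" by linarith
  then show ?thesis by (simp add: G abs_minus_commute)
qed

text \<open>The mass of the right margin keeps the denominator of the hazard rate away from zero up
  to \<open>B\<close>.\<close>

lemma mass_beyond_ge:
  shows "c0 * r \<le> (LINT y|lborel. indicator {B<..} y * f y)"
proof -
  have "c0 * (LINT y|lborel. indicator {B<..} y * indicator {B..B + r} y) \<le> (LINT y|lborel. indicator {B<..} y * f y)"
    using r AB by (intro weighted_mass_ge[where K = 1]) auto
  moreover have "(LINT y|lborel. indicator {B<..} y * indicator {B..B + r} y :: real) = (LINT y|lborel. indicator {B<..B + r} y)"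
    by (intro Bochner_Integration.integral_cong) (auto simp: indicator_def)
  moreover have "\<dots> = r" using r by simp
  ultimately show ?thesis by simp
qed

lemma survival_ge:
  assumes "z \<le> B"
  shows "c0 * r \<le> 1 - (LINT y|lborel. indicator {..z} y * f y)"
proof -
  have i: "integrable lborel (\<lambda>y. indicator S y * f y)" if "S \<in> sets borel" for S
    using that by (intro bounded_f_integrable[of _ 1]) auto
  have "(LINT y|lborel. indicator {..z} y * f y) + (LINT y|lborel. indicator {B<..} y * f y) =
      (LINT y|lborel. indicator {..z} y * f y + indicator {B<..} y * f y)"
    by (intro Bochner_Integration.integral_add[symmetric] i) auto
  also have "\<dots> \<le> (LINT y|lborel. f y)"
    using assms f_nonneg by (intro integral_mono Bochner_Integration.integrable_add i f_int) (auto simp: indicator_def)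
  finally show ?thesis using mass_beyond_ge f_total by linarith
qed

lemma density_deviation:
  assumes y: "y \<in> {l..u}" and e: "\<bar>g y - \<phi> y\<bar> \<le> e" "e \<le> 1"
  shows "\<bar>q y - f y\<bar> \<le> 2 * c1 * e"
proof -
  define p where "p = g y - \<phi> y"
  have p: "\<bar>p\<bar> \<le> e" "\<bar>p\<bar> \<le> 1" using e by (auto simp: p_def)
  have "p\<^sup>2 \<le> \<bar>p\<bar>"
    using p mult_left_mono[of "\<bar>p\<bar>" 1 "\<bar>p\<bar>"] by (simp add: power2_eq_square abs_mult_self)
  then have "\<bar>exp p - 1\<bar> \<le> 2 * e"
    using exp_le_quadratic[OF p(2)] exp_ge_add_one_self[of p] p(1) by linarith
  then have "f y * \<bar>exp p - 1\<bar> \<le> c1 * (2 * e)" using f_le f_nonneg c1 by (intro mult_mono) auto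
  moreover have "q y - f y = f y * (exp p - 1)" using q_f[OF y] by (simp add: p_def algebra_simps)
  ultimately show ?thesis using f_nonneg by (simp add: abs_mult)
qed

end

section \<open>Ratios, tangents, strict concavity and tails\<close>

lemma ratio_deviation:
  fixes a b s t :: real
  assumes t: "c \<le> t" and c: "0 < c" and st: "\<bar>s - t\<bar> \<le> D" "D \<le> c / 2" and b: "0 \<le> b" "b \<le> K" and ab: "\<bar>a - b\<bar> \<le> E"
  shows "\<bar>a / s - b / t\<bar> \<le> 2 * E / c + 2 * K * D / c\<^sup>2"
proof -
  have t0: "0 < t" and s0: "0 < s" and sc: "c / 2 \<le> s" using assms by linarith+
  have "a / s - b / t = (a - b) / s + b * (t - s) / (s * t)"
    using s0 t0 by (simp add: field_simps)
  also have "\<bar>\<dots>\<bar> \<le> \<bar>(a - b) / s\<bar> + \<bar>b * (t - s) / (s * t)\<bar>" by (rule abs_triangle_ineq)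
  also have "\<dots> = \<bar>a - b\<bar> / s + b * \<bar>s - t\<bar> / (s * t)"
    using s0 t0 b by (simp add: abs_mult abs_minus_commute)
  also have "\<dots> \<le> E / (c / 2) + K * D / (c / 2 * c)"
    using assms s0 t0 sc by (intro add_mono frac_le mult_mono) auto
  also have "\<dots> = 2 * E / c + 2 * K * D / c\<^sup>2" by (simp add: power2_eq_square mult_ac)
  finally show ?thesis .
qed

text \<open>For \<open>\<beta> = 1\<close> the constant approximation already has the right order,
  so slope \<open>0\<close> serves; otherwise the mean value theorem is applied with slope
  \<open>h' z\<close>.\<close>

lemma holder_class_tangent:
  assumes h: "h \<in> holder_class \<beta> L {A..B}" and \<beta>: "1 \<le> \<beta>" and L: "0 \<le> L" and z: "z \<in> {A..B}"
  shows "\<exists>m. \<forall>y\<in>{A..B}. \<bar>h y - h z - m * (y - z)\<bar> \<le> L * \<bar>y - z\<bar> powr \<beta>"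
proof (cases "\<beta> = 1")
  case True
  then have "\<forall>x\<in>{A..B}. \<forall>y\<in>{A..B}. \<bar>h x - h y\<bar> \<le> L * \<bar>x - y\<bar>" using h by (simp add: holder_class_def)
  then show ?thesis using z True by (intro exI[of _ 0]) auto
next
  case False
  then obtain h' where h': "\<And>x. x \<in> {A..B} \<Longrightarrow> (h has_real_derivative h' x) (at x within {A..B})"
    "\<And>x y. x \<in> {A..B} \<Longrightarrow> y \<in> {A..B} \<Longrightarrow> \<bar>h' x - h' y\<bar> \<le> L * \<bar>x - y\<bar> powr (\<beta> - 1)"
    using h False unfolding holder_class_def by (simp only: mem_Collect_eq if_False) blast
  have mvt: "\<exists>\<xi>\<in>{a..b}. h b - h a = h' \<xi> * (b - a)" if ab: "a \<le> b" "a \<in> {A..B}" "b \<in> {A..B}" for a b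
  proof (rule mvt_very_simple[OF ab(1)])
    fix y assume y: "a \<le> y" "y \<le> b"
    then have "(h has_real_derivative h' y) (at y within {a..b})"
      using ab by (intro DERIV_subset[OF h'(1)]) auto
    then show "(h has_derivative (*) (h' y)) (at y within {a..b})" by (simp add: has_field_derivative_def)
  qed
  have "\<bar>h y - h z - h' z * (y - z)\<bar> \<le> L * \<bar>y - z\<bar> powr \<beta>" if y: "y \<in> {A..B}" for y
  proof -
    obtain \<xi> where \<xi>: "\<bar>\<xi> - z\<bar> \<le> \<bar>y - z\<bar>" "\<xi> \<in> {A..B}" "h y - h z = h' \<xi> * (y - z)"
    proof (cases "z \<le> y")
      case True
      obtain \<xi> where "\<xi> \<in> {z..y}" "h y - h z = h' \<xi> * (y - z)" using mvt[OF True] z y by blast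
      then show ?thesis using that[of \<xi>] z y by auto
    next
      case False
      then obtain \<xi> where "\<xi> \<in> {y..z}" "h z - h y = h' \<xi> * (z - y)" using mvt[of y z] z y by auto
      then show ?thesis using that[of \<xi>] z y by (auto simp: algebra_simps)
    qed
    have "h y - h z - h' z * (y - z) = (h' \<xi> - h' z) * (y - z)" using \<xi> by (simp add: algebra_simps)
    then have "\<bar>h y - h z - h' z * (y - z)\<bar> = \<bar>h' \<xi> - h' z\<bar> * \<bar>y - z\<bar>" by (simp only: abs_mult)
    also have "\<dots> \<le> (L * \<bar>\<xi> - z\<bar> powr (\<beta> - 1)) * \<bar>y - z\<bar>" using h'(2)[OF \<xi>(2) z] by (intro mult_right_mono) auto
    also have "\<dots> \<le> (L * \<bar>y - z\<bar> powr (\<beta> - 1)) * \<bar>y - z\<bar>"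
      using \<xi>(1) L \<beta> by (intro mult_right_mono mult_left_mono powr_mono2) auto
    also have "\<dots> = L * \<bar>y - z\<bar> powr \<beta>"
      by (cases "y = z") (use False \<beta> in \<open>auto simp: powr_diff\<close>)
    finally show ?thesis .
  qed
  then show ?thesis by blast
qed

lemma one_sided_deriv_affine:
  assumes x: "x \<in> {a<..<b}" and aff: "\<And>y. y \<in> {a..b} \<Longrightarrow> h y = c + m * y"
  shows "left_deriv h x = m" "right_deriv h x = m"
proof -
  have quot: "(h y - h x) / (y - x) = m" if "y \<in> {a..b}" "y \<noteq> x" for y
  proof -
    have "h y - h x = m * (y - x)" using aff[OF that(1)] aff[of x] x by (simp add: algebra_simps)
    then show ?thesis using that(2) by simp
  qed
  have "eventually (\<lambda>y. y \<in> {a<..<x}) (at_left x)" using x by (intro eventually_at_left_real) auto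
  then have "eventually (\<lambda>y. (h y - h x) / (y - x) = m) (at_left x)"
  proof eventually_elim
    case (elim y)
    then show ?case using x by (intro quot) auto
  qed
  then have "((\<lambda>y. (h y - h x) / (y - x)) \<longlongrightarrow> m) (at_left x)" by (rule tendsto_eventually)
  then show "left_deriv h x = m" unfolding left_deriv_def by (intro tendsto_Lim) auto
  have "eventually (\<lambda>y. y \<in> {x<..<b}) (at_right x)" using x by (intro eventually_at_right_real) auto
  then have "eventually (\<lambda>y. (h y - h x) / (y - x) = m) (at_right x)"
  proof eventually_elim
    case (elim y)
    then show ?case using x by (intro quot) auto
  qed
  then have "((\<lambda>y. (h y - h x) / (y - x)) \<longlongrightarrow> m) (at_right x)" by (rule tendsto_eventually)
  then show "right_deriv h x = m" unfolding right_deriv_def by (intro tendsto_Lim) auto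
qed

text \<open>A concave function lies above its chord; if it does not exceed the chord at the
  midpoint, it coincides with it on all of \<open>{a..b}\<close>. Then both one-sided derivatives
  are constant inside, which contradicts the decrease of \<open>D\<close>.\<close>

lemma strict_midpoint_concavity:
  assumes h: "concave_on {a..b} h" and ab: "a < b"
    and D: "D = left_deriv h \<or> D = right_deriv h"
    and decr: "\<And>x y. a \<le> x \<Longrightarrow> x < y \<Longrightarrow> y \<le> b \<Longrightarrow> 0 < D x - D y"
  shows "(h a + h b) / 2 < h ((a + b) / 2)"
proof (rule ccontr)
  assume not: "\<not> ?thesis"
  define m where "m = (a + b) / 2"
  have m: "a < m" "m < b" using ab by (auto simp: m_def)
  have hm: "h m \<le> (h a + h b) / 2" using not by (simp add: m_def)
  define \<sigma> where "\<sigma> = (h b - h a) / (b - a)"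
  have \<sigma>: "\<sigma> * (b - a) = h b - h a" using ab by (simp add: \<sigma>_def)
  define k where "k y = h y - h a - \<sigma> * (y - a)" for y
  have k: "concave_on {a..b} k"
  proof -
    have "concave_on {a..b} (\<lambda>y. h y + ((- h a + \<sigma> * a) + (- \<sigma>) * y))"
      by (intro concave_on_add h concave_on_affine) simp
    then show ?thesis by (rule concave_on_cong') (simp add: k_def algebra_simps)
  qed
  have k0: "k a = 0" "k b = 0" using \<sigma> by (auto simp: k_def)
  have "\<sigma> * (m - a) = (h b - h a) / 2"
  proof -
    have "m - a = (b - a) / 2" by (simp add: m_def field_simps)
    then have "\<sigma> * (m - a) = \<sigma> * (b - a) / 2" by simp
    then show ?thesis unfolding \<sigma> .
  qed
  then have km: "k m \<le> 0" using hm by (simp add: k_def field_simps)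
  have k_zero: "k y = 0" if y: "y \<in> {a..b}" for y
  proof -
    have "(b - y) * k a + (y - a) * k b \<le> (b - a) * k y" using y ab by (intro concave_on_three_points[OF k]) auto
    then have "0 \<le> k y" using k0 ab by (simp add: zero_le_mult_iff)
    moreover have "k y \<le> 0"
    proof (cases "y \<le> m")
      case True
      have "(b - m) * k y + (m - y) * k b \<le> (b - y) * k m" using y m True by (intro concave_on_three_points[OF k]) auto
      also have "\<dots> \<le> 0" using km m True by (intro mult_nonneg_nonpos) auto
      finally show ?thesis using k0 m by (simp add: mult_le_0_iff)
    next
      case False
      have "(y - m) * k a + (m - a) * k y \<le> (y - a) * k m" using y m False by (intro concave_on_three_points[OF k]) auto
      also have "\<dots> \<le> 0" using km m False by (intro mult_nonneg_nonpos) auto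
      finally show ?thesis using k0 m by (simp add: mult_le_0_iff)
    qed
    ultimately show ?thesis by simp
  qed
  have aff: "h y = (h a - \<sigma> * a) + \<sigma> * y" if "y \<in> {a..b}" for y
    using k_zero[OF that] by (simp add: k_def algebra_simps)
  have "D x = \<sigma>" if "x \<in> {a<..<b}" for x
    using D one_sided_deriv_affine[OF that aff] by auto
  then have "D m = \<sigma>" "D ((m + b) / 2) = \<sigma>" using m by auto
  moreover have "0 < D m - D ((m + b) / 2)" using m by (intro decr) auto
  ultimately show False by simp
qed

lemma exponential_tail:
  fixes f :: "real \<Rightarrow> real"
  assumes meas: "f \<in> borel_measurable borel" and K: "0 \<le> K" and \<alpha>: "0 < \<alpha>"
    and tail: "\<And>y. f y \<le> K * exp (- \<alpha> * \<bar>y\<bar>)" and m: "0 \<le> m"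
  shows "(\<integral>\<^sup>+ y. ennreal (f y) * indicator {y. m < \<bar>y\<bar>} y \<partial>lborel) \<le> ennreal (2 * K / \<alpha> * exp (- \<alpha> * m))"
proof -
  define h where "h y = K * exp (- \<alpha> * y)" for y
  have half: "(\<integral>\<^sup>+ y. ennreal (h y) * indicator {m..} y \<partial>lborel) = ennreal (K / \<alpha> * exp (- \<alpha> * m))"
  proof -
    have "(\<integral>\<^sup>+ y. ennreal (h y) * indicator {m..} y \<partial>lborel) = ennreal (0 - (- K / \<alpha> * exp (- \<alpha> * m)))"
    proof (rule nn_integral_FTC_atLeast)
      show "((\<lambda>y. - K / \<alpha> * exp (- \<alpha> * y)) has_real_derivative h y) (at y)" for y
        unfolding h_def using \<alpha> by (auto intro!: derivative_eq_intros)
      show "((\<lambda>y. - K / \<alpha> * exp (- \<alpha> * y)) \<longlongrightarrow> 0) at_top" using \<alpha> by real_asymp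
    qed (use K in \<open>auto simp: h_def\<close>)
    then show ?thesis by simp
  qed
  have hm[measurable]: "h \<in> borel_measurable borel" unfolding h_def by measurable
  have "(\<integral>\<^sup>+ y. ennreal (f y) * indicator {y. m < \<bar>y\<bar>} y \<partial>lborel) \<le>
      (\<integral>\<^sup>+ y. ennreal (h y) * indicator {m..} y + ennreal (h (- y)) * indicator {m..} (- y) \<partial>lborel)"
  proof (intro nn_integral_mono)
    fix y :: real
    have "ennreal (f y) \<le> ennreal (h \<bar>y\<bar>)" using tail[of y] by (simp add: h_def ennreal_leI)
    then show "ennreal (f y) * indicator {y. m < \<bar>y\<bar>} y \<le>
        ennreal (h y) * indicator {m..} y + ennreal (h (- y)) * indicator {m..} (- y)"
      using m by (cases "0 \<le> y") (auto simp: indicator_def)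
  qed
  also have "\<dots> = (\<integral>\<^sup>+ y. ennreal (h y) * indicator {m..} y \<partial>lborel) +
      (\<integral>\<^sup>+ y. ennreal (h (- y)) * indicator {m..} (- y) \<partial>lborel)"
    by (intro nn_integral_add) auto
  also have "(\<integral>\<^sup>+ y. ennreal (h (- y)) * indicator {m..} (- y) \<partial>lborel) = (\<integral>\<^sup>+ y. ennreal (h y) * indicator {m..} y \<partial>lborel)"
    using nn_integral_real_affine[of "\<lambda>y. ennreal (h y) * indicator {m..} y" "-1" 0] by simp
  also have "(\<integral>\<^sup>+ y. ennreal (h y) * indicator {m..} y \<partial>lborel) + \<dots> = ennreal (K / \<alpha> * exp (- \<alpha> * m) + K / \<alpha> * exp (- \<alpha> * m))"
    unfolding half using K \<alpha> by (intro ennreal_plus[symmetric]) auto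
  finally show ?thesis by (simp add: field_simps)
qed

section \<open>The true density and the hazard rate on a good sample\<close>

locale log_concave_density =
  fixes \<phi> :: "real \<Rightarrow> ereal" and f :: "real \<Rightarrow> real" and A B r c0 c1 :: real
  assumes conc: "ext_concave \<phi>" and f_eq: "f = (\<lambda>y. ext_exp (\<phi> y))"
    and mass: "(\<integral>\<^sup>+ y. ennreal (f y) \<partial>lborel) = 1"
    and AB: "A < B" and r: "0 < r" "r \<le> 1" and sub: "{A - r..B + r} \<subseteq> {y. 0 < f y}"
    and c0: "0 < c0" and f_ge: "\<And>y. y \<in> {A - r..B + r} \<Longrightarrow> c0 \<le> f y" and f_le: "\<And>y. f y \<le> c1"
begin

abbreviation "ph \<equiv> \<lambda>y. real_of_ereal (\<phi> y)"
abbreviation "\<nu> \<equiv> density lborel (\<lambda>y. ennreal (f y))"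

lemma f_meas [measurable]: "f \<in> borel_measurable borel"
  unfolding f_eq by (rule borel_measurable_ext_exp_concave[OF conc])

lemma f_nonneg: "0 \<le> f y"
  by (simp add: f_eq)

lemma f_int: "integrable lborel f"
  using mass f_nonneg by (intro integrableI_nonneg) auto

lemma f_total: "(LINT y|lborel. f y) = 1"
  using mass f_nonneg by (subst integral_eq_nn_integral) auto

lemma support: "{y. 0 < f y} = {y. \<phi> y \<noteq> -\<infinity>}"
  by (auto simp: f_eq ext_exp_pos_iff)

lemma support_interval: "is_interval {y. 0 < f y}"
  unfolding support using concave_on_imp_convex[OF ext_concave_imp_concave_on[OF conc]]
  by (simp add: is_interval_convex_1)

lemma ph_concave: "concave_on {y. 0 < f y} ph"
  unfolding support by (rule ext_concave_imp_concave_on[OF conc])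

lemma f_exp: "0 < f y \<Longrightarrow> f y = exp (ph y)"
  by (auto simp: f_eq ext_exp_def split: if_splits)

lemma ph_continuous: "continuous_on (interior {y. 0 < f y}) ph"
proof -
  have "concave_on (interior {y. 0 < f y}) ph"
    using support_interval by (intro concave_on_mono[OF ph_concave] interior_subset convex_interior) (simp add: is_interval_convex_1)
  then have "continuous_on (interior {y. 0 < f y}) (\<lambda>y. - ph y)"
    unfolding concave_on_def by (intro convex_on_continuous) auto
  from continuous_on_minus[OF this] show ?thesis by simp
qed

lemma measure_\<nu>: "S \<in> sets borel \<Longrightarrow> measure \<nu> S = (LINT y|lborel. indicator S y * f y)"
proof -
  assume S: "S \<in> sets borel"
  have "measure \<nu> S = (LINT y|\<nu>. indicator S y)" using S by simp
  also have "\<dots> = (LINT y|lborel. indicator S y * f y)"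
    using S f_nonneg by (subst integral_density) (auto simp: mult.commute)
  finally show ?thesis .
qed

lemma real_distribution_\<nu>: "real_distribution \<nu>"
proof -
  have "prob_space \<nu>" using mass by (intro prob_spaceI) (simp add: emeasure_density)
  then show ?thesis by (simp add: real_distribution_def real_distribution_axioms_def)
qed

lemma atomless: "measure \<nu> {y} = 0"
proof -
  have "measure \<nu> {y} = (LINT z|lborel. indicator {y} z * f z)" by (rule measure_\<nu>) simp
  also have "\<dots> = 0"
  proof (rule integral_eq_zero_AE)
    have "AE z in lborel. z \<noteq> y" by (rule AE_lborel_singleton)
    then show "AE z in lborel. indicator {y} z * f z = 0" by eventually_elim simp
  qed
  finally show ?thesis .
qed

text \<open>The support is an interval, so its frontier is a null set. Observations in the interior
  make \<phi> finite and continuous on the whole sample range, as the intermediate value argument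
  for the tent requires.\<close>

lemma AE_interior: "AE y in \<nu>. y \<in> interior {y. 0 < f y}"
proof -
  let ?S = "{y. 0 < f y}"
  have "negligible (frontier ?S)"
    using support_interval by (intro negligible_convex_frontier) (simp add: is_interval_convex_1)
  then have "frontier ?S \<in> null_sets lebesgue" by (simp add: negligible_iff_null_sets)
  then have "frontier ?S \<in> null_sets lborel" by (simp add: null_sets_def)
  then have "AE y in lborel. y \<notin> frontier ?S" by (rule AE_not_in)
  then have "AE y in lborel. 0 < ennreal (f y) \<longrightarrow> y \<in> interior ?S"
  proof eventually_elim
    case (elim y)
    show ?case
    proof
      assume "0 < ennreal (f y)"
      then have "y \<in> closure ?S" using closure_subset[of ?S] by auto
      then show "y \<in> interior ?S" using elim by (simp add: frontier_def)
    qed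
  qed
  then show ?thesis by (subst AE_density) auto
qed

text \<open>The deviation bound puts observations on both sides of \<open>[A, B]\<close>. The
  distribution function of the estimator is rewritten with \<open>q\<close>, which agrees with the
  estimated density almost everywhere.\<close>

lemma noisy_mle_if_good:
  assumes n: "n > 0" and mle: "is_log_concave_mle n x \<phi>h"
    and dev: "\<And>I. is_interval I \<Longrightarrow> \<bar>measure (empirical n x) I - measure \<nu> I\<bar> \<le> 14 * (sqrt (measure \<nu> I * \<rho>) + \<rho>)"
    and \<rho>: "0 \<le> \<rho>" and small: "14 * (sqrt (1 * \<rho>) + \<rho>) < c0 * (r / 2)"
    and sample: "\<And>i. i < n \<Longrightarrow> \<bar>x i\<bar> \<le> m" "\<And>i. i < n \<Longrightarrow> x i \<in> interior {y. 0 < f y}"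
    and l: "l = Min (x ` {..<n})" and u: "u = Max (x ` {..<n})"
  defines "g \<equiv> \<lambda>y. real_of_ereal (\<phi>h y)"
  defines "q \<equiv> \<lambda>y. if y \<in> {l..u} then exp (g y) else 0"
  shows "noisy_mle n x l u g q f ph A B r (2 * m + 1) c0 c1 (\<lambda>a. 14 * (sqrt (a * \<rho>) + \<rho>))"
    and "\<And>z. distr_fun (\<lambda>y. ext_exp (\<phi>h y)) z = (LINT y|lborel. indicator {..z} y * q y)"
    and "\<And>y. y \<in> {l..u} \<Longrightarrow> ext_exp (\<phi>h y) = q y"
proof -
  have fin: "finite (x ` {..<n})" "x ` {..<n} \<noteq> {}" using n by auto
  \<comment> \<open>An interval containing a piece of length \<open>r / 2\<close> within the margin
    has mass at least \<open>c0 * (r / 2)\<close>, more than the uniform noise bound, so it contains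
    an observation. Half the margin leaves the piece clear of \<open>A\<close> or \<open>B\<close>,
    where strict inequalities are wanted.\<close>
  have hit: "\<exists>i<n. x i \<in> I" if I: "is_interval I" and J: "{j..j + r / 2} \<subseteq> I \<inter> {A - r..B + r}" for I j
  proof (rule ccontr)
    assume no: "\<not> ?thesis"
    have Ib: "I \<in> sets borel" using I by (rule real_interval_borel_measurable)
    have "measure (empirical n x) I = 0" using no Ib by (simp add: measure_empirical indicator_def)
    then have "measure \<nu> I \<le> 14 * (sqrt (measure \<nu> I * \<rho>) + \<rho>)" using dev[OF I] by simp
    also have "\<dots> \<le> 14 * (sqrt (1 * \<rho>) + \<rho>)"
      using real_distribution_\<nu> \<rho> prob_space.prob_le_1[of \<nu> I]
      by (intro mult_left_mono add_right_mono real_sqrt_le_mono mult_right_mono) (auto simp: real_distribution_def)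
    also have "\<dots> < c0 * (r / 2)" by (rule small)
    also have "\<dots> = (LINT y|lborel. c0 * indicator {j..j + r / 2} y)" using r by simp
    also have "\<dots> \<le> (LINT y|lborel. indicator I y * f y)"
    proof (intro integral_mono integrable_mult_right integrable_indicator_Icc)
      show "integrable lborel (\<lambda>y. indicator I y * f y)"
        by (rule Bochner_Integration.integrable_bound[OF f_int]) (use Ib in \<open>auto simp: indicator_def\<close>)
      show "c0 * indicator {j..j + r / 2} y \<le> indicator I y * f y" for y
        using J f_ge[of y] f_nonneg[of y] c0 by (auto simp: indicator_def)
    qed
    also have "\<dots> = measure \<nu> I" using Ib by (simp add: measure_\<nu>)
    finally show False by simp
  qed
  have "\<exists>i<n. x i \<in> {..<A}"
    using r AB by (intro hit[of _ "A - r"]) (auto simp: is_interval_1)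
  then obtain i where i: "i < n" "x i < A" by auto
  have "\<exists>i<n. x i \<in> {B<..}"
    using r AB by (intro hit[of _ "B + r / 2"]) (auto simp: is_interval_1)
  then obtain j where j: "j < n" "B < x j" by auto
  have "l \<le> x i" "x j \<le> u" unfolding l u using i j fin by (auto intro!: Min_le Max_ge)
  then have lA: "l < A" and uB: "B < u" using i j by auto
  then have lu: "l < u" using AB by simp
  interpret concave_mle n x l u g q
    unfolding g_def q_def by (rule concave_mle_if_is_log_concave_mle(1)[OF mle n l u lu])
  have AEq: "AE y in lborel. ext_exp (\<phi>h y) = q y"
    unfolding g_def q_def by (rule concave_mle_if_is_log_concave_mle(2)[OF mle n l u lu])
  show "ext_exp (\<phi>h y) = q y" if "y \<in> {l..u}" for y
    unfolding g_def q_def by (rule concave_mle_if_is_log_concave_mle(3)[OF mle n l u lu that])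
  have hm: "(\<lambda>y. ext_exp (\<phi>h y)) \<in> borel_measurable borel"
    using mle by (intro borel_measurable_ext_exp_concave) (simp add: is_log_concave_mle_def)
  show "distr_fun (\<lambda>y. ext_exp (\<phi>h y)) z = (LINT y|lborel. indicator {..z} y * q y)" for z
    unfolding distr_fun_def set_lebesgue_integral_def
  proof (rule integral_cong_AE)
    show "AE y in lborel. indicator {..z} y *\<^sub>R ext_exp (\<phi>h y) = indicator {..z} y * q y"
      using AEq by eventually_elim simp
  qed (use hm in measurable)
  have inner: "{l..u} \<subseteq> interior {y. 0 < f y}"
  proof -
    have "is_interval (interior {y. 0 < f y})"
      using support_interval by (simp add: is_interval_convex_1 convex_interior)
    moreover have "l \<in> interior {y. 0 < f y}" "u \<in> interior {y. 0 < f y}" using l_data u_data sample(2) by auto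
    ultimately show ?thesis using mem_is_interval_1_I[of "interior {y. 0 < f y}" l u] by auto
  qed
  then have inner': "{l..u} \<subseteq> {y. 0 < f y}" using interior_subset by blast
  have lm: "\<bar>l\<bar> \<le> m" "\<bar>u\<bar> \<le> m" using l_data u_data sample(1) by auto
  \<comment> \<open>The added \<open>1\<close> in the width provides
    \<open>1 \<le> W\<close>.\<close>
  show "noisy_mle n x l u g q f ph A B r (2 * m + 1) c0 c1 (\<lambda>a. 14 * (sqrt (a * \<rho>) + \<rho>))"
  proof
    show "continuous_on {l..u} ph" by (rule continuous_on_subset[OF ph_continuous inner])
    show "concave_on {l..u} ph" by (rule concave_on_mono[OF ph_concave inner']) simp
    show "f y = exp (ph y)" if "y \<in> {l..u}" for y using inner' that by (intro f_exp) auto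
    show "u - l \<le> 2 * m + 1" "1 \<le> 2 * m + 1" using lm by auto
    show "\<bar>(\<Sum>i<n. indicator I (x i)) / n - (LINT y|lborel. indicator I y * f y)\<bar> \<le> 14 * (sqrt (a * \<rho>) + \<rho>)"
      if I: "is_interval I" and a: "(LINT y|lborel. indicator I y * f y) \<le> a" for I a
    proof -
      have Ib: "I \<in> sets borel" using I by (rule real_interval_borel_measurable)
      have "14 * (sqrt (measure \<nu> I * \<rho>) + \<rho>) \<le> 14 * (sqrt (a * \<rho>) + \<rho>)"
        using a \<rho> unfolding measure_\<nu>[OF Ib, symmetric]
        by (intro mult_left_mono add_right_mono real_sqrt_le_mono mult_right_mono) auto
      with dev[OF I] have "\<bar>measure (empirical n x) I - measure \<nu> I\<bar> \<le> 14 * (sqrt (a * \<rho>) + \<rho>)" by linarith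
      then show ?thesis unfolding measure_empirical[OF Ib] measure_\<nu>[OF Ib] .
    qed
  qed (use f_int f_nonneg f_total f_le c0 f_ge r AB lA uB in auto)
qed

text \<open>Deterministic conclusion on the good event. In \<open>gap\<close> the margin is
  \<open>8 * e\<close> because the error at the midpoint and the averaged error at the quarter
  points are below \<open>4 * e\<close> each. The condition \<open>small\<close> keeps the estimated
  survival function above half of the lower bound \<open>c0 * r\<close>.\<close>

lemma hazard_error_le:
  assumes n: "n > 0" and mle: "is_log_concave_mle n x \<phi>h"
    and dev: "\<And>I. is_interval I \<Longrightarrow> \<bar>measure (empirical n x) I - measure \<nu> I\<bar> \<le> 14 * (sqrt (measure \<nu> I * \<rho>) + \<rho>)"
    and \<rho>: "0 \<le> \<rho>"
    and sample: "\<And>i. i < n \<Longrightarrow> \<bar>x i\<bar> \<le> m" "\<And>i. i < n \<Longrightarrow> x i \<in> interior {y. 0 < f y}"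
    and d: "0 < d" "24 * d \<le> (B - A) / 4" and e: "0 < e" "4 * e \<le> 1"
    and near: "\<And>v. d \<le> v \<Longrightarrow> 14 * (sqrt (c1 * v * \<rho>) + \<rho>) < c0 * e * v / 24"
    and far: "24 * (2 * m + 1)\<^sup>2 * (14 * (sqrt (1 * \<rho>) + \<rho>)) < c0 * r ^ 3 * e"
    and tangent: "\<And>z. z \<in> {A..B} \<Longrightarrow> \<exists>k. \<forall>y\<in>{A..B}. \<bar>y - z\<bar> \<le> 24 * d \<longrightarrow> \<bar>ph y - ph z - k * (y - z)\<bar> \<le> e"
    and gap: "(ph (A + (B - A) / 4) + ph (B - (B - A) / 4)) / 2 + 8 * e <
      ph ((A + (B - A) / 4 + (B - (B - A) / 4)) / 2)"
    and small: "(c0 + 8 * c1 * (B - A)) * e \<le> c0 * r / 2"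
  shows "\<bar>hazard_error (largest_obs n x) (\<lambda>y. ext_exp (\<phi>h y)) f {A + 24 * d..B - 24 * d}\<bar> \<le>
    ereal ((16 * c1 / (c0 * r) + 2 * c1 * (c0 + 8 * c1 * (B - A)) / (c0 * r)\<^sup>2) * e)"
proof -
  define l u where "l = Min (x ` {..<n})" and "u = Max (x ` {..<n})"
  define g where "g y = real_of_ereal (\<phi>h y)" for y
  define q where "q y = (if y \<in> {l..u} then exp (g y) else 0)" for y
  define \<eta> where "\<eta> a = 14 * (sqrt (a * \<rho>) + \<rho>)" for a
  have m0: "0 \<le> m" using sample(1)[of 0] n by linarith
  have \<eta>0: "0 \<le> \<eta> 1" using \<rho> by (simp add: \<eta>_def)
  have re: "r ^ 3 * e \<le> 1 * e" using r e by (intro mult_right_mono power_le_one) auto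
  \<comment> \<open>The far condition also controls \<open>\<eta> 1\<close> itself, which enters the
    distribution functions and the existence of observations in the margins.\<close>
  have "1 * \<eta> 1 \<le> (24 * (2 * m + 1)\<^sup>2) * \<eta> 1"
  proof (rule mult_right_mono[OF _ \<eta>0])
    have "1 \<le> (2 * m + 1)\<^sup>2" using m0 by (intro one_le_power) simp
    then show "1 \<le> 24 * (2 * m + 1)\<^sup>2" by linarith
  qed
  also have "24 * (2 * m + 1)\<^sup>2 * \<eta> 1 < c0 * r ^ 3 * e" using far by (simp add: \<eta>_def)
  finally have \<eta>_far: "\<eta> 1 < c0 * r ^ 3 * e" by simp
  have \<eta>e: "\<eta> 1 \<le> c0 * e"
    using \<eta>_far mult_left_mono[OF re less_imp_le[OF c0]] unfolding mult.assoc mult_1 by linarith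
  have "c0 * r ^ 3 * e \<le> c0 * (r * 1) * (1 / 4)"
  proof (intro mult_mono mult_left_mono)
    have "r * r\<^sup>2 \<le> r * 1" using r by (intro mult_left_mono power_le_one) auto
    then show "r ^ 3 \<le> r * 1" by (simp add: power3_eq_cube power2_eq_square mult.assoc)
  qed (use c0 r e in auto)
  moreover have "0 < c0 * r" using c0 r by simp
  ultimately have \<eta>r: "\<eta> 1 < c0 * (r / 2)" using \<eta>_far by simp
  note good = noisy_mle_if_good[OF n mle dev \<rho> \<eta>r[unfolded \<eta>_def] sample l_def u_def,
      folded g_def, folded q_def, folded \<eta>_def]
  interpret noisy_mle n x l u g q f ph A B r "2 * m + 1" c0 c1 \<eta>
    using good(1) by (simp add: \<eta>_def[abs_def] q_def[abs_def] g_def[abs_def])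
  let ?S = "{A + 24 * d..B - 24 * d}"
  have SAB: "?S \<subseteq> {A..B}" "{A..B} \<subseteq> {l..u}" using d lA uB by auto
  have e1: "e \<le> 1" using e by simp
  have near': "\<eta> (c1 * v) < c0 * e * v / 24" if "d \<le> v" for v using near[OF that] by (simp add: \<eta>_def)
  have far': "24 * (2 * m + 1)\<^sup>2 * \<eta> 1 < c0 * r ^ 3 * e" using far by (simp add: \<eta>_def)
  have close: "\<bar>g z - ph z\<bar> < 4 * e" if z: "z \<in> ?S" for z
  proof -
    obtain k where k: "\<forall>y\<in>{A..B}. \<bar>y - z\<bar> \<le> 24 * d \<longrightarrow> \<bar>ph y - ph z - k * (y - z)\<bar> \<le> e"
      using tangent z SAB by blast
    show ?thesis
      using z k by (intro uniform_closeness[OF d(1) e(1) e1 near' far', of z k]) auto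
  qed
  \<comment> \<open>Quarter points: \<open>24 * d \<le> (B - A) / 4\<close> places them and their
    midpoint inside \<open>?S\<close>, and so the knot found between them lies in \<open>?S\<close>
    too.\<close>
  define a b where "a = A + (B - A) / 4" and "b = B - (B - A) / 4"
  define w where "w = (B - A) / 4"
  have "4 * w = B - A" unfolding w_def by simp
  then have "B = A + 4 * w" by simp
  moreover have "0 < w" "24 * d \<le> w" using AB d(2) unfolding w_def by auto
  ultimately have ab: "a \<in> ?S" "b \<in> ?S" "a < b" using d(1) unfolding a_def b_def w_def[symmetric] by auto
  then have mid: "(a + b) / 2 \<in> ?S" by auto
  have "g ((a + b) / 2) \<noteq> (g a + g b) / 2"
    using close[OF ab(1)] close[OF ab(2)] close[OF mid] gap unfolding a_def[symmetric] b_def[symmetric] by argo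
  then obtain k where k: "knot k" "k \<in> {a<..<b}"
    using knot_if_not_midpoint_affine[of a b] ab SAB by auto
  have kS: "k \<in> ?S" using k ab by auto
  have dens: "\<bar>q y - f y\<bar> \<le> 8 * c1 * e" if "y \<in> ?S" for y
    using density_deviation[of y "4 * e"] close[OF that] e SAB that by auto
  have c1': "0 \<le> 8 * c1 * e" using c1 e by simp
  have point: "\<bar>hazard (\<lambda>y. ext_exp (\<phi>h y)) z - hazard f z\<bar> \<le>
      (16 * c1 / (c0 * r) + 2 * c1 * (c0 + 8 * c1 * (B - A)) / (c0 * r)\<^sup>2) * e" if z: "z \<in> ?S" for z
  proof -
    define Fh F where "Fh = (LINT y|lborel. indicator {..z} y * q y)" and "F = (LINT y|lborel. indicator {..z} y * f y)"
    have "\<bar>Fh - F\<bar> \<le> \<eta> 1 + (B - A) * (8 * c1 * e)"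
      unfolding Fh_def F_def using d by (intro cdf_deviation[OF _ _ k(1) kS z c1' dens]) auto
    also have "\<dots> \<le> (c0 + 8 * c1 * (B - A)) * e" using \<eta>e by (simp add: algebra_simps)
    finally have D: "\<bar>(1 - Fh) - (1 - F)\<bar> \<le> (c0 + 8 * c1 * (B - A)) * e" by (simp add: abs_minus_commute)
    have F: "c0 * r \<le> 1 - F" unfolding F_def using z d by (intro survival_ge) auto
    have "\<bar>q z / (1 - Fh) - f z / (1 - F)\<bar> \<le> 2 * (8 * c1 * e) / (c0 * r) + 2 * c1 * ((c0 + 8 * c1 * (B - A)) * e) / (c0 * r)\<^sup>2"
      using c0 r small f_nonneg f_le dens[OF z] by (intro ratio_deviation[OF F _ D]) auto
    also have "\<dots> = (16 * c1 / (c0 * r) + 2 * c1 * (c0 + 8 * c1 * (B - A)) / (c0 * r)\<^sup>2) * e"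
    proof -
      have "2 * (8 * c1 * e) / p + 2 * c1 * (s * e) / p' = (16 * c1 / p + 2 * c1 * s / p') * e" for p p' s
        by (simp add: distrib_right)
      then show ?thesis .
    qed
    finally have bound: "\<bar>q z / (1 - Fh) - f z / (1 - F)\<bar> \<le>
      (16 * c1 / (c0 * r) + 2 * c1 * (c0 + 8 * c1 * (B - A)) / (c0 * r)\<^sup>2) * e" .
    have "z \<in> {l..u}" using SAB z by blast
    then have 1: "ext_exp (\<phi>h z) = q z" using good(3)[of z] by (simp add: q_def g_def)
    have 2: "distr_fun (\<lambda>y. ext_exp (\<phi>h y)) z = Fh" using good(2)[of z] by (simp add: Fh_def q_def[abs_def] g_def)
    have 3: "distr_fun f z = F" by (simp add: distr_fun_def set_lebesgue_integral_def F_def)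
    show ?thesis unfolding hazard_def 1 2 3 by (rule bound)
  qed
  have obs: "largest_obs n x = u" by (simp add: largest_obs_def u_def)
  have Su: "?S \<subseteq> {..<u}" using uB d by auto
  have "0 \<le> (SUP t\<in>?S. ereal \<bar>hazard (\<lambda>y. ext_exp (\<phi>h y)) t - hazard f t\<bar>)"
    by (rule SUP_upper2[OF ab(1)]) simp
  moreover have "(SUP t\<in>?S. ereal \<bar>hazard (\<lambda>y. ext_exp (\<phi>h y)) t - hazard f t\<bar>) \<le>
      ereal ((16 * c1 / (c0 * r) + 2 * c1 * (c0 + 8 * c1 * (B - A)) / (c0 * r)\<^sup>2) * e)"
    using point by (intro SUP_least) simp
  ultimately have "\<bar>SUP t\<in>?S. ereal \<bar>hazard (\<lambda>y. ext_exp (\<phi>h y)) t - hazard f t\<bar>\<bar> \<le>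
      ereal ((16 * c1 / (c0 * r) + 2 * c1 * (c0 + 8 * c1 * (B - A)) / (c0 * r)\<^sup>2) * e)"
    by (simp only: abs_ereal_ge0)
  then show ?thesis unfolding hazard_error_def obs if_P[OF Su] .
qed

end

section \<open>Rates and the exceptional event\<close>

text \<open>On \<open>[1, 2]\<close> the exponent \<open>\<beta> / (2 * \<beta> + 1)\<close>
  increases from 1/3 to 2/5, and \<open>1 / (2 * \<beta> + 1)\<close> decreases from 1/3 to 1/5. The
  resulting bounds have fixed exponents, so the limits can be taken without \<beta>.\<close>

lemma rate_identities:
  fixes \<rho> \<beta> :: real
  assumes \<rho>: "0 < \<rho>" "\<rho> \<le> 1" and \<beta>: "1 \<le> \<beta>" "\<beta> \<le> 2"
  defines "\<delta> \<equiv> \<rho> powr (1 / (2 * \<beta> + 1))" and "\<epsilon> \<equiv> \<rho> powr (\<beta> / (2 * \<beta> + 1))"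
  shows "\<delta> powr \<beta> = \<epsilon>" "\<epsilon>\<^sup>2 * \<delta> = \<rho>" "\<rho> powr (2 / 5) \<le> \<epsilon>" "\<epsilon> \<le> \<rho> powr (1 / 3)"
    "\<delta> \<le> \<rho> powr (1 / 5)" "\<rho> powr (1 / 3) \<le> \<delta>"
proof -
  show "\<delta> powr \<beta> = \<epsilon>" by (simp add: \<delta>_def \<epsilon>_def powr_powr)
  have "\<epsilon>\<^sup>2 * \<delta> = \<rho> powr (\<beta> / (2 * \<beta> + 1) + \<beta> / (2 * \<beta> + 1) + 1 / (2 * \<beta> + 1))"
    by (simp only: \<delta>_def \<epsilon>_def powr_add power2_eq_square)
  also have "\<beta> / (2 * \<beta> + 1) + \<beta> / (2 * \<beta> + 1) + 1 / (2 * \<beta> + 1) = 1"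
    using \<beta> by (simp add: add_divide_distrib[symmetric])
  finally show "\<epsilon>\<^sup>2 * \<delta> = \<rho>" using \<rho> by simp
  have "\<beta> / (2 * \<beta> + 1) \<le> 2 / 5" "1 / 3 \<le> \<beta> / (2 * \<beta> + 1)" "1 / 5 \<le> 1 / (2 * \<beta> + 1)" "1 / (2 * \<beta> + 1) \<le> 1 / 3"
    using \<beta> by (auto simp: field_simps)
  then show "\<rho> powr (2 / 5) \<le> \<epsilon>" "\<epsilon> \<le> \<rho> powr (1 / 3)" "\<delta> \<le> \<rho> powr (1 / 5)" "\<rho> powr (1 / 3) \<le> \<delta>"
    unfolding \<delta>_def \<epsilon>_def using \<rho> by (auto intro: powr_mono')
qed

text \<open>This is \<open>H1\<close> for the actual noise. From
  \<open>\<rho> = \<epsilon>\<^sup>2 * \<delta>\<close> and \<open>\<delta> \<le> 24 * v\<close>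
  follows \<open>sqrt (v * \<rho>) \<le> sqrt 24 * \<epsilon> * v\<close>, and
  \<open>sqrt 24 < 4.9\<close>. As \<open>14 * 4.9 < 70\<close>, the constant
  \<open>1680 = 24 * 70\<close> makes the inequality strict. The lone summand \<rho> is absorbed
  through \<open>\<rho> \<le> v\<close>.\<close>

lemma near_noise_bound:
  fixes \<rho> c0 c1 K \<epsilon> \<delta> v :: real
  assumes \<rho>: "0 < \<rho>" and c0: "0 < c0" and c1: "0 \<le> c1" and K: "1680 * (sqrt c1 + 1) / c0 \<le> K"
    and \<epsilon>: "0 < \<epsilon>" "\<epsilon>\<^sup>2 * \<delta> = \<rho>" and \<delta>: "24 * \<rho> \<le> \<delta>" and v: "\<delta> / 24 \<le> v"
  shows "14 * (sqrt (c1 * v * \<rho>) + \<rho>) < c0 * (K * \<epsilon>) * v / 24"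
proof -
  define b where "b = sqrt c1 + 1"
  have b: "1 \<le> b" using c1 by (simp add: b_def)
  have v0: "0 < v" "\<rho> \<le> v" using v \<delta> \<rho> by auto
  have K0: "1680 * b \<le> K * c0" using K c0 by (simp add: b_def pos_divide_le_eq)
  have "\<rho> = sqrt (\<rho> * \<rho>)" using \<rho> by simp
  also have "\<dots> \<le> sqrt (v * \<rho>)" using v0 \<rho> by (intro real_sqrt_le_mono mult_right_mono) auto
  finally have r1: "\<rho> \<le> sqrt (v * \<rho>)" .
  have "sqrt (c1 * v * \<rho>) + \<rho> \<le> b * sqrt (v * \<rho>)"
    using r1 by (simp add: b_def real_sqrt_mult algebra_simps)
  then have "14 * (sqrt (c1 * v * \<rho>) + \<rho>) \<le> 14 * b * sqrt (v * \<rho>)" by simp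
  also have "sqrt (v * \<rho>) \<le> 4.9 * (\<epsilon> * v)"
  proof (rule real_le_lsqrt)
    have "v * \<rho> = v * \<epsilon>\<^sup>2 * \<delta>" using \<epsilon> by simp
    also have "\<dots> \<le> v * \<epsilon>\<^sup>2 * (24 * v)" using v v0 by (intro mult_left_mono) auto
    also have "\<dots> \<le> (4.9 * (\<epsilon> * v))\<^sup>2" using \<epsilon> by (simp add: power2_eq_square mult_ac)
    finally show "v * \<rho> \<le> (4.9 * (\<epsilon> * v))\<^sup>2" .
  qed (use \<epsilon> v0 in auto)
  then have "14 * b * sqrt (v * \<rho>) \<le> 14 * b * (4.9 * (\<epsilon> * v))" using b by (intro mult_left_mono) auto
  also have "\<dots> < 1680 * b * (\<epsilon> * v) / 24"
    using b \<epsilon> v0 by simp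
  also have "\<dots> \<le> K * c0 * (\<epsilon> * v) / 24"
    using K0 \<epsilon> v0 by (intro divide_right_mono mult_right_mono) auto
  finally show ?thesis by (simp add: mult_ac)
qed

text \<open>The exponent 1/10 is 1/2 - 2/5: the far noise
  \<open>(ln n)\<^sup>2 * sqrt \<rho>\<close> is compared with
  \<open>\<epsilon> \<ge> \<rho> powr (2 / 5)\<close>. The exponent 2/3 is 1 - 1/3, for
  \<open>24 * \<rho> \<le> \<delta>\<close>.\<close>

lemma rho_asymptotics:
  shows "rho \<longlonglongrightarrow> 0" "(\<lambda>n. (ln (real n))\<^sup>2 * rho n powr (1 / 10)) \<longlonglongrightarrow> 0"
    "(\<lambda>n. rho n powr (1 / 3)) \<longlonglongrightarrow> 0" "(\<lambda>n. rho n powr (1 / 5)) \<longlonglongrightarrow> 0" "(\<lambda>n. rho n powr (2 / 3)) \<longlonglongrightarrow> 0"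
  unfolding rho_def[abs_def] by real_asymp+

context log_concave_density
begin

text \<open>A single observation exceeds \<open>m\<close> in modulus with probability of order
  \<open>1 / n ^ 2\<close>, hence some observation does with order \<open>1 / n\<close>. No
  measurability is assumed of \<open>G\<close>; its failure is absorbed in a null event.\<close>

lemma sample_event:
  assumes n: "n \<ge> 3" and M: "prob_space M" and indep: "prob_space.indep_vars M (\<lambda>_. borel) X {..<n}"
    and distr: "\<And>i. i < n \<Longrightarrow> distributed M lborel (X i) (\<lambda>y. ennreal (f y))"
    and tail: "0 < \<alpha>" "0 < K" "\<And>y. f y \<le> K * exp (- \<alpha> * \<bar>y\<bar>)"
    and m: "m = 2 / \<alpha> * ln (real n)"
    and good: "AE \<omega> in M. G \<omega>"
  shows "\<exists>E\<in>sets M. emeasure M E \<le> ennreal (2 * (real n + 2)\<^sup>2 / real n ^ 3 + 2 * K / (\<alpha> * n)) \<and>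
    (\<forall>\<omega>\<in>space M - E. G \<omega> \<and> (\<forall>i<n. \<bar>X i \<omega>\<bar> \<le> m \<and> X i \<omega> \<in> interior {y. 0 < f y}) \<and>
      (\<forall>I. is_interval I \<longrightarrow> \<bar>measure (empirical n (\<lambda>i. X i \<omega>)) I - measure \<nu> I\<bar> \<le>
        14 * (sqrt (measure \<nu> I * rho n) + rho n)))"
proof -
  interpret prob_space M by fact
  have X[measurable]: "random_variable borel (X i)" if "i < n" for i
    using distributed_measurable[OF distr[OF that]] by simp
  have dX: "distr M borel (X i) = \<nu>" if "i < n" for i
  proof -
    have "distr M borel (X i) = distr M lborel (X i)" by (rule distr_cong) auto
    then show ?thesis using distributed_distr_eq_density[OF distr[OF that]] by simp
  qed
  obtain E1 where E1: "E1 \<in> events" "prob E1 \<le> 2 * (real n + 2)\<^sup>2 / real n ^ 3"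
    "\<And>\<omega> I. \<omega> \<in> space M - E1 \<Longrightarrow> is_interval I \<Longrightarrow> \<bar>measure (empirical n (\<lambda>i. X i \<omega>)) I - measure \<nu> I\<bar> \<le>
        14 * (sqrt (measure \<nu> I * rho n) + rho n)"
    using empirical_interval_deviation[OF n indep dX real_distribution_\<nu> atomless] by blast
  define B' where "B' i = {\<omega> \<in> space M. m < \<bar>X i \<omega>\<bar>}" for i
  have B'm[measurable]: "B' i \<in> events" if "i < n" for i unfolding B'_def using that by measurable
  have n0: "0 < real n" "0 \<le> m" using n tail(1) unfolding m by auto
  have pB: "prob (B' i) \<le> 2 * K / \<alpha> * (1 / real n ^ 2)" if i: "i < n" for i
  proof -
    have "{y::real. m < \<bar>y\<bar>} \<in> sets borel" by measurable
    then have "emeasure M (B' i) = emeasure \<nu> {y. m < \<bar>y\<bar>}"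
      unfolding dX[OF i, symmetric] using i
      by (subst emeasure_distr) (auto simp: B'_def intro!: arg_cong[where f = "emeasure M"])
    also have "\<dots> = (\<integral>\<^sup>+ y. ennreal (f y) * indicator {y. m < \<bar>y\<bar>} y \<partial>lborel)"
      by (subst emeasure_density) auto
    also have "\<dots> \<le> ennreal (2 * K / \<alpha> * exp (- \<alpha> * m))"
      using tail n0 by (intro exponential_tail) auto
    also have "exp (- \<alpha> * m) = 1 / real n ^ 2"
    proof -
      have "- \<alpha> * m = - (2 * ln (real n))" using tail(1) by (simp add: m)
      then have "exp (- \<alpha> * m) = exp (- ln (real n)) ^ 2" by (simp add: exp_double[symmetric])
      also have "exp (- ln (real n)) = 1 / real n" using n0 by (simp add: exp_minus inverse_eq_divide)
      finally show ?thesis by (simp add: power_one_over)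
    qed
    finally show ?thesis using tail by (simp add: emeasure_eq_measure)
  qed
  define E2 where "E2 = (\<Union>i\<in>{..<n}. B' i)"
  have E2m[measurable]: "E2 \<in> events" unfolding E2_def by (intro sets.finite_UN) auto
  have "prob E2 \<le> (\<Sum>i\<in>{..<n}. prob (B' i))"
    unfolding E2_def by (intro finite_measure_subadditive_finite) auto
  also have "\<dots> \<le> (\<Sum>i\<in>{..<n}. 2 * K / \<alpha> * (1 / real n ^ 2))" using pB by (intro sum_mono) auto
  also have "\<dots> = 2 * K / (\<alpha> * n)" using n0 by (simp add: power2_eq_square)
  finally have pE2: "prob E2 \<le> 2 * K / (\<alpha> * n)" .
  have "AE \<omega> in M. X i \<omega> \<in> interior {y. 0 < f y}" if "i < n" for i
    using AE_interior unfolding dX[OF that, symmetric] by (rule AE_distrD[OF X[OF that]])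
  then have "AE \<omega> in M. \<forall>i\<in>{..<n}. X i \<omega> \<in> interior {y. 0 < f y}"
    by (intro AE_finite_allI) auto
  with good have "AE \<omega> in M. G \<omega> \<and> (\<forall>i\<in>{..<n}. X i \<omega> \<in> interior {y. 0 < f y})" by eventually_elim simp
  then obtain E3 where E3: "{\<omega> \<in> space M. \<not> (G \<omega> \<and> (\<forall>i\<in>{..<n}. X i \<omega> \<in> interior {y. 0 < f y}))} \<subseteq> E3"
    "emeasure M E3 = 0" "E3 \<in> events" by (rule AE_E)
  define E where "E = E1 \<union> E2 \<union> E3"
  have "prob E \<le> prob (E1 \<union> E2) + prob E3" unfolding E_def using E1 E3 by (intro measure_Un_le) auto
  also have "prob (E1 \<union> E2) \<le> prob E1 + prob E2" using E1 by (intro measure_Un_le) auto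
  also have "prob E3 = 0" using E3 by (simp add: measure_def)
  finally have "prob E \<le> 2 * (real n + 2)\<^sup>2 / real n ^ 3 + 2 * K / (\<alpha> * n)" using E1 pE2 by simp
  then have "emeasure M E \<le> ennreal (2 * (real n + 2)\<^sup>2 / real n ^ 3 + 2 * K / (\<alpha> * n))"
    unfolding emeasure_eq_measure by (rule ennreal_leI)
  moreover have "E \<in> events" using E1 E3 by (simp add: E_def)
  moreover have "G \<omega> \<and> (\<forall>i<n. \<bar>X i \<omega>\<bar> \<le> m \<and> X i \<omega> \<in> interior {y. 0 < f y}) \<and>
      (\<forall>I. is_interval I \<longrightarrow> \<bar>measure (empirical n (\<lambda>i. X i \<omega>)) I - measure \<nu> I\<bar> \<le>
        14 * (sqrt (measure \<nu> I * rho n) + rho n))" if \<omega>: "\<omega> \<in> space M - E" for \<omega>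
  proof (intro conjI allI impI)
    show "G \<omega>" using \<omega> E3(1) by (auto simp: E_def)
    show "\<bar>X i \<omega>\<bar> \<le> m" if "i < n" for i using \<omega> that by (auto simp: E_def E2_def B'_def not_less)
    show "X i \<omega> \<in> interior {y. 0 < f y}" if "i < n" for i using \<omega> that E3(1) by (auto simp: E_def)
    show "\<bar>measure (empirical n (\<lambda>i. X i \<omega>)) I - measure \<nu> I\<bar> \<le> 14 * (sqrt (measure \<nu> I * rho n) + rho n)"
      if "is_interval I" for I using \<omega> that by (intro E1(3)) (auto simp: E_def)
  qed
  ultimately show ?thesis by blast
qed

end

section \<open>Large sample sizes and the conclusion in probability\<close>

lemma eventually_hazard_conditions:
  fixes \<alpha> \<beta> A B r c0 c1 \<gamma> K :: real
  assumes pos: "0 < \<alpha>" "0 < K" "0 < r" "0 < c0" "0 < c1" "0 < \<gamma>" "A < B" and \<beta>: "1 \<le> \<beta>" "\<beta> \<le> 2"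
  shows "\<forall>\<^sub>F n in sequentially. 3 \<le> n \<and> 0 < rho n \<and> rho n \<le> 1 \<and>
    24 * rho n \<le> rho n powr (1 / (2 * \<beta> + 1)) \<and> rho n powr (1 / (2 * \<beta> + 1)) \<le> (B - A) / 4 \<and>
    4 * (K * rho n powr (\<beta> / (2 * \<beta> + 1))) \<le> 1 \<and>
    24 * (2 * (2 / \<alpha> * ln (real n)) + 1)\<^sup>2 * (14 * (sqrt (1 * rho n) + rho n)) <
      c0 * r ^ 3 * (K * rho n powr (\<beta> / (2 * \<beta> + 1))) \<and>
    8 * (K * rho n powr (\<beta> / (2 * \<beta> + 1))) < \<gamma> \<and>
    (c0 + 8 * c1 * (B - A)) * (K * rho n powr (\<beta> / (2 * \<beta> + 1))) \<le> c0 * r / 2"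
proof -
  \<comment> \<open>The thresholds \<open>q1\<close> and \<open>q2\<close> result from solving the
    far condition and the last condition; \<open>672\<close> is \<open>24 * 28\<close>, where 28
    comes from \<open>14 * (sqrt \<rho> + \<rho>) \<le> 28 * sqrt \<rho>\<close>.\<close>
  define q1 where "q1 = c0 * r ^ 3 * K / (672 * (4 / \<alpha> + 1)\<^sup>2)"
  define q2 where "q2 = c0 * r / 2 / ((c0 + 8 * c1 * (B - A)) * K)"
  have s: "0 < c0 + 8 * c1 * (B - A)" using pos by (simp add: add_pos_pos)
  have a: "0 < 4 / \<alpha> + 1" using pos by (simp add: add_pos_pos)
  have q: "0 < q1" "0 < q2" using pos s a by (auto simp: q1_def q2_def)
  have "\<forall>\<^sub>F n in sequentially. rho n < 1" using rho_asymptotics(1) by (rule order_tendstoD) simp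
  moreover have "\<forall>\<^sub>F n in sequentially. (ln (real n))\<^sup>2 * rho n powr (1 / 10) < q1"
    using rho_asymptotics(2) q(1) by (rule order_tendstoD)
  moreover have "\<forall>\<^sub>F n in sequentially. rho n powr (1 / 3) < min (1 / (4 * K)) (min (\<gamma> / (8 * K)) q2)"
    using rho_asymptotics(3) by (rule order_tendstoD) (use pos q in auto)
  moreover have "\<forall>\<^sub>F n in sequentially. rho n powr (1 / 5) < (B - A) / 4"
    using rho_asymptotics(4) by (rule order_tendstoD) (use pos in auto)
  moreover have "\<forall>\<^sub>F n in sequentially. rho n powr (2 / 3) < 1 / 24"
    using rho_asymptotics(5) by (rule order_tendstoD) auto
  moreover have "\<forall>\<^sub>F n in sequentially. 3 \<le> n" by (rule eventually_ge_at_top)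
  ultimately show ?thesis
  proof eventually_elim
    case (elim n)
    define \<rho> \<delta> \<epsilon> where "\<rho> = rho n" and "\<delta> = rho n powr (1 / (2 * \<beta> + 1))" and "\<epsilon> = rho n powr (\<beta> / (2 * \<beta> + 1))"
    have ln1: "1 \<le> ln (real n)"
    proof -
      have "exp 1 \<le> real n" using exp_le elim by linarith
      then show ?thesis using elim by (subst ln_ge_iff) auto
    qed
    have "0 < \<rho>" using elim ln1 by (simp add: \<rho>_def rho_def)
    moreover have "\<rho> \<le> 1" using elim by (simp add: \<rho>_def)
    ultimately have \<rho>: "0 < \<rho>" "\<rho> \<le> 1" .
    note rate = rate_identities[OF \<rho> \<beta>, folded \<rho>_def, unfolded \<rho>_def, folded \<delta>_def \<epsilon>_def, folded \<rho>_def]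
    have \<epsilon>: "\<epsilon> < 1 / (4 * K)" "\<epsilon> < \<gamma> / (8 * K)" "\<epsilon> < q2" using elim rate(4) by (auto simp: \<rho>_def)
    have "24 * \<rho> \<le> \<delta>"
    proof -
      have "\<rho> = \<rho> powr (2 / 3) * \<rho> powr (1 / 3)" using \<rho> by (simp flip: powr_add)
      also have "24 * \<dots> \<le> 1 * \<rho> powr (1 / 3)"
        unfolding mult.assoc[symmetric] using elim by (intro mult_right_mono) (auto simp: \<rho>_def)
      finally show ?thesis using rate(6) by simp
    qed
    moreover have "\<delta> \<le> (B - A) / 4" using elim rate(5) by (simp add: \<rho>_def)
    moreover have "4 * (K * \<epsilon>) \<le> 1" "8 * (K * \<epsilon>) < \<gamma>" using \<epsilon> pos by (auto simp: field_simps)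
    moreover have "(c0 + 8 * c1 * (B - A)) * (K * \<epsilon>) \<le> c0 * r / 2"
    proof -
      have "\<epsilon> * ((c0 + 8 * c1 * (B - A)) * K) \<le> c0 * r / 2"
        using \<epsilon>(3) s pos unfolding q2_def by (subst pos_le_divide_eq[symmetric]) auto
      then show ?thesis by (simp add: mult_ac)
    qed
    moreover have "24 * (2 * (2 / \<alpha> * ln (real n)) + 1)\<^sup>2 * (14 * (sqrt (1 * \<rho>) + \<rho>)) < c0 * r ^ 3 * (K * \<epsilon>)"
    proof -
      have sq: "sqrt \<rho> = \<rho> powr (1 / 10) * \<rho> powr (2 / 5)" using \<rho> by (simp add: powr_half_sqrt[symmetric] flip: powr_add)
      have "\<rho> \<le> sqrt \<rho>"
      proof -
        have "\<rho> = sqrt (\<rho> * \<rho>)" using \<rho> by simp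
        also have "\<dots> \<le> sqrt (\<rho> * 1)" using \<rho> by (intro real_sqrt_le_mono mult_left_mono) auto
        finally show ?thesis by simp
      qed
      then have 1: "14 * (sqrt (1 * \<rho>) + \<rho>) \<le> 28 * (\<rho> powr (1 / 10) * \<rho> powr (2 / 5))" using sq by simp
      have "2 * (2 / \<alpha> * ln (real n)) + 1 \<le> (4 / \<alpha> + 1) * ln (real n)" using ln1 by (simp add: distrib_right)
      then have 2: "(2 * (2 / \<alpha> * ln (real n)) + 1)\<^sup>2 \<le> ((4 / \<alpha> + 1) * ln (real n))\<^sup>2"
        using ln1 pos by (intro power_mono) auto
      have "24 * (2 * (2 / \<alpha> * ln (real n)) + 1)\<^sup>2 * (14 * (sqrt (1 * \<rho>) + \<rho>)) \<le>
          24 * ((4 / \<alpha> + 1) * ln (real n))\<^sup>2 * (28 * (\<rho> powr (1 / 10) * \<rho> powr (2 / 5)))"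
        using \<rho> by (intro mult_mono[OF mult_left_mono[OF 2] 1]) auto
      also have "\<dots> = 672 * (4 / \<alpha> + 1)\<^sup>2 * ((ln (real n))\<^sup>2 * \<rho> powr (1 / 10)) * \<rho> powr (2 / 5)"
        by (simp add: power_mult_distrib mult_ac)
      also have "\<dots> < 672 * (4 / \<alpha> + 1)\<^sup>2 * q1 * \<rho> powr (2 / 5)"
        using elim \<rho> a by (intro mult_strict_right_mono mult_strict_left_mono) (auto simp: \<rho>_def)
      also have "\<dots> = c0 * r ^ 3 * K * \<rho> powr (2 / 5)" using a by (simp add: q1_def)
      also have "\<dots> \<le> c0 * r ^ 3 * K * \<epsilon>" using rate(3) pos by (intro mult_left_mono) auto
      finally show ?thesis by (simp add: mult.assoc)
    qed
    ultimately show ?case using elim \<rho> by (simp add: \<rho>_def \<delta>_def \<epsilon>_def)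
  qed
qed

text \<open>One constant works off events of vanishing probability, so the limsup is already zero
  for every larger constant. Covering by \<open>E\<close> bounds the outer measure without any
  measurability of \<open>Z n\<close>.\<close>

lemma bounded_in_prob_if_eventually_bounded:
  assumes bound: "\<forall>\<^sub>F n in sequentially. \<exists>E\<in>sets (M n). emeasure (M n) E \<le> ennreal (p n) \<and>
      (\<forall>\<omega>\<in>space (M n) - E. \<bar>Z n \<omega>\<bar> \<le> ereal (K * a n))"
    and p: "p \<longlonglongrightarrow> 0" and a: "\<And>n. 0 \<le> a n"
  shows "bounded_in_prob M Z a"
  unfolding bounded_in_prob_def
proof (rule tendsto_eventually, rule eventually_at_top_linorderI[of K])
  fix k :: real assume k: "K \<le> k"
  have "limsup (\<lambda>n. outer_measure_of (M n) {\<omega> \<in> space (M n). \<bar>Z n \<omega>\<bar> > ereal (k * a n)}) \<le> limsup (\<lambda>n. ennreal (p n))"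
  proof (rule Limsup_mono)
    show "\<forall>\<^sub>F n in sequentially. outer_measure_of (M n) {\<omega> \<in> space (M n). \<bar>Z n \<omega>\<bar> > ereal (k * a n)} \<le> ennreal (p n)"
      using bound
    proof eventually_elim
      case (elim n)
      then obtain E where E: "E \<in> sets (M n)" "emeasure (M n) E \<le> ennreal (p n)"
        "\<And>\<omega>. \<omega> \<in> space (M n) - E \<Longrightarrow> \<bar>Z n \<omega>\<bar> \<le> ereal (K * a n)" by blast
      have "{\<omega> \<in> space (M n). \<bar>Z n \<omega>\<bar> > ereal (k * a n)} \<subseteq> E"
      proof
        fix \<omega> assume \<omega>: "\<omega> \<in> {\<omega> \<in> space (M n). \<bar>Z n \<omega>\<bar> > ereal (k * a n)}"
        show "\<omega> \<in> E"
        proof (rule ccontr)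
          assume "\<omega> \<notin> E"
          then have "\<bar>Z n \<omega>\<bar> \<le> ereal (K * a n)" using \<omega> by (intro E(3)) auto
          also have "\<dots> \<le> ereal (k * a n)" using k a by (simp add: mult_right_mono)
          finally show False using \<omega> by auto
        qed
      qed
      then have "outer_measure_of (M n) {\<omega> \<in> space (M n). \<bar>Z n \<omega>\<bar> > ereal (k * a n)} \<le> outer_measure_of (M n) E"
        by (rule outer_measure_of_mono)
      also have "\<dots> \<le> ennreal (p n)" using E by simp
      finally show ?case .
    qed
  qed
  also have "limsup (\<lambda>n. ennreal (p n)) = 0"
    using tendsto_ennrealI[OF p] by (intro lim_imp_Limsup) auto
  finally show "limsup (\<lambda>n. outer_measure_of (M n) {\<omega> \<in> space (M n). \<bar>Z n \<omega>\<bar> > ereal (k * a n)}) = 0" by simp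
qed

theorem corollary4p5:
  fixes \<phi> :: "real \<Rightarrow> ereal" and f :: "real \<Rightarrow> real"
    and M :: "nat \<Rightarrow> 'a measure"
    and X :: "nat \<Rightarrow> nat \<Rightarrow> 'a \<Rightarrow> real"
    and \<phi>_hat :: "nat \<Rightarrow> 'a \<Rightarrow> real \<Rightarrow> ereal"
    and A B \<beta> L C :: real
    and D :: "real \<Rightarrow> real"
  assumes "ext_concave \<phi>"
    and "f = (\<lambda>x. ext_exp (\<phi> x))"
    and "(\<integral>\<^sup>+ x. ennreal (f x) \<partial>lborel) = 1"
    and "\<And>n. n > 1 \<Longrightarrow> prob_space (M n)"
    and "\<And>n. n > 1 \<Longrightarrow> prob_space.indep_vars (M n) (\<lambda>_. borel) (X n) {..<n}"
    and "\<And>n i. n > 1 \<Longrightarrow> i < n \<Longrightarrow> distributed (M n) lborel (X n i) (\<lambda>x. ennreal (f x))"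
    and "\<And>n. n > 1 \<Longrightarrow> AE \<omega> in M n. is_log_concave_mle n (\<lambda>i. X n i \<omega>) (\<phi>_hat n \<omega>)"
    and "1 \<le> \<beta>" and "\<beta> \<le> 2" and "L > 0"
    and "A < B" and "{A..B} \<subseteq> interior {x. f x > 0}"
    and "(\<lambda>x. real_of_ereal (\<phi> x)) \<in> holder_class \<beta> L {A..B}"
    and "C > 0"
    and "D = left_deriv (\<lambda>x. real_of_ereal (\<phi> x)) \<or> D = right_deriv (\<lambda>x. real_of_ereal (\<phi> x))"
    and "\<And>x y. A \<le> x \<Longrightarrow> x < y \<Longrightarrow> y \<le> B \<Longrightarrow> D x - D y \<ge> C * (y - x)"
  shows "bounded_in_prob M
    (\<lambda>n \<omega>. hazard_error (largest_obs n (\<lambda>i. X n i \<omega>)) (\<lambda>x. ext_exp (\<phi>_hat n \<omega> x)) f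
              (T_shrunk A B n \<beta>))
    (\<lambda>n. rho n powr (\<beta> / (2 * \<beta> + 1)))"
proof -
  let ?S = "{y. 0 < f y}"
  let ?ph = "\<lambda>y. real_of_ereal (\<phi> y)"
  note f_eq = assms(2)
  have supp: "?S = {y. \<phi> y \<noteq> -\<infinity>}" by (auto simp: f_eq ext_exp_pos_iff)
  have ph_conc: "concave_on ?S ?ph" unfolding supp by (rule ext_concave_imp_concave_on[OF assms(1)])
  have iv: "is_interval ?S" using concave_on_imp_convex[OF ph_conc] by (simp add: is_interval_convex_1)
  have "A \<in> interior ?S" "B \<in> interior ?S" using assms(11,12) by auto
  then obtain r1 r2 where r12: "0 < r1" "cball A r1 \<subseteq> ?S" "0 < r2" "cball B r2 \<subseteq> ?S"
    unfolding mem_interior_cball by blast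
  \<comment> \<open>A margin that still belongs to the support; the cap \<open>1\<close> allows
    comparison of powers of \<open>r\<close>.\<close>
  define r where "r = min 1 (min r1 r2)"
  have r: "0 < r" "r \<le> 1" "r \<le> r1" "r \<le> r2" using r12 by (auto simp: r_def)
  have "A - r \<in> cball A r1" "B + r \<in> cball B r2" using r by (auto simp: dist_real_def)
  then have "A - r \<in> ?S" "B + r \<in> ?S" using r12 by blast+
  then have ends: "0 < f (A - r)" "0 < f (B + r)" by auto
  have sub: "{A - r..B + r} \<subseteq> ?S"
    using mem_is_interval_1_I[OF iv, of "A - r" "B + r"] ends by auto
  \<comment> \<open>On an interval a log-concave density is smallest at one of the end
    points.\<close>
  define c0 where "c0 = min (f (A - r)) (f (B + r))"
  have c0: "0 < c0" using ends by (simp add: c0_def)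
  have f_exp: "f y = exp (?ph y)" if "0 < f y" for y using that by (auto simp: f_eq ext_exp_def split: if_splits)
  have f_ge: "c0 \<le> f y" if y: "y \<in> {A - r..B + r}" for y
  proof -
    define w where "w = min (?ph (A - r)) (?ph (B + r))"
    have "(B + r - (A - r)) * w = (B + r - y) * w + (y - (A - r)) * w" by (simp add: algebra_simps)
    also have "\<dots> \<le> (B + r - y) * ?ph (A - r) + (y - (A - r)) * ?ph (B + r)"
      using y by (intro add_mono mult_left_mono) (auto simp: w_def)
    also have "\<dots> \<le> (B + r - (A - r)) * ?ph y"
      using y ends by (intro concave_on_three_points[OF ph_conc]) auto
    finally have "w \<le> ?ph y" using assms(11) r by simp
    then have "exp w \<le> f y" using f_exp[of y] sub y by auto
    moreover have "c0 = exp w" using f_exp[OF ends(1)] f_exp[OF ends(2)] by (simp add: c0_def w_def min_def)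
    ultimately show ?thesis by simp
  qed
  have "A \<in> {A - r..B + r}" "B \<in> {A - r..B + r}" using r assms(11) by auto
  then have "\<phi> A \<noteq> -\<infinity>" "\<phi> B \<noteq> -\<infinity>" using sub unfolding supp by blast+
  then obtain \<alpha> c1 where tail: "0 < \<alpha>" "0 < c1" "\<And>y. f y \<le> c1 * exp (- \<alpha> * \<bar>y\<bar>)"
    using log_concave_tail[OF assms(1), of A B] assms(3,11) unfolding f_eq by auto
  \<comment> \<open>The constant of the tail bound doubles as an upper bound of the density.\<close>
  have f_le: "f y \<le> c1" for y
  proof -
    have "c1 * exp (- \<alpha> * \<bar>y\<bar>) \<le> c1 * 1" using tail(1,2) by (intro mult_left_mono) auto
    then show ?thesis using tail(3)[of y] by simp
  qed
  interpret log_concave_density \<phi> f A B r c0 c1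
    using assms(1-3,11) r sub c0 f_ge f_le by unfold_locales auto
  define a b where "a = A + (B - A) / 4" and "b = B - (B - A) / 4"
  define w where "w = (B - A) / 4"
  have "4 * w = B - A" unfolding w_def by simp
  then have "B = A + 4 * w" by simp
  moreover have "0 < w" using assms(11) unfolding w_def by simp
  ultimately have ab: "A \<le> a" "a < b" "b \<le> B" unfolding a_def b_def w_def[symmetric] by auto
  define \<gamma> where "\<gamma> = ?ph ((a + b) / 2) - (?ph a + ?ph b) / 2"
  have "(?ph a + ?ph b) / 2 < ?ph ((a + b) / 2)"
  proof (rule strict_midpoint_concavity[OF _ ab(2) assms(15)])
    have "{a..b} \<subseteq> {A - r..B + r}" using ab r by auto
    then have "{a..b} \<subseteq> ?S" using sub by (rule order_trans)
    then show "concave_on {a..b} ?ph" by (rule concave_on_mono[OF ph_conc]) simp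
    show "0 < D y - D z" if "a \<le> y" "y < z" "z \<le> b" for y z
    proof -
      have "0 < C * (z - y)" using assms(14) that by simp
      also have "\<dots> \<le> D y - D z" using that ab by (intro assms(16)) auto
      finally show ?thesis .
    qed
  qed
  then have \<gamma>: "0 < \<gamma>" by (simp add: \<gamma>_def)
  \<comment> \<open>\<open>L\<close> dominates the error of the tangent, the other term the noise in
    \<open>near_noise_bound\<close>; thus \<open>e = K * \<epsilon>\<close> serves for both.\<close>
  define K where "K = max L (1680 * (sqrt c1 + 1) / c0)"
  have K: "0 < K" "L \<le> K" "1680 * (sqrt c1 + 1) / c0 \<le> K" using assms(10) by (auto simp: K_def)
  define Q where "Q = 16 * c1 / (c0 * r) + 2 * c1 * (c0 + 8 * c1 * (B - A)) / (c0 * r)\<^sup>2"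
  show ?thesis
  proof (rule bounded_in_prob_if_eventually_bounded[where K = "Q * K" and
        p = "\<lambda>n. 2 * (real n + 2)\<^sup>2 / real n ^ 3 + 2 * c1 / (\<alpha> * real n)"])
    show "(\<lambda>n. 2 * (real n + 2)\<^sup>2 / real n ^ 3 + 2 * c1 / (\<alpha> * real n)) \<longlonglongrightarrow> 0"
      using tail(1,2) by real_asymp
    show "\<forall>\<^sub>F n in sequentially. \<exists>E\<in>sets (M n).
        emeasure (M n) E \<le> ennreal (2 * (real n + 2)\<^sup>2 / real n ^ 3 + 2 * c1 / (\<alpha> * real n)) \<and>
        (\<forall>\<omega>\<in>space (M n) - E. \<bar>hazard_error (largest_obs n (\<lambda>i. X n i \<omega>)) (\<lambda>x. ext_exp (\<phi>_hat n \<omega> x)) f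
              (T_shrunk A B n \<beta>)\<bar> \<le> ereal (Q * K * rho n powr (\<beta> / (2 * \<beta> + 1))))"
      using eventually_hazard_conditions[OF tail(1) K(1) r(1) c0 tail(2) \<gamma> assms(11,8,9)]
    proof eventually_elim
      case (elim n)
      define \<delta> \<epsilon> where "\<delta> = rho n powr (1 / (2 * \<beta> + 1))" and "\<epsilon> = rho n powr (\<beta> / (2 * \<beta> + 1))"
      have n: "3 \<le> n" "1 < n" "0 < n" using elim by auto
      have \<rho>: "0 < rho n" "rho n \<le> 1" using elim by auto
      note rate = rate_identities[OF \<rho> assms(8,9), folded \<delta>_def \<epsilon>_def]
      have pos: "0 < \<delta>" "0 < \<epsilon>" using \<rho> by (auto simp: \<delta>_def \<epsilon>_def)
      obtain E where E: "E \<in> sets (M n)"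
        "emeasure (M n) E \<le> ennreal (2 * (real n + 2)\<^sup>2 / real n ^ 3 + 2 * c1 / (\<alpha> * real n))"
        "\<And>\<omega>. \<omega> \<in> space (M n) - E \<Longrightarrow> is_log_concave_mle n (\<lambda>i. X n i \<omega>) (\<phi>_hat n \<omega>)"
        "\<And>\<omega> i. \<omega> \<in> space (M n) - E \<Longrightarrow> i < n \<Longrightarrow> \<bar>X n i \<omega>\<bar> \<le> 2 / \<alpha> * ln (real n) \<and> X n i \<omega> \<in> interior ?S"
        "\<And>\<omega> I. \<omega> \<in> space (M n) - E \<Longrightarrow> is_interval I \<Longrightarrow>
          \<bar>measure (empirical n (\<lambda>i. X n i \<omega>)) I - measure \<nu> I\<bar> \<le> 14 * (sqrt (measure \<nu> I * rho n) + rho n)"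
        using sample_event[OF n(1) assms(4)[OF n(2)] assms(5)[OF n(2)] assms(6)[OF n(2)] tail refl assms(7)[OF n(2)]]
        by blast
      have "\<bar>hazard_error (largest_obs n (\<lambda>i. X n i \<omega>)) (\<lambda>x. ext_exp (\<phi>_hat n \<omega> x)) f (T_shrunk A B n \<beta>)\<bar> \<le>
          ereal (Q * K * rho n powr (\<beta> / (2 * \<beta> + 1)))" if \<omega>: "\<omega> \<in> space (M n) - E" for \<omega>
      proof -
        \<comment> \<open>With \<open>d = \<delta> / 24\<close> the interval treated by
          \<open>hazard_error_le\<close> is precisely \<open>T_shrunk\<close>.\<close>
        have T: "T_shrunk A B n \<beta> = {A + 24 * (\<delta> / 24)..B - 24 * (\<delta> / 24)}" by (simp add: T_shrunk_def \<delta>_def)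
        have "\<bar>hazard_error (largest_obs n (\<lambda>i. X n i \<omega>)) (\<lambda>x. ext_exp (\<phi>_hat n \<omega> x)) f (T_shrunk A B n \<beta>)\<bar> \<le>
            ereal (Q * (K * \<epsilon>))"
          unfolding T Q_def
        proof (rule hazard_error_le[OF n(3) E(3)[OF \<omega>] E(5)[OF \<omega>] less_imp_le[OF \<rho>(1)],
              where m = "2 / \<alpha> * ln (real n)" and d = "\<delta> / 24" and e = "K * \<epsilon>"])
          show "14 * (sqrt (c1 * v * rho n) + rho n) < c0 * (K * \<epsilon>) * v / 24" if "\<delta> / 24 \<le> v" for v
            using elim tail(2) by (intro near_noise_bound[OF \<rho>(1) c0 _ K(3) pos(2) rate(2) _ that]) (auto simp: \<delta>_def)
          show "\<exists>k. \<forall>y\<in>{A..B}. \<bar>y - z\<bar> \<le> 24 * (\<delta> / 24) \<longrightarrow> \<bar>?ph y - ?ph z - k * (y - z)\<bar> \<le> K * \<epsilon>"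
            if z: "z \<in> {A..B}" for z
          proof -
            obtain k where k: "\<And>y. y \<in> {A..B} \<Longrightarrow> \<bar>?ph y - ?ph z - k * (y - z)\<bar> \<le> L * \<bar>y - z\<bar> powr \<beta>"
              using holder_class_tangent[OF assms(13,8) less_imp_le[OF assms(10)] z] by blast
            have "\<bar>?ph y - ?ph z - k * (y - z)\<bar> \<le> K * \<epsilon>" if y: "y \<in> {A..B}" "\<bar>y - z\<bar> \<le> 24 * (\<delta> / 24)" for y
            proof -
              have "L * \<bar>y - z\<bar> powr \<beta> \<le> K * \<delta> powr \<beta>"
                using y K assms(8,10) by (intro mult_mono powr_mono2) auto
              then show ?thesis using k[OF y(1)] rate(1) by simp
            qed
            then show ?thesis by blast
          qed
          show "(?ph (A + (B - A) / 4) + ?ph (B - (B - A) / 4)) / 2 + 8 * (K * \<epsilon>)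
              < ?ph ((A + (B - A) / 4 + (B - (B - A) / 4)) / 2)"
            using elim unfolding \<gamma>_def a_def b_def \<epsilon>_def by linarith
        qed (use elim E(4)[OF \<omega>] pos K(1) in \<open>auto simp: \<delta>_def \<epsilon>_def\<close>)
        then show ?thesis by (simp add: \<epsilon>_def mult.assoc)
      qed
      then show ?case using E(1,2) by blast
    qed
  qed simp
qed

end
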